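(* Let $A, B \in \mathbb{R}^{2\times 2}$, and suppose $b := \lambda_{\min}\left(\frac{B+B^T}{2}\right) > 0$. Let $f:[0,\infty)\to\mathbb{R}^2$ be absolutely integrable on $[0,\infty)$ and let $g:[0,\infty)\to\mathbb{R}^2$ be continuous. Consider the problem, for an unknown $u(z,t)\in\mathbb{R}^2$, $$\frac{\partial u}{\partial t}(z,t) = A\,u(z,t) + B\,\frac{\partial^2 u}{\partial z^2}(z,t), \quad z>0,\ t>0,$$ $$u(z,0) = f(z), \quad z>0,$$ $$\frac{\partial u}{\partial z}(0,t) = g(t), \quad t>0,$$ $$\lim_{z\to\infty} u(z,t) = 0, \qquad \lim_{z\to\infty} \frac{\partial u}{\partial z}(z,t) = 0.$$ Put $F(\omega) = \int_0^\infty f(z)\cos(\omega z)\,dz$ for $\omega\ge 0$, and $c(s) = B g(s)$. Define $$u(z,t) = \frac{2}{\pi}(I_1 - I_2),$$ where $$I_1 = \int_0^\infty e^{(A-\omega^2B)t}F(\omega)\cos(\omega z)\,d\omega, \qquad I_2 = \int_0^\infty\left(\int_0^t e^{(A-\omega^2B)(t-s)}c(s)\cos(\omega z)\,ds\right)d\omega,$$ and, for $R>0$, $z>0$, $t>0$, $$u_R(z,t) = \frac{2}{\pi}\bigl(I_1(R) - I_2(R)\bigr),$$ where $$I_1(R) = \int_0^R e^{(A-\omega^2B)t}F(\omega)\cos(\omega z)\,d\omega, \qquad I_2(R) = \int_0^R\left(\int_0^t e^{(A-\omega^2B)(t-s)}c(s)\cos(\omega z)\,ds\right)d\omega.$$ Then: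 (i) $u(z,t)$ is a solution of the problem consisting of the equation $\frac{\partial u}{\partial t}(z,t) = A\,u(z,t) + B\,\frac{\partial^2 u}{\partial z^2}(z,t)$ for $z>0$, $t>0$, the initial condition $u(z,0) = f(z)$ for $z>0$, the boundary condition $\frac{\partial u}{\partial z}(0,t) = g(t)$ for $t>0$, and the conditions $\lim_{z\to\infty} u(z,t) = 0$ and $\lim_{z\to\infty} \frac{\partial u}{\partial z}(z,t) = 0$; (ii) $u_R(z,t)$ converges, as $R\to\infty$, to $u(z,t)$ uniformly for $z>0$ and pointwise at each $(z,t)\in\mathbb{R}^+\times\mathbb{R}^+$.
   Context: For a real symmetric matrix $S$, $\lambda_{\min}(S)$ denotes its smallest eigenvalue. Integrals of vector-valued functions are taken componentwise, and $\mathbb{R}^+ = (0,\infty)$. The matrices $A,B$ and the functions $f,g$ are the deterministic realizations, for one fixed event $\xi$ of the underlying probability space, of random matrices and stochastic processes; after fixing the event, everything is deterministic.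
   Formalization: The initial condition u(z,0)=f(z), false at every z for merely integrable f, is proved as u(z,t)→f(z) when t→0+ for almost every z>0 and every continuity point of f; the formula at t=0 equals f(z) at such z wherever its integral converges. *)

theory Defs
  imports "HOL-Analysis.Analysis"
begin

definition eigenvalues :: "real^'n^'n \<Rightarrow> real set" where
  "eigenvalues S = {l. \<exists>v. v \<noteq> 0 \<and> S *v v = l *\<^sub>R v}"

text \<open>Intended for symmetric matrices, whose set of real eigenvalues is finite and nonempty.\<close>

definition lambda_min :: "real^'n^'n \<Rightarrow> real" where
  "lambda_min S = Min (eigenvalues S)"

text \<open>The class-based \<^const>\<open>exp\<close> is not available for square matrices: multiplication
  on the type \<^typ>\<open>real^'n^'n\<close> is componentwise, so the exponential series is written with \<open>**\<close>.\<close>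

primrec mat_power :: "real^'n^'n \<Rightarrow> nat \<Rightarrow> real^'n^'n" where
  "mat_power M 0 = mat 1"
| "mat_power M (Suc k) = M ** mat_power M k"

definition mat_exp :: "real^'n^'n \<Rightarrow> real^'n^'n" where
  "mat_exp M = (\<Sum>k. (1 / fact k) *\<^sub>R mat_power M k)"

text \<open>All integrals are Henstock--Kurzweil integrals. Over \<open>{0..}\<close> they coincide with the improper
  integrals (limits of integrals over \<open>{0..R}\<close>), so that conditional convergence is
  admitted.\<close>

definition cos_transform :: "(real \<Rightarrow> real^2) \<Rightarrow> real \<Rightarrow> real^2" where
  "cos_transform f \<omega> = integral {0..} (\<lambda>z. cos (\<omega> * z) *\<^sub>R f z)"

definition integrand1 :: "real^2^2 \<Rightarrow> real^2^2 \<Rightarrow> (real \<Rightarrow> real^2) \<Rightarrow> real \<Rightarrow> real \<Rightarrow> real \<Rightarrow> real^2" where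
  "integrand1 A B f z t \<omega> =
     cos (\<omega> * z) *\<^sub>R (mat_exp (t *\<^sub>R (A - \<omega>\<^sup>2 *\<^sub>R B)) *v cos_transform f \<omega>)"

definition integrand2 :: "real^2^2 \<Rightarrow> real^2^2 \<Rightarrow> (real \<Rightarrow> real^2) \<Rightarrow> real \<Rightarrow> real \<Rightarrow> real \<Rightarrow> real^2" where
  "integrand2 A B g z t \<omega> =
     integral {0..t} (\<lambda>s. cos (\<omega> * z) *\<^sub>R (mat_exp ((t - s) *\<^sub>R (A - \<omega>\<^sup>2 *\<^sub>R B)) *v (B *v g s)))"

definition u_sol :: "real^2^2 \<Rightarrow> real^2^2 \<Rightarrow> (real \<Rightarrow> real^2) \<Rightarrow> (real \<Rightarrow> real^2) \<Rightarrow> real \<Rightarrow> real \<Rightarrow> real^2" where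
  "u_sol A B f g z t =
     (2 / pi) *\<^sub>R (integral {0..} (integrand1 A B f z t) - integral {0..} (integrand2 A B g z t))"

definition u_trunc ::
  "real^2^2 \<Rightarrow> real^2^2 \<Rightarrow> (real \<Rightarrow> real^2) \<Rightarrow> (real \<Rightarrow> real^2) \<Rightarrow> real \<Rightarrow> real \<Rightarrow> real \<Rightarrow> real^2" where
  "u_trunc A B f g R z t =
     (2 / pi) *\<^sub>R (integral {0..R} (integrand1 A B f z t) - integral {0..R} (integrand2 A B g z t))"

text \<open>An integrable initial datum matters only up to null sets, so no identity involving
  its values can hold at every single point. Pointwise statements about \<open>f\<close> are therefore
  required almost everywhere and, in addition, at every point of continuity of \<open>f\<close> (hence
  everywhere if \<open>f\<close> is continuous).\<close>

definition essentially_everywhere :: "(real \<Rightarrow> real^2) \<Rightarrow> (real \<Rightarrow> bool) \<Rightarrow> bool" where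
  "essentially_everywhere f P \<longleftrightarrow>
     (AE z in lebesgue. 0 < z \<longrightarrow> P z) \<and> (\<forall>z>0. isCont f z \<longrightarrow> P z)"

text \<open>The derivative at the boundary point \<open>z = 0\<close> is one-sided, and the initial datum is
  attained as \<open>t\<close> decreases to \<open>0\<close>.\<close>

definition solves_problem ::
  "real^2^2 \<Rightarrow> real^2^2 \<Rightarrow> (real \<Rightarrow> real^2) \<Rightarrow> (real \<Rightarrow> real^2) \<Rightarrow> (real \<Rightarrow> real \<Rightarrow> real^2) \<Rightarrow> bool" where
  "solves_problem A B f g u \<longleftrightarrow>
     (\<exists>ut uz uzz.
        (\<forall>z>0. \<forall>t>0.
           ((\<lambda>t. u z t) has_vector_derivative ut z t) (at t) \<and>
           ((\<lambda>z. u z t) has_vector_derivative uz z t) (at z) \<and>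
           ((\<lambda>z. uz z t) has_vector_derivative uzz z t) (at z) \<and>
           ut z t = A *v u z t + B *v uzz z t) \<and>
        essentially_everywhere f (\<lambda>z. ((\<lambda>t. u z t) \<longlongrightarrow> f z) (at_right 0)) \<and>
        (\<forall>t>0. ((\<lambda>z. u z t) has_vector_derivative g t) (at 0 within {0..})) \<and>
        (\<forall>t>0. ((\<lambda>z. u z t) \<longlongrightarrow> 0) at_top \<and> ((\<lambda>z. uz z t) \<longlongrightarrow> 0) at_top))"

end

theory Submission
  imports Defs "HOL-Probability.Sinc_Integral"
begin

text \<open>Write \<open>E(\<omega>, t)\<close> for the exponential of \<open>t (A - \<omega>\<^sup>2 B)\<close>. Coercivity of \<open>B\<close> and an energy
  estimate bound \<open>E\<close>, and Duhamel's formula bounds its derivatives \<open>E'\<close>, \<open>E''\<close> in \<open>\<omega>\<close>, by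
  \<open>exp (- \<kappa> \<omega>\<^sup>2 t)\<close> times the powers of \<open>\<omega>\<close> that scaling predicts. For \<open>t > 0\<close> the first integral
  may therefore be differentiated under the integral sign.

  The density \<open>G(\<omega>, t)\<close> of the second integral decays only like \<open>1 / \<omega>\<^sup>2\<close>. For \<open>z > 0\<close> two
  integrations by parts replace it by \<open>- G'' / z\<^sup>2\<close>, which decays like \<open>1 / \<omega>\<^sup>4\<close>, so two
  derivatives in \<open>z\<close> and one in \<open>t\<close> become legitimate. At \<open>z = 0\<close> the difference quotient is the
  mean of \<open>\<omega>\<^sup>2 G(\<omega>, t)\<close> against the Fejer kernel, and \<open>\<omega>\<^sup>2 G(\<omega>, t)\<close> tends to \<open>g t\<close>.

  For the initial condition, Fejer's theorem gives the Cesaro means of the inverse cosine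
  integral of \<open>f\<close> at each Lebesgue point, and two integrations by parts write the first integral
  as a weighted average of these means with weight \<open>\<omega> E''(\<omega>, t)\<close>.\<close>



subsection \<open>Matrix products and the matrix exponential\<close>

text \<open>Neither datum is regular enough for the formal computation. For \<open>f\<close> merely
  integrable, the inverse cosine integral may diverge at a given point, so only its averages can be
  expected to recover \<open>f z\<close>. For \<open>g\<close> merely continuous, two z-derivatives
  under the second integral would produce \<omega>^2 G(\<omega>, t), which tends to
  \<open>g t\<close> and hence is not integrable when \<open>g t\<close> is nonzero; the time
  derivative of G contains the undamped source. Passing to G'' cures both at once: it gains two
  powers of \<omega>, and since E'' vanishes at time 0, its time derivative contains no source. A
  and B need not commute, so E has no simple closed derivative in \<omega>. Duhamel's formula is
  therefore used in the parameter \<mu> = \<omega>^2, and the chain rule returns to \<omega>. As E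
  depends on \<omega> only through \<omega>^2, its first derivative vanishes at \<omega> = 0, which
  removes the boundary term when G is integrated by parts. The rate \<kappa> is a quarter of the
  coercivity constant: the other three quarters absorb powers of \<omega>^2 t.\<close>

lemma inner_column_matrix: "inner X Y = (\<Sum>j\<in>UNIV. inner (column j X) (column j Y))"
  for X Y :: "real^'n^'m"
  unfolding inner_vec_def column_def by (simp add: sum.swap[of _ "UNIV::'n set"])

lemma column_matrix_mult: "column j (X ** Y) = X *v column j Y"
  for X :: "real^'n^'m"
  by (simp add: column_def matrix_matrix_mult_def matrix_vector_mult_def)

text \<open>The norm on this type is the Frobenius norm. Each entry of the product is the inner
  product of a row and a column, so Cauchy-Schwarz on every entry and summation give
  submultiplicativity.\<close>

lemma norm_matrix_mult_le: "norm (X ** Y) \<le> norm X * norm Y"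
  for X :: "real^'n^'m" and Y :: "real^'p^'n"
proof -
  have "(norm (X ** Y))\<^sup>2 = (\<Sum>i\<in>UNIV. \<Sum>j\<in>UNIV. (inner (X$i) (column j Y))\<^sup>2)"
    unfolding power2_norm_eq_inner inner_vec_def
    by (simp add: matrix_matrix_mult_def column_def power2_eq_square)
  also have "\<dots> \<le> (\<Sum>i\<in>UNIV. \<Sum>j\<in>UNIV. inner (X$i) (X$i) * inner (column j Y) (column j Y))"
    by (intro sum_mono Cauchy_Schwarz_ineq)
  also have "\<dots> = inner X X * inner Y Y"
    unfolding inner_column_matrix[of Y] by (simp add: inner_vec_def[of X] sum_product)
  also have "\<dots> = (norm X * norm Y)\<^sup>2"
    by (simp add: power_mult_distrib power2_norm_eq_inner)
  finally show ?thesis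
    by (rule power2_le_imp_le) simp
qed

lemma norm_matrix_vector_mult_le: "norm (X *v y) \<le> norm X * norm y"
  for X :: "real^'n^'m"
proof -
  have "(norm (X *v y))\<^sup>2 = (\<Sum>i\<in>UNIV. (inner (X$i) y)\<^sup>2)"
    unfolding power2_norm_eq_inner inner_vec_def[of "X *v y"]
    by (simp add: matrix_vector_mul_component power2_eq_square)
  also have "\<dots> \<le> (\<Sum>i\<in>UNIV. inner (X$i) (X$i) * inner y y)"
    by (intro sum_mono Cauchy_Schwarz_ineq)
  also have "\<dots> = (norm X * norm y)\<^sup>2"
    by (simp add: power_mult_distrib power2_norm_eq_inner inner_vec_def[of X] sum_distrib_right)
  finally show ?thesis
    by (rule power2_le_imp_le) simp
qed

lemma bounded_bilinear_matrix_mult: "bounded_bilinear ((**) :: real^'n^'m \<Rightarrow> real^'p^'n \<Rightarrow> real^'p^'m)"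
proof (unfold_locales, goal_cases)
  case (2 a b c) show ?case by (simp add: matrix_add_ldistrib)
next
  case (5) show ?case by (rule exI[of _ 1]) (simp add: norm_matrix_mult_le)
qed (auto simp: matrix_matrix_mult_def vec_eq_iff sum_distrib_left algebra_simps sum.distrib)

lemma bounded_bilinear_matrix_vector_mult: "bounded_bilinear ((*v) :: real^'n^'m \<Rightarrow> real^'n \<Rightarrow> real^'m)"
proof (unfold_locales, goal_cases)
  case (5) show ?case by (rule exI[of _ 1]) (simp add: norm_matrix_vector_mult_le)
qed (auto simp: matrix_vector_mult_def vec_eq_iff sum_distrib_left algebra_simps sum.distrib)

interpretation matrix_mult: bounded_bilinear "(**) :: real^'n^'m \<Rightarrow> real^'p^'n \<Rightarrow> real^'p^'m"
  by (rule bounded_bilinear_matrix_mult)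

interpretation matrix_vector_mult: bounded_bilinear "(*v) :: real^'n^'m \<Rightarrow> real^'n \<Rightarrow> real^'m"
  by (rule bounded_bilinear_matrix_vector_mult)

lemma norm_mat_power_le:
  "norm (mat_power M k) \<le> norm (mat 1 :: real^'n^'n) * norm M ^ k" for M :: "real^'n^'n"
proof (induction k)
  case (Suc k)
  have "norm (mat_power M (Suc k)) \<le> norm M * norm (mat_power M k)"
    by (simp add: norm_matrix_mult_le)
  also have "\<dots> \<le> norm M * (norm (mat 1 :: real^'n^'n) * norm M ^ k)"
    by (intro mult_left_mono Suc.IH) simp
  finally show ?case by (simp add: mult_ac)
qed simp

lemma mat_power_commute: "M ** mat_power M k = mat_power M k ** M"
  for M :: "real^'n^'n"
proof (induction k)
  case (Suc k)
  then show ?case by (metis mat_power.simps(2) matrix_mul_assoc)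
qed simp

lemma mat_power_scaleR: "mat_power (r *\<^sub>R M) k = r ^ k *\<^sub>R mat_power M k"
  for M :: "real^'n^'n"
  by (induction k) (simp_all add: matrix_mult.scaleR_left matrix_mult.scaleR_right)

lemma norm_mat_exp_term_le:
  "norm ((1 / fact k) *\<^sub>R mat_power M k) \<le> norm (mat 1 :: real^'n^'n) * (norm M ^ k /\<^sub>R fact k)"
  for M :: "real^'n^'n"
  using norm_mat_power_le[of M k] by (simp add: divide_simps mult_ac)

lemma summable_exp_bound: "summable (\<lambda>k. c * (x ^ k /\<^sub>R fact k))" for c x :: real
  by (intro summable_mult summable_exp_generic)

lemma mat_exp_sums: "(\<lambda>k. (1 / fact k) *\<^sub>R mat_power M k) sums mat_exp M"
  for M :: "real^'n^'n"
  unfolding mat_exp_def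
  by (intro summable_sums summable_comparison_test'[OF summable_exp_bound norm_mat_exp_term_le])

lemma mat_exp_0 [simp]: "mat_exp (0 :: real^'n^'n) = mat 1"
proof -
  have "mat_power (0 :: real^'n^'n) k = (if k = 0 then mat 1 else 0)" for k
    by (cases k) auto
  then have *: "(\<lambda>k. (1 / fact k) *\<^sub>R mat_power (0 :: real^'n^'n) k) = (\<lambda>k. if k = 0 then mat 1 else 0)"
    by auto
  show ?thesis
    unfolding mat_exp_def * by (rule sums_unique[symmetric]) (rule sums_single[of 0 "\<lambda>_. mat 1"])
qed

lemma mat_exp_commute: "M ** mat_exp M = mat_exp M ** M" for M :: "real^'n^'n"
proof -
  have "(\<lambda>k. M ** ((1 / fact k) *\<^sub>R mat_power M k)) sums (M ** mat_exp M)"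
    by (rule bounded_linear.sums[OF matrix_mult.bounded_linear_right mat_exp_sums])
  moreover have "(\<lambda>k. ((1 / fact k) *\<^sub>R mat_power M k) ** M) sums (mat_exp M ** M)"
    by (rule bounded_linear.sums[OF matrix_mult.bounded_linear_left mat_exp_sums])
  ultimately show ?thesis
    by (simp add: matrix_mult.scaleR_left matrix_mult.scaleR_right mat_power_commute sums_iff)
qed

lemma continuous_mat_power: "continuous_on S (\<lambda>M :: real^'n^'n. mat_power M k)"
  by (induction k) (auto intro!: continuous_intros matrix_mult.continuous_on)

lemma continuous_mat_exp: "continuous_on UNIV (mat_exp :: real^'n^'n \<Rightarrow> _)"
proof (rule continuous_at_imp_continuous_on, intro ballI)
  fix X :: "real^'n^'n"
  let ?f = "\<lambda>k M :: real^'n^'n. (1 / fact k) *\<^sub>R mat_power M k"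
  \<comment> \<open>The majorant of the series is uniform only on bounded sets, hence a ball that
    has \<open>X\<close> in its interior.\<close>
  let ?S = "cball (0 :: real^'n^'n) (norm X + 1)"
  have "uniform_limit ?S (\<lambda>n M. \<Sum>k<n. ?f k M) (\<lambda>M. \<Sum>k. ?f k M) sequentially"
  proof (rule Weierstrass_m_test[OF _ summable_exp_bound])
    fix n and M :: "real^'n^'n" assume "M \<in> ?S"
    then have "norm (mat 1 :: real^'n^'n) * (norm M ^ n /\<^sub>R fact n)
        \<le> norm (mat 1 :: real^'n^'n) * ((norm X + 1) ^ n /\<^sub>R fact n)"
      by (intro mult_left_mono scaleR_left_mono power_mono) auto
    with norm_mat_exp_term_le[of n M]
    show "norm (?f n M) \<le> norm (mat 1 :: real^'n^'n) * ((norm X + 1) ^ n /\<^sub>R fact n)"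
      by linarith
  qed
  then have "continuous_on ?S (\<lambda>M. \<Sum>k. ?f k M)"
    by (rule uniform_limit_theorem[rotated])
      (auto intro!: always_eventually continuous_intros continuous_mat_power)
  then have "continuous_on ?S mat_exp"
    by (simp add: mat_exp_def[abs_def])
  then show "isCont mat_exp X"
    by (rule continuous_on_interior) (simp add: interior_cball)
qed

lemma continuous_on_mat_exp [continuous_intros]:
  fixes f :: "'a::topological_space \<Rightarrow> real^'n^'n"
  shows "continuous_on S f \<Longrightarrow> continuous_on S (\<lambda>x. mat_exp (f x))"
  by (rule continuous_on_compose2[OF continuous_mat_exp]) auto

lemma has_vector_derivative_cart:
  fixes f :: "real \<Rightarrow> 'a::real_normed_vector ^ 'n"
  assumes "\<And>i. ((\<lambda>t. f t $ i) has_vector_derivative f' $ i) (at x within S)"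
  shows "(f has_vector_derivative f') (at x within S)"
  unfolding has_vector_derivative_def has_derivative_within
proof (intro conjI bounded_linear_scaleR_left vec_tendstoI)
  fix i
  show "((\<lambda>y. ((1 / norm (y - x)) *\<^sub>R (f y - (f x + (y - x) *\<^sub>R f'))) $ i) \<longlongrightarrow> 0 $ i) (at x within S)"
    using assms[of i] unfolding has_vector_derivative_def has_derivative_within by simp
qed

text \<open>Every entry of the exponential of t M is a scalar power series in t with infinite radius
  of convergence, so termwise differentiation of scalar series suffices.\<close>

lemma mat_exp_has_vector_derivative:
  fixes M :: "real^'n^'n"
  shows "((\<lambda>t. mat_exp (t *\<^sub>R M)) has_vector_derivative M ** mat_exp (t *\<^sub>R M)) (at t within S)"
proof (intro has_vector_derivative_cart)
  fix i j
  have nth: "bounded_linear (\<lambda>X :: real^'n^'n. X $ i $ j)"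
    by (intro bounded_linear_compose[OF bounded_linear_vec_nth bounded_linear_vec_nth])
  define c where "c = (\<lambda>k. mat_power M k $ i $ j / fact k)"
  have "(\<lambda>k. c k * y ^ k) sums (mat_exp (y *\<^sub>R M) $ i $ j)" for y
    using bounded_linear.sums[OF nth mat_exp_sums[of "y *\<^sub>R M"]]
    by (simp add: mat_power_scaleR c_def mult_ac)
  then have c: "summable (\<lambda>k. c k * y ^ k)" "(\<Sum>k. c k * y ^ k) = mat_exp (y *\<^sub>R M) $ i $ j" for y
    by (auto simp: sums_iff)
  have "(\<lambda>k. M ** ((1 / fact k) *\<^sub>R mat_power (t *\<^sub>R M) k)) sums (M ** mat_exp (t *\<^sub>R M))"
    by (rule bounded_linear.sums[OF matrix_mult.bounded_linear_right mat_exp_sums])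
  from bounded_linear.sums[OF nth this]
  \<comment> \<open>The coefficient \<open>diffs c k\<close> is (k + 1) times
    \<open>c (Suc k)\<close>, that is, the entry of \<open>M ** mat_power M k\<close> divided by
    k!.\<close>
  have "(\<lambda>k. diffs c k * t ^ k) sums ((M ** mat_exp (t *\<^sub>R M)) $ i $ j)"
    by (simp add: diffs_def c_def matrix_mult.scaleR_right mat_power_scaleR mult_ac divide_simps)
  then have "((\<lambda>t. \<Sum>k. c k * t ^ k) has_field_derivative (M ** mat_exp (t *\<^sub>R M)) $ i $ j) (at t)"
    using termdiffs_strong_converges_everywhere[OF c(1), of t] by (simp add: sums_iff)
  then show "((\<lambda>t. mat_exp (t *\<^sub>R M) $ i $ j) has_vector_derivative (M ** mat_exp (t *\<^sub>R M)) $ i $ j) (at t within S)"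
    by (simp add: c has_real_derivative_iff_has_vector_derivative has_vector_derivative_at_within)
qed

subsection \<open>The smallest eigenvalue as a coercivity constant\<close>

text \<open>Eigenvalues are roots of the characteristic polynomial. Finiteness is what makes the
  \<open>Min\<close> in \<open>lambda_min\<close> a lower bound of the set.\<close>

lemma finite_eigenvalues: "finite (eigenvalues S)" for S :: "real^2^2"
proof -
  let ?p = "[:det S, - (S$1$1 + S$2$2), 1:]"
  have "poly ?p l = 0" if "l \<in> eigenvalues S" for l
  proof -
    from that obtain v where v: "v \<noteq> 0" "S *v v = l *\<^sub>R v"
      unfolding eigenvalues_def by auto
    let ?M = "S - mat l"
    have "mat l *v v = l *\<^sub>R v"
      by (simp add: vec_eq_iff matrix_vector_mult_def mat_def if_distrib[of "\<lambda>x. x * _"] cong: if_cong)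
    with v have "?M *v v = 0"
      by (simp add: matrix_vector_mult_diff_rdistrib)
    with v(1) have "\<not> invertible ?M"
      using matrix_left_invertible_ker[of ?M] by (metis invertible_left_inverse)
    then have "det ?M = 0"
      by (simp add: invertible_det_nz)
    then show ?thesis
      by (simp add: det_2 mat_def algebra_simps power2_eq_square)
  qed
  then have "eigenvalues S \<subseteq> {l. poly ?p l = 0}" by auto
  then show ?thesis
    by (rule finite_subset) (rule poly_roots_finite, simp)
qed

text \<open>The minimum of the Rayleigh quotient on the unit sphere is an eigenvalue, so it bounds
  the smallest eigenvalue from above.\<close>

lemma lambda_min_le_inner:
  fixes S :: "real^2^2"
  assumes "transpose S = S"
  shows "lambda_min S * (norm v)\<^sup>2 \<le> inner (S *v v) v"
proof -
  have sym: "inner (S *v x) y = inner x (S *v y)" for x y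
    by (metis assms dot_lmul_matrix inner_commute transpose_matrix_vector)
  let ?q = "\<lambda>v. inner (S *v v) v"
  have cont: "continuous_on (sphere 0 1) ?q"
    by (intro continuous_intros matrix_vector_mult.continuous_on)
  have "sphere (0 :: real^2) 1 \<noteq> {}"
    by simp
  with cont obtain x where x: "norm x = 1" and min: "\<And>y. norm y = 1 \<Longrightarrow> ?q x \<le> ?q y"
    using continuous_attains_inf[OF compact_sphere _ cont] by (auto simp: dist_norm)
  define m where "m = ?q x"
  have le: "m * (norm v)\<^sup>2 \<le> ?q v" for v
  proof (cases "v = 0")
    case False
    have "m \<le> ?q (v /\<^sub>R norm v)"
      unfolding m_def by (rule min) (use False in simp)
    also have "\<dots> = ?q v / (norm v)\<^sup>2"
      by (simp add: matrix_vector_mult.scaleR_right power2_eq_square divide_simps)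
    finally show ?thesis
      using False by (simp add: field_simps)
  qed simp
  have "S *v x = m *\<^sub>R x"
  proof (rule ccontr)
    define r where "r = S *v x - m *\<^sub>R x"
    assume "S *v x \<noteq> m *\<^sub>R x"
    then have r: "inner r r > 0" by (simp add: r_def)
    \<comment> \<open>Moving the minimiser \<open>x\<close> by -e r changes the Rayleigh form by a
      linear gain of 2 e |r|^2 and a quadratic loss of at most e^2 K. With e = |r|^2 / K the gain is
      twice the loss, which contradicts minimality. The added 1 keeps \<open>K\<close>
      positive.\<close>
    define K where "K = \<bar>?q r - m * inner r r\<bar> + 1"
    define e where "e = inner r r / K"
    have K: "K > 0" by (simp add: K_def)
    have e: "e > 0" using r K by (simp add: e_def)
    have "m * inner (x - e *\<^sub>R r) (x - e *\<^sub>R r) \<le> ?q (x - e *\<^sub>R r)"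
      using le[of "x - e *\<^sub>R r"] by (simp add: power2_norm_eq_inner)
    moreover have "inner x x = 1" using x by (simp add: norm_eq_1)
    moreover have "S *v x = r + m *\<^sub>R x"
      by (simp add: r_def)
    then have "inner (S *v x) r = inner r r + m * inner x r"
      by (simp add: inner_add_left)
    moreover have "inner (S *v r) x = inner (S *v x) r"
      by (metis sym inner_commute)
    moreover have "inner (S *v x) x = m" by (simp add: m_def)
    ultimately have "2 * e * inner r r \<le> e\<^sup>2 * (?q r - m * inner r r)"
      by (simp add: matrix_vector_mult.diff_right matrix_vector_mult.scaleR_right inner_diff_left
          inner_diff_right inner_commute algebra_simps power2_eq_square)
    also have "\<dots> \<le> e\<^sup>2 * K"
      by (intro mult_left_mono) (auto simp: K_def)
    also have "\<dots> = e * inner r r"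
      using K by (simp add: e_def power2_eq_square)
    finally show False
      using r e by simp
  qed
  then have "m \<in> eigenvalues S"
    using x unfolding eigenvalues_def by (intro CollectI exI[of _ x]) auto
  then have "lambda_min S \<le> m"
    unfolding lambda_min_def by (intro Min_le finite_eigenvalues)
  then show ?thesis
    using le[of v] by (meson mult_right_mono order_trans zero_le_power2)
qed

text \<open>The antisymmetric part of \<open>B\<close> drops out of the quadratic form. Summing over
  the columns of \<open>X\<close> gives coercivity for the Frobenius inner product, the form in
  which the energy estimate for a whole fundamental matrix uses it.\<close>

lemma lambda_min_coercive:
  fixes B :: "real^2^2" and X :: "real^'n^2"
  shows "lambda_min ((1 / 2) *\<^sub>R (B + transpose B)) * (norm X)\<^sup>2 \<le> inner (B ** X) X"
proof -
  let ?S = "(1 / 2) *\<^sub>R (B + transpose B)"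
  have S: "transpose ?S = ?S"
    by (simp add: transpose_def vec_eq_iff)
  have "inner (transpose B *v v) v = inner (B *v v) v" for v
    by (metis dot_lmul_matrix inner_commute transpose_matrix_vector)
  then have "inner (?S *v v) v = inner (B *v v) v" for v
    by (simp add: matrix_vector_mult.scaleR_left matrix_vector_mult.add_left inner_add_left)
  then have "lambda_min ?S * inner (column j X) (column j X) \<le> inner (B *v column j X) (column j X)" for j
    using lambda_min_le_inner[OF S, of "column j X"] by (simp add: power2_norm_eq_inner)
  then show ?thesis
    unfolding power2_norm_eq_inner inner_column_matrix column_matrix_mult sum_distrib_left
    by (intro sum_mono)
qed

subsection \<open>Differentiation of convolutions\<close>

text \<open>The substitution s = t r replaces the moving interval by the fixed interval from 0 to 1,
  on which continuity in parameters is available.\<close>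

lemma continuous_on_integral_upto:
  fixes h :: "'a::metric_space \<Rightarrow> real \<Rightarrow> real \<Rightarrow> 'b::euclidean_space"
  assumes h: "continuous_on {(x, t, s). x \<in> U \<and> 0 \<le> s \<and> s \<le> t} (\<lambda>(x, t, s). h x t s)"
  shows "continuous_on (U \<times> {0..}) (\<lambda>(x, t). integral {0..t} (h x t))"
proof -
  have "continuous_on (U \<times> {0..}) (\<lambda>p. integral (cbox 0 1) (\<lambda>s. snd p *\<^sub>R h (fst p) (snd p) (snd p * s)))"
  proof (rule integral_continuous_on_param)
    have "continuous_on ((U \<times> {0..}) \<times> cbox 0 1)
        (\<lambda>q. (\<lambda>(x, t, s). h x t s) (fst (fst q), snd (fst q), snd (fst q) * snd q))"
      by (rule continuous_on_compose2[OF h]) (auto intro!: continuous_intros mult_left_le)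
    then show "continuous_on ((U \<times> {0..}) \<times> cbox 0 1)
        (\<lambda>(p, s). snd p *\<^sub>R h (fst p) (snd p) (snd p * s))"
      by (auto simp: split_beta intro!: continuous_intros)
  qed
  also have "?this \<longleftrightarrow> ?thesis"
  proof (rule continuous_on_cong[OF refl], clarsimp)
    fix x t assume "(t::real) \<ge> 0"
    show "t *\<^sub>R integral {0..1} (\<lambda>s. h x t (t * s)) = integral {0..t} (h x t)"
    proof (cases "t = 0")
      case False
      with \<open>t \<ge> 0\<close> have t: "t > 0" by simp
      have "(\<lambda>s. s / t) ` {0..t} = {0..1}"
        using t image_divide_atLeastAtMost[of t 0 t] by simp
      then have "integral {0..1} (\<lambda>s. h x t (t * s)) = (1 / t) *\<^sub>R integral {0..t} (h x t)"
        using t integral_stretch_real[of t 0 t "h x t"] by simp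
      then show ?thesis using t by simp
    qed simp
  qed
  finally show ?thesis .
qed

lemma has_vector_derivative_within_atLeast:
  assumes "(f has_vector_derivative f') (at x within {a..b})" "x < b"
  shows "(f has_vector_derivative f') (at x within {a..})"
proof -
  have "at x within {a..b} = at x within {a..}"
    by (rule at_within_nhd[of _ "{..<b}"]) (use assms in auto)
  with assms show ?thesis by simp
qed

text \<open>A kernel known only for nonnegative times is continued by its tangent at 0. The
  continuation allows k (y - s) to be differentiated in y while s runs over a fixed interval,
  including s > y.\<close>

lemma has_vector_derivative_If_atLeast:
  fixes k :: "real \<Rightarrow> 'a::real_normed_vector"
  assumes k: "\<And>x. x \<ge> 0 \<Longrightarrow> (k has_vector_derivative k' x) (at x within {0..})"
  shows "((\<lambda>x. if x \<in> {0..} then k x else k 0 + x *\<^sub>R k' 0) has_vector_derivative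
      (if x \<in> {0..} then k' x else k' 0)) (at x)"
proof (rule has_vector_derivative_If_within_closures[where T = "{..<0}"])
  have *: "{0..} \<union> (closure {0..} \<inter> closure {..<0}) = {0 :: real..}"
    by auto
  show "(k has_vector_derivative k' x) (at x within {0..} \<union> (closure {0..} \<inter> closure {..<0}))"
    if "x \<in> {0..} \<union> (closure {0..} \<inter> closure {..<0})"
    using that unfolding * by (intro k) auto
  show "((\<lambda>x. k 0 + x *\<^sub>R k' 0) has_vector_derivative k' 0) (at x within {..<0} \<union> (closure {0..} \<inter> closure {..<0}))"
    by (auto intro!: derivative_eq_intros)
qed auto

text \<open>The time occurs both as upper limit and inside the kernel. The two occurrences are
  separated into \<open>J x y\<close>, with x the limit and y the kernel time, and the derivative is
  taken along the diagonal: the limit contributes the boundary term with \<open>k 0\<close>, the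
  kernel the convolution with \<open>k'\<close>.\<close>

lemma convolution_has_vector_derivative:
  fixes k k' :: "real \<Rightarrow> 'a::real_normed_vector" and c :: "real \<Rightarrow> 'b::real_normed_vector"
    and prod :: "'a \<Rightarrow> 'b \<Rightarrow> 'c::euclidean_space" (infixl "\<bullet>\<bullet>" 70)
  assumes "bounded_bilinear (\<bullet>\<bullet>)"
    and k: "\<And>x. x \<ge> 0 \<Longrightarrow> (k has_vector_derivative k' x) (at x within {0..})"
    and k': "continuous_on {0..} k'" and c: "continuous_on {0..} c" and t: "t \<ge> 0"
  shows "((\<lambda>t. integral {0..t} (\<lambda>s. k (t - s) \<bullet>\<bullet> c s)) has_vector_derivative
      k 0 \<bullet>\<bullet> c t + integral {0..t} (\<lambda>s. k' (t - s) \<bullet>\<bullet> c s)) (at t within {0..})"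
proof -
  interpret bounded_bilinear "(\<bullet>\<bullet>)" by fact
  define K where "K = (\<lambda>x. if x \<in> {0..} then k x else k 0 + x *\<^sub>R k' 0)"
  define K' where "K' = (\<lambda>x. if x \<in> {0..} then k' x else k' 0)"
  have K: "(K has_vector_derivative K' x) (at x)" for x
    unfolding K_def K'_def by (rule has_vector_derivative_If_atLeast[OF k])
  have contK: "continuous_on UNIV K"
    by (rule continuous_on_vector_derivative) (rule has_vector_derivative_at_within[OF K])
  have "continuous_on UNIV (\<lambda>x. k' (max 0 x))"
    by (rule continuous_on_compose2[OF k']) (auto intro!: continuous_intros)
  also have "(\<lambda>x. k' (max 0 x)) = K'"
    by (auto simp: K'_def max_def)
  finally have contK': "continuous_on UNIV K'" .
  have [continuous_intros]: "continuous_on S (\<lambda>x. K (f x))" "continuous_on S (\<lambda>x. K' (f x))"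
    if "continuous_on S f" for f :: "'z::topological_space \<Rightarrow> real" and S
    using that by (auto intro: continuous_on_compose2[OF contK] continuous_on_compose2[OF contK'])
  define J where "J = (\<lambda>x y. integral {0..x} (\<lambda>s. K (y - s) \<bullet>\<bullet> c s))"
  define J' where "J' = (\<lambda>x y. integral {0..x} (\<lambda>s. K' (y - s) \<bullet>\<bullet> c s))"
  have Jx: "((\<lambda>x. J x t) has_vector_derivative K 0 \<bullet>\<bullet> c t) (at t within {0..})"
  proof (rule has_vector_derivative_within_atLeast[of _ _ _ _ "t + 1"])
    have "continuous_on {0..t + 1} (\<lambda>s. K (t - s) \<bullet>\<bullet> c s)"
      by (intro continuous_on continuous_intros continuous_on_subset[OF c]) auto
    then show "((\<lambda>x. J x t) has_vector_derivative K 0 \<bullet>\<bullet> c t) (at t within {0..t + 1})"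
      unfolding J_def using t integral_has_vector_derivative[of 0 "t + 1" _ t] by fastforce
  qed simp
  have Jy: "((\<lambda>y. J x y) has_vector_derivative J' x y) (at y within UNIV)" if "x \<ge> 0" for x y
    unfolding J_def J'_def interval_cbox
  proof (rule leibniz_rule_vector_derivative)
    fix y s
    have "((\<lambda>y. y - s) has_vector_derivative 1 - 0) (at y)"
      by (intro derivative_intros)
    note bounded_linear.has_vector_derivative[OF bounded_linear_left[of "c s"] vector_diff_chain_at[OF this K]]
    then
    show "((\<lambda>y. K (y - s) \<bullet>\<bullet> c s) has_vector_derivative K' (y - s) \<bullet>\<bullet> c s) (at y within UNIV)"
      unfolding o_def by simp
  next
    show "(\<lambda>s. K (y - s) \<bullet>\<bullet> c s) integrable_on cbox 0 x" for y
      by (intro integrable_continuous continuous_on continuous_intros continuous_on_subset[OF c]) auto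
    have "continuous_on (UNIV \<times> cbox 0 x) (\<lambda>q. K' (fst q - snd q) \<bullet>\<bullet> c (snd q))"
      by (intro continuous_on continuous_intros continuous_on_compose2[OF c]) auto
    then show "continuous_on (UNIV \<times> cbox 0 x) (\<lambda>(y, s). K' (y - s) \<bullet>\<bullet> c s)"
      by (simp add: split_beta)
  qed auto
  have "continuous_on (UNIV \<times> {0..}) (\<lambda>(y, x). integral {0..x} (\<lambda>s. K' (y - s) \<bullet>\<bullet> c s))"
  proof (rule continuous_on_integral_upto)
    have "continuous_on {(y, t, s). y \<in> UNIV \<and> 0 \<le> s \<and> s \<le> t} (\<lambda>q. K' (fst q - snd (snd q)) \<bullet>\<bullet> c (snd (snd q)))"
      by (intro continuous_on continuous_intros continuous_on_compose2[OF c]) auto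
    then show "continuous_on {(y :: real, t :: real, s). y \<in> UNIV \<and> 0 \<le> s \<and> s \<le> t} (\<lambda>(y, t, s). K' (y - s) \<bullet>\<bullet> c s)"
      by (simp add: split_beta)
  qed
  then have "continuous_on ({0..} \<times> UNIV) (\<lambda>q. (\<lambda>(y, x). J' x y) (snd q, fst q))"
    unfolding J'_def by (rule continuous_on_compose2) (auto intro!: continuous_intros)
  then have J'c: "continuous_on ({0..} \<times> UNIV) (\<lambda>(x, y). blinfun_scaleR_left (J' x y))"
    by (auto simp: split_beta intro!: continuous_intros)
  \<comment> \<open>One partial derivative at the point and joint continuity of the other give a
    total derivative, which may then be restricted to the diagonal.\<close>
  have "((\<lambda>(x, y). J x y) has_derivative
      (\<lambda>(tx, ty). tx *\<^sub>R (K 0 \<bullet>\<bullet> c t) + blinfun_scaleR_left (J' t t) ty)) (at (t, t) within {0..} \<times> UNIV)"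
    using Jx Jy t J'c unfolding has_vector_derivative_def
    by (intro has_derivative_partialsI) (auto simp: continuous_on_eq_continuous_within)
  then have J: "((\<lambda>(x, y). J x y) has_derivative
      (\<lambda>(tx, ty). tx *\<^sub>R (K 0 \<bullet>\<bullet> c t) + blinfun_scaleR_left (J' t t) ty)) (at (t, t) within (\<lambda>t. (t, t)) ` {0..})"
    by (rule has_derivative_subset) auto
  have "((\<lambda>t. (t, t)) has_derivative (\<lambda>h. (h, h))) (at t within {0..})"
    by (auto intro!: derivative_eq_intros)
  from has_derivative_in_compose[OF this J]
  have "((\<lambda>t. J t t) has_derivative (\<lambda>h. h *\<^sub>R (K 0 \<bullet>\<bullet> c t) + h *\<^sub>R J' t t)) (at t within {0..})"
    by simp
  then have "((\<lambda>t. J t t) has_vector_derivative K 0 \<bullet>\<bullet> c t + J' t t) (at t within {0..})"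
    by (simp add: has_vector_derivative_def scaleR_add_right)
  moreover have "K 0 = k 0" "J' t t = integral {0..t} (\<lambda>s. k' (t - s) \<bullet>\<bullet> c s)"
    unfolding J'_def by (auto simp: K_def K'_def intro!: integral_cong)
  moreover have "J t t = integral {0..t} (\<lambda>s. k (t - s) \<bullet>\<bullet> c s)" for t
    unfolding J_def by (auto simp: K_def intro!: integral_cong)
  ultimately show ?thesis by simp
qed

text \<open>Caratheodory's criterion, suited to cases where the difference quotient is itself an
  explicit integral: differentiability reduces to continuity of that integral.\<close>

lemma has_vector_derivative_caratheodory:
  fixes f :: "real \<Rightarrow> 'a::real_normed_vector"
  assumes eq: "\<And>y. y \<in> S \<Longrightarrow> f y - f x = (y - x) *\<^sub>R q y"
    and q: "(q \<longlongrightarrow> q x) (at x within S)"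
  shows "(f has_vector_derivative q x) (at x within S)"
  unfolding has_vector_derivative_def has_derivative_within
proof
  have "((\<lambda>y. norm (q y - q x)) \<longlongrightarrow> 0) (at x within S)"
    using q tendsto_norm_zero LIM_zero by blast
  moreover have "\<forall>\<^sub>F y in at x within S. norm (q y - q x) =
      norm ((1 / norm (y - x)) *\<^sub>R (f y - (f x + (y - x) *\<^sub>R q x)))"
    unfolding eventually_at_filter
  proof (intro always_eventually allI impI)
    fix y assume "y \<noteq> x" "y \<in> S"
    then have "f y - (f x + (y - x) *\<^sub>R q x) = (y - x) *\<^sub>R (q y - q x)"
      using eq[of y] by (simp add: algebra_simps)
    then show "norm (q y - q x) = norm ((1 / norm (y - x)) *\<^sub>R (f y - (f x + (y - x) *\<^sub>R q x)))"
      using \<open>y \<noteq> x\<close> by simp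
  qed
  ultimately have "((\<lambda>y. norm ((1 / norm (y - x)) *\<^sub>R (f y - (f x + (y - x) *\<^sub>R q x)))) \<longlongrightarrow> 0) (at x within S)"
    by (rule Lim_transform_eventually)
  then show "((\<lambda>y. (1 / norm (y - x)) *\<^sub>R (f y - (f x + (y - x) *\<^sub>R q x))) \<longlongrightarrow> 0) (at x within S)"
    by (rule tendsto_norm_zero_cancel)
qed (rule bounded_linear_scaleR_left)

subsection \<open>The exponential of \<open>A - \<mu> B\<close> and its derivatives in \<open>\<mu>\<close>\<close>

locale parabolic_matrices =
  fixes A B :: "real^'n^'n" and b :: real
  assumes b_pos: "b > 0" and coercive: "b * (norm X)\<^sup>2 \<le> inner (B ** X) (X :: real^'n^'n)"
begin

definition P :: "real \<Rightarrow> real \<Rightarrow> real^'n^'n" where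
  "P \<mu> t = mat_exp (t *\<^sub>R (A - \<mu> *\<^sub>R B))"

text \<open>Duhamel's expression for the \<mu>-derivative of \<open>P\<close>. If \<open>A\<close>
  and \<open>B\<close> commuted, it would collapse to - t B P; in general the order of the factors
  has to be kept. \<open>P''\<close> arises from differentiating both factors of this
  convolution.\<close>

definition P' :: "real \<Rightarrow> real \<Rightarrow> real^'n^'n" where
  "P' \<mu> t = - integral {0..t} (\<lambda>s. P \<mu> (t - s) ** (B ** P \<mu> s))"

definition P'' :: "real \<Rightarrow> real \<Rightarrow> real^'n^'n" where
  "P'' \<mu> t = - (integral {0..t} (\<lambda>s. P' \<mu> (t - s) ** (B ** P \<mu> s)) +
     integral {0..t} (\<lambda>s. P \<mu> (t - s) ** (B ** P' \<mu> s)))"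

lemma P_0 [simp]: "P \<mu> 0 = mat 1" and P'_0 [simp]: "P' \<mu> 0 = 0" and P''_0 [simp]: "P'' \<mu> 0 = 0"
  by (simp_all add: P_def P'_def P''_def)

lemma P_deriv_time: "(P \<mu> has_vector_derivative (A - \<mu> *\<^sub>R B) ** P \<mu> t) (at t within S)"
  unfolding P_def[abs_def] by (rule mat_exp_has_vector_derivative)

lemma P_commute: "(A - \<mu> *\<^sub>R B) ** P \<mu> t = P \<mu> t ** (A - \<mu> *\<^sub>R B)"
proof (cases "t = 0")
  case False
  then show ?thesis
    using mat_exp_commute[of "t *\<^sub>R (A - \<mu> *\<^sub>R B)"]
    by (simp add: P_def matrix_mult.scaleR_left matrix_mult.scaleR_right)
qed simp

lemma continuous_on_P [continuous_intros]:
  fixes f g :: "'z::topological_space \<Rightarrow> real"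
  shows "continuous_on S f \<Longrightarrow> continuous_on S g \<Longrightarrow> continuous_on S (\<lambda>x. P (f x) (g x))"
  unfolding P_def by (intro continuous_intros)

abbreviation "N\<^sub>1 \<equiv> norm (P 0 0)"

text \<open>Energy estimate: coercivity bounds the time derivative of |P|^2 by 2 (|A| - b \<mu>)
  |P|^2, so |P|^2 times the inverse exponential does not increase. The constant
  \<open>N\<^sub>1\<close> is the Frobenius norm of the identity, the value at time 0.\<close>

lemma norm_P_le:
  assumes t: "t \<ge> 0" and "\<mu> \<ge> 0"
  shows "norm (P \<mu> t) \<le> N\<^sub>1 * exp ((norm A - b * \<mu>) * t)"
proof -
  let ?a = "norm A - b * \<mu>"
  let ?h = "\<lambda>t. exp (- (2 * ?a) * t) * inner (P \<mu> t) (P \<mu> t)"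
  have inv: "y \<le> z * exp (2 * (c * t))" if "exp (- (2 * c) * t) * y \<le> z" for c y z :: real
  proof -
    have "exp (- (2 * c) * t) = inverse (exp (2 * (c * t)))"
      by (simp add: exp_minus[symmetric] mult.assoc)
    with that have "y / exp (2 * (c * t)) \<le> z"
      by (simp add: divide_inverse mult.commute)
    then show ?thesis
      by (simp add: pos_divide_le_eq)
  qed
  have eq: "e * (- (2 * a)) * q + 2 * p * e \<le> 0" if "2 * p - 2 * a * q \<le> 0" "e > 0" for e a p q :: real
  proof -
    have "e * (2 * p - 2 * a * q) \<le> 0"
      using that by (simp only: mult_le_0_iff) simp
    then show ?thesis
      by (simp add: algebra_simps)
  qed
  have "\<exists>y. (?h has_real_derivative y) (at x) \<and> y \<le> 0" for x
  proof (intro exI conjI)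
    let ?X = "P \<mu> x"
    have "(P \<mu> has_derivative (\<lambda>h. h *\<^sub>R ((A - \<mu> *\<^sub>R B) ** ?X))) (at x)"
      using P_deriv_time[of \<mu> x UNIV] by (simp add: has_vector_derivative_def)
    then have "((\<lambda>t. inner (P \<mu> t) (P \<mu> t)) has_derivative
        (\<lambda>h. inner ?X (h *\<^sub>R ((A - \<mu> *\<^sub>R B) ** ?X)) + inner (h *\<^sub>R ((A - \<mu> *\<^sub>R B) ** ?X)) ?X)) (at x)"
      by (intro has_derivative_inner)
    then have "((\<lambda>t. inner (P \<mu> t) (P \<mu> t)) has_real_derivative 2 * inner ((A - \<mu> *\<^sub>R B) ** ?X) ?X) (at x)"
      by (rule has_derivative_imp_has_field_derivative) (simp add: inner_commute[of ?X])
    moreover have "((\<lambda>t. exp (- (2 * ?a) * t)) has_real_derivative exp (- (2 * ?a) * x) * (- (2 * ?a))) (at x)"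
      by (auto intro!: derivative_eq_intros)
    ultimately show "(?h has_real_derivative exp (- (2 * ?a) * x) * (- (2 * ?a)) * inner ?X ?X +
        2 * inner ((A - \<mu> *\<^sub>R B) ** ?X) ?X * exp (- (2 * ?a) * x)) (at x)"
      by (intro DERIV_mult)
    have "inner (A ** ?X) ?X \<le> norm (A ** ?X) * norm ?X"
      by (rule norm_cauchy_schwarz)
    also have "\<dots> \<le> (norm A * norm ?X) * norm ?X"
      by (intro mult_right_mono norm_matrix_mult_le) simp
    finally have "inner (A ** ?X) ?X \<le> norm A * inner ?X ?X"
      by (simp add: power2_norm_eq_inner[symmetric] power2_eq_square)
    moreover have "\<mu> * (b * inner ?X ?X) \<le> \<mu> * inner (B ** ?X) ?X"
      using coercive[of ?X] \<open>\<mu> \<ge> 0\<close> by (intro mult_left_mono) (simp_all add: power2_norm_eq_inner)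
    ultimately have "2 * inner ((A - \<mu> *\<^sub>R B) ** ?X) ?X - 2 * ?a * inner ?X ?X \<le> 0"
      by (simp add: matrix_mult.diff_left matrix_mult.scaleR_left inner_diff_left algebra_simps)
    then show "exp (- (2 * ?a) * x) * (- (2 * ?a)) * inner ?X ?X +
        2 * inner ((A - \<mu> *\<^sub>R B) ** ?X) ?X * exp (- (2 * ?a) * x) \<le> 0"
      by (rule eq) simp
  qed
  then have "?h t \<le> ?h 0"
    by (rule DERIV_nonpos_imp_nonincreasing[OF t])
  then have "exp (- (2 * ?a) * t) * (norm (P \<mu> t))\<^sup>2 \<le> (norm (mat 1 :: real^'n^'n))\<^sup>2"
    by (simp add: power2_norm_eq_inner)
  then have "(norm (P \<mu> t))\<^sup>2 \<le> (norm (mat 1 :: real^'n^'n))\<^sup>2 * exp (2 * (?a * t))"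
    by (rule inv)
  also have "\<dots> = (norm (mat 1 :: real^'n^'n) * exp (?a * t))\<^sup>2"
    by (simp add: power_mult_distrib exp_double)
  finally have "norm (P \<mu> t) \<le> norm (mat 1 :: real^'n^'n) * exp (?a * t)"
    by (rule power2_le_imp_le) simp
  then show ?thesis by simp
qed

text \<open>Duhamel's formula. The path s \<mapsto> \<open>P \<mu> (t - s) ** P \<nu> s\<close>
  joins \<open>P \<mu> t\<close> to \<open>P \<nu> t\<close>. In its derivative the contributions of
  \<open>A\<close> cancel, and only the difference of the generators, a multiple of
  \<open>B\<close>, survives.\<close>

lemma P_diff_eq:
  assumes "t \<ge> 0"
  shows "P \<nu> t - P \<mu> t = (\<nu> - \<mu>) *\<^sub>R - integral {0..t} (\<lambda>s. P \<mu> (t - s) ** (B ** P \<nu> s))"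
proof -
  have P_rev: "((\<lambda>s. P \<mu> (t - s)) has_vector_derivative - (P \<mu> (t - s) ** (A - \<mu> *\<^sub>R B))) (at s within {0..t})" for s
  proof -
    have "((\<lambda>s. t - s) has_vector_derivative 0 - 1) (at s within {0..t})"
      by (intro derivative_intros)
    from vector_diff_chain_within[OF this P_deriv_time]
    show ?thesis by (simp add: o_def P_commute)
  qed
  have "((\<lambda>s. P \<mu> (t - s) ** P \<nu> s) has_vector_derivative
      - ((\<nu> - \<mu>) *\<^sub>R (P \<mu> (t - s) ** (B ** P \<nu> s)))) (at s within {0..t})" for s
    by (rule has_vector_derivative_eq_rhs[OF matrix_mult.has_vector_derivative[OF P_rev P_deriv_time]])
      (simp add: matrix_mult.diff_left matrix_mult.diff_right matrix_mult.scaleR_left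
        matrix_mult.scaleR_right matrix_mul_assoc algebra_simps)
  then have "((\<lambda>s. - ((\<nu> - \<mu>) *\<^sub>R (P \<mu> (t - s) ** (B ** P \<nu> s)))) has_integral
      P \<mu> (t - t) ** P \<nu> t - P \<mu> (t - 0) ** P \<nu> 0) {0..t}"
    using assms by (intro fundamental_theorem_of_calculus)
  from integral_unique[OF this] show ?thesis
    by simp
qed

lemma P_deriv_param:
  assumes "t \<ge> 0"
  shows "((\<lambda>\<mu>. P \<mu> t) has_vector_derivative P' \<mu> t) (at \<mu>)"
proof -
  let ?q = "\<lambda>\<nu>. - integral (cbox 0 t) (\<lambda>s. P \<mu> (t - s) ** (B ** P \<nu> s))"
  have "continuous_on (UNIV \<times> cbox 0 t) (\<lambda>(\<nu>, s). P \<mu> (t - s) ** (B ** P \<nu> s))"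
    unfolding split_beta by (intro continuous_intros matrix_mult.continuous_on)
  then have "continuous_on UNIV ?q"
    by (intro continuous_on_minus integral_continuous_on_param)
  then have "(?q \<longlongrightarrow> ?q \<mu>) (at \<mu>)"
    by (simp add: continuous_on_def)
  then have "((\<lambda>\<mu>. P \<mu> t) has_vector_derivative ?q \<mu>) (at \<mu>)"
    by (rule has_vector_derivative_caratheodory[rotated]) (simp add: P_diff_eq assms)
  then show ?thesis
    by (simp add: P'_def)
qed

lemma continuous_on_P' [continuous_intros]:
  fixes f g :: "'z::topological_space \<Rightarrow> real"
  assumes "continuous_on S f" "continuous_on S g" "\<And>x. x \<in> S \<Longrightarrow> g x \<ge> 0"
  shows "continuous_on S (\<lambda>x. P' (f x) (g x))"
proof -
  have "continuous_on (UNIV \<times> {0..}) (\<lambda>(\<mu>, t). - P' \<mu> t)"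
    unfolding P'_def minus_minus
    by (rule continuous_on_integral_upto, unfold split_beta)
      (intro continuous_intros matrix_mult.continuous_on)
  then have "continuous_on S (\<lambda>x. (\<lambda>(\<mu>, t). - P' \<mu> t) (f x, g x))"
    by (rule continuous_on_compose2) (use assms in \<open>auto intro!: continuous_intros\<close>)
  from continuous_on_minus[OF this] show ?thesis
    by simp
qed

lemma continuous_on_P'' [continuous_intros]:
  fixes f g :: "'z::topological_space \<Rightarrow> real"
  assumes "continuous_on S f" "continuous_on S g" "\<And>x. x \<in> S \<Longrightarrow> g x \<ge> 0"
  shows "continuous_on S (\<lambda>x. P'' (f x) (g x))"
proof -
  have "continuous_on (UNIV \<times> {0..}) (\<lambda>(\<mu>, t). integral {0..t} (\<lambda>s. P' \<mu> (t - s) ** (B ** P \<mu> s)))"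
    and "continuous_on (UNIV \<times> {0..}) (\<lambda>(\<mu>, t). integral {0..t} (\<lambda>s. P \<mu> (t - s) ** (B ** P' \<mu> s)))"
    by (rule continuous_on_integral_upto; unfold split_beta;
        auto intro!: continuous_intros matrix_mult.continuous_on)+
  then have "continuous_on (UNIV \<times> {0..}) (\<lambda>(\<mu>, t). P'' \<mu> t)"
    unfolding P''_def split_beta by (intro continuous_intros)
  then have "continuous_on S (\<lambda>x. (\<lambda>(\<mu>, t). P'' \<mu> t) (f x, g x))"
    by (rule continuous_on_compose2) (use assms in \<open>auto intro!: continuous_intros\<close>)
  then show ?thesis by simp
qed

lemma P'_deriv_param:
  assumes "t \<ge> 0"
  shows "((\<lambda>\<mu>. P' \<mu> t) has_vector_derivative P'' \<mu> t) (at \<mu>)"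
proof -
  let ?d = "\<lambda>\<mu> s. P \<mu> (t - s) ** (B ** P' \<mu> s) + P' \<mu> (t - s) ** (B ** P \<mu> s)"
  have "((\<lambda>\<mu>. integral (cbox 0 t) (\<lambda>s. P \<mu> (t - s) ** (B ** P \<mu> s))) has_vector_derivative
      integral (cbox 0 t) (?d \<mu>)) (at \<mu> within UNIV)"
  proof (rule leibniz_rule_vector_derivative)
    show "((\<lambda>\<mu>. P \<mu> (t - s) ** (B ** P \<mu> s)) has_vector_derivative ?d \<mu> s) (at \<mu> within UNIV)"
      if "s \<in> cbox 0 t" for \<mu> s
      using that by (intro matrix_mult.has_vector_derivative P_deriv_param
          bounded_linear.has_vector_derivative[OF matrix_mult.bounded_linear_right]) auto
    show "continuous_on (UNIV \<times> cbox 0 t) (\<lambda>(\<mu>, s). ?d \<mu> s)"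
      unfolding split_beta by (auto intro!: continuous_intros matrix_mult.continuous_on)
  qed (auto intro!: integrable_continuous_interval continuous_intros matrix_mult.continuous_on)
  moreover have "integral {0..t} (?d \<mu>) = - P'' \<mu> t"
    unfolding P''_def minus_minus
    by (subst integral_add)
      (auto intro!: integrable_continuous_interval continuous_intros matrix_mult.continuous_on)
  ultimately have "((\<lambda>\<mu>. integral {0..t} (\<lambda>s. P \<mu> (t - s) ** (B ** P \<mu> s))) has_vector_derivative - P'' \<mu> t) (at \<mu>)"
    by simp
  from has_vector_derivative_minus[OF this] show ?thesis
    unfolding P'_def[abs_def] by simp
qed

text \<open>This is the equation of \<open>P\<close> formally differentiated in \<mu>: the
  derivative of the generator supplies the source - B P, which here comes from the boundary term of
  the convolution.\<close>

lemma P'_deriv_time: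
  assumes "t \<ge> 0"
  shows "(P' \<mu> has_vector_derivative (A - \<mu> *\<^sub>R B) ** P' \<mu> t - B ** P \<mu> t) (at t within {0..})"
proof -
  have "((\<lambda>t. integral {0..t} (\<lambda>s. P \<mu> (t - s) ** (B ** P \<mu> s))) has_vector_derivative
     P \<mu> 0 ** (B ** P \<mu> t) + integral {0..t} (\<lambda>s. ((A - \<mu> *\<^sub>R B) ** P \<mu> (t - s)) ** (B ** P \<mu> s))) (at t within {0..})"
    by (rule convolution_has_vector_derivative[OF bounded_bilinear_matrix_mult])
      (auto intro!: P_deriv_time continuous_intros matrix_mult.continuous_on assms)
  moreover have "integral {0..t} (\<lambda>s. ((A - \<mu> *\<^sub>R B) ** P \<mu> (t - s)) ** (B ** P \<mu> s)) = - ((A - \<mu> *\<^sub>R B) ** P' \<mu> t)"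
    unfolding P'_def matrix_mul_assoc[symmetric] matrix_mult.minus_right minus_minus
    by (subst integral_linear[OF _ matrix_mult.bounded_linear_right, symmetric])
      (auto simp: o_def intro!: integrable_continuous_interval continuous_intros matrix_mult.continuous_on)
  ultimately have "((\<lambda>t. integral {0..t} (\<lambda>s. P \<mu> (t - s) ** (B ** P \<mu> s))) has_vector_derivative
     B ** P \<mu> t - (A - \<mu> *\<^sub>R B) ** P' \<mu> t) (at t within {0..})"
    by simp
  from has_vector_derivative_minus[OF this] show ?thesis
    unfolding P'_def[abs_def] by simp
qed

text \<open>The factor 2 has two origins: the boundary term of the convolution of \<open>P\<close>
  with \<open>B ** P'\<close>, and the source in the equation of \<open>P'\<close> inside the other
  convolution. The boundary term of the latter vanishes because
  \<open>P' \<mu> 0 = 0\<close>.\<close>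

lemma P''_deriv_time:
  assumes "t \<ge> 0"
  shows "(P'' \<mu> has_vector_derivative (A - \<mu> *\<^sub>R B) ** P'' \<mu> t - 2 *\<^sub>R (B ** P' \<mu> t)) (at t within {0..})"
proof -
  let ?M = "A - \<mu> *\<^sub>R B"
  have 1: "((\<lambda>t. integral {0..t} (\<lambda>s. P \<mu> (t - s) ** (B ** P' \<mu> s))) has_vector_derivative
     P \<mu> 0 ** (B ** P' \<mu> t) + integral {0..t} (\<lambda>s. (?M ** P \<mu> (t - s)) ** (B ** P' \<mu> s))) (at t within {0..})"
    by (rule convolution_has_vector_derivative[OF bounded_bilinear_matrix_mult])
      (auto intro!: P_deriv_time continuous_intros matrix_mult.continuous_on assms)
  have 2: "((\<lambda>t. integral {0..t} (\<lambda>s. P' \<mu> (t - s) ** (B ** P \<mu> s))) has_vector_derivative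
     P' \<mu> 0 ** (B ** P \<mu> t) + integral {0..t} (\<lambda>s. (?M ** P' \<mu> (t - s) - B ** P \<mu> (t - s)) ** (B ** P \<mu> s))) (at t within {0..})"
    by (rule convolution_has_vector_derivative[OF bounded_bilinear_matrix_mult])
      (auto intro!: P'_deriv_time continuous_intros matrix_mult.continuous_on assms)
  have 3: "integral {0..t} (\<lambda>s. (?M ** P \<mu> (t - s)) ** (B ** P' \<mu> s)) =
     ?M ** integral {0..t} (\<lambda>s. P \<mu> (t - s) ** (B ** P' \<mu> s))"
    unfolding matrix_mul_assoc[symmetric]
    by (subst integral_linear[OF _ matrix_mult.bounded_linear_right, symmetric])
      (auto simp: o_def intro!: integrable_continuous_interval continuous_intros matrix_mult.continuous_on)
  have "integral {0..t} (\<lambda>s. (?M ** P' \<mu> (t - s) - B ** P \<mu> (t - s)) ** (B ** P \<mu> s)) =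
     integral {0..t} (\<lambda>s. ?M ** (P' \<mu> (t - s) ** (B ** P \<mu> s)) - B ** (P \<mu> (t - s) ** (B ** P \<mu> s)))"
    by (simp add: matrix_mult.diff_left matrix_mul_assoc)
  also have "\<dots> = integral {0..t} (\<lambda>s. ?M ** (P' \<mu> (t - s) ** (B ** P \<mu> s))) -
     integral {0..t} (\<lambda>s. B ** (P \<mu> (t - s) ** (B ** P \<mu> s)))"
    by (rule integral_diff)
      (auto intro!: integrable_continuous_interval continuous_intros matrix_mult.continuous_on)
  also have "integral {0..t} (\<lambda>s. ?M ** (P' \<mu> (t - s) ** (B ** P \<mu> s))) =
      ?M ** integral {0..t} (\<lambda>s. P' \<mu> (t - s) ** (B ** P \<mu> s))"
    by (subst integral_linear[OF _ matrix_mult.bounded_linear_right, symmetric])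
      (auto simp: o_def intro!: integrable_continuous_interval continuous_intros matrix_mult.continuous_on)
  also have "integral {0..t} (\<lambda>s. B ** (P \<mu> (t - s) ** (B ** P \<mu> s))) = - (B ** P' \<mu> t)"
    unfolding P'_def matrix_mult.minus_right minus_minus
    by (subst integral_linear[OF _ matrix_mult.bounded_linear_right, symmetric])
      (auto simp: o_def intro!: integrable_continuous_interval continuous_intros matrix_mult.continuous_on)
  finally have 4: "integral {0..t} (\<lambda>s. (?M ** P' \<mu> (t - s) - B ** P \<mu> (t - s)) ** (B ** P \<mu> s)) =
    ?M ** integral {0..t} (\<lambda>s. P' \<mu> (t - s) ** (B ** P \<mu> s)) + B ** P' \<mu> t" by simp
  show ?thesis
    unfolding P''_def[abs_def]
    by (rule has_vector_derivative_eq_rhs, rule has_vector_derivative_minus, rule has_vector_derivative_add[OF 2 1])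
      (simp add: 3 4 matrix_mult.add_right matrix_mult.diff_right matrix_mult.minus_right scaleR_2)
qed

text \<open>The exponential bounds at times t - s and s multiply to the bound at time t,
  independently of s. The convolution therefore costs just the length t of the interval.\<close>

lemma norm_P'_le:
  assumes t: "t \<ge> 0" and "\<mu> \<ge> 0"
  shows "norm (P' \<mu> t) \<le> N\<^sub>1\<^sup>2 * norm B * t * exp ((norm A - b * \<mu>) * t)"
proof -
  let ?a = "norm A - b * \<mu>"
  have "norm (P \<mu> (t - s) ** (B ** P \<mu> s)) \<le> N\<^sub>1\<^sup>2 * norm B * exp (?a * t)" if "s \<in> cbox 0 t" for s
  proof -
    have "norm (P \<mu> (t - s) ** (B ** P \<mu> s)) \<le> norm (P \<mu> (t - s)) * (norm B * norm (P \<mu> s))"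
      by (meson norm_matrix_mult_le mult_left_mono norm_ge_zero order_trans)
    also have "\<dots> \<le> (N\<^sub>1 * exp (?a * (t - s))) * (norm B * (N\<^sub>1 * exp (?a * s)))"
      using that assms by (intro mult_mono norm_P_le) auto
    also have "\<dots> = N\<^sub>1\<^sup>2 * norm B * (exp (?a * (t - s)) * exp (?a * s))"
      by (simp add: power2_eq_square)
    also have "exp (?a * (t - s)) * exp (?a * s) = exp (?a * t)"
      by (simp add: exp_add[symmetric] algebra_simps)
    finally show ?thesis .
  qed
  then have "norm (integral (cbox 0 t) (\<lambda>s. P \<mu> (t - s) ** (B ** P \<mu> s))) \<le> N\<^sub>1\<^sup>2 * norm B * exp (?a * t) * measure lborel (cbox 0 t)"
    by (intro integrable_bound integrable_continuous continuous_intros matrix_mult.continuous_on) auto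
  then show ?thesis
    using t by (simp add: P'_def mult_ac)
qed

lemma norm_P''_le:
  assumes t: "t \<ge> 0" and "\<mu> \<ge> 0"
  shows "norm (P'' \<mu> t) \<le> N\<^sub>1 ^ 3 * (norm B)\<^sup>2 * t\<^sup>2 * exp ((norm A - b * \<mu>) * t)"
proof -
  let ?a = "norm A - b * \<mu>"
  let ?h = "\<lambda>s. P' \<mu> (t - s) ** (B ** P \<mu> s) + P \<mu> (t - s) ** (B ** P' \<mu> s)"
  have "norm (?h s) \<le> N\<^sub>1 ^ 3 * (norm B)\<^sup>2 * t * exp (?a * t)" if s: "s \<in> cbox 0 t" for s
  proof -
    have e: "exp (?a * (t - s)) * exp (?a * s) = exp (?a * t)"
      by (simp add: exp_add[symmetric] algebra_simps)
    have "norm (?h s) \<le> norm (P' \<mu> (t - s)) * (norm B * norm (P \<mu> s)) + norm (P \<mu> (t - s)) * (norm B * norm (P' \<mu> s))"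
      by (intro norm_triangle_le add_mono; meson norm_matrix_mult_le mult_left_mono norm_ge_zero order_trans)
    also have "\<dots> \<le> (N\<^sub>1\<^sup>2 * norm B * (t - s) * exp (?a * (t - s))) * (norm B * (N\<^sub>1 * exp (?a * s)))
        + (N\<^sub>1 * exp (?a * (t - s))) * (norm B * (N\<^sub>1\<^sup>2 * norm B * s * exp (?a * s)))"
      using s assms by (intro add_mono mult_mono norm_P_le norm_P'_le) auto
    \<comment> \<open>The linear factors t - s and s of the two bounds for \<open>P'\<close> add up
      to t.\<close>
    also have "\<dots> = N\<^sub>1 ^ 3 * (norm B)\<^sup>2 * t * (exp (?a * (t - s)) * exp (?a * s))"
      by (simp add: power2_eq_square power3_eq_cube algebra_simps)
    finally show ?thesis unfolding e .
  qed
  then have "norm (integral (cbox 0 t) ?h) \<le> N\<^sub>1 ^ 3 * (norm B)\<^sup>2 * t * exp (?a * t) * measure lborel (cbox 0 t)"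
    using t by (intro integrable_bound integrable_continuous)
      (auto intro!: continuous_intros matrix_mult.continuous_on)
  moreover have "integral (cbox 0 t) ?h = - P'' \<mu> t"
    unfolding P''_def minus_minus interval_cbox
    by (rule integral_add)
      (auto intro!: integrable_continuous_interval continuous_intros matrix_mult.continuous_on)
  ultimately show ?thesis
    using t by (simp add: mult_ac power2_eq_square)
qed

end

subsection \<open>Integrals over the half-line\<close>

text \<open>Also valid for conditionally convergent integrals: the definition of the integral over
  an unbounded set controls every interval that contains a large ball, in particular the one from -R
  to R. This generality is used for the formula at t = 0.\<close>

lemma integral_upto_tendsto:
  fixes f :: "real \<Rightarrow> 'a::banach"
  assumes "f integrable_on {0..}"
  shows "((\<lambda>R. integral {0..R} f) \<longlongrightarrow> integral {0..} f) at_top"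
proof (rule tendstoI)
  fix e :: real assume "e > 0"
  have "(f has_integral integral {0..} f) {0..}"
    using assms by blast
  then obtain K where K: "K > 0" and le: "\<And>a b. ball 0 K \<subseteq> cbox a b \<Longrightarrow>
      norm (integral (cbox a b) (\<lambda>x. if x \<in> {0..} then f x else 0) - integral {0..} f) < e"
    unfolding has_integral_alt'[of f] using \<open>e > 0\<close> by blast
  have "dist (integral {0..R} f) (integral {0..} f) < e" if "R \<ge> K" for R
  proof -
    have "ball 0 K \<subseteq> cbox (- R) R"
      using that by (auto simp: dist_norm)
    from le[OF this]
    have "norm (integral (cbox (- R) R) (\<lambda>x. if x \<in> {0..} then f x else 0) - integral {0..} f) < e" .
    also have "integral (cbox (- R) R) (\<lambda>x. if x \<in> {0..} then f x else 0) = integral ({0..} \<inter> {- R..R}) f"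
      by (simp only: cbox_interval integral_restrict_Int)
    also have "{0..} \<inter> {- R..R} = {0..R}"
      using that K by auto
    finally show ?thesis by (simp add: dist_norm)
  qed
  then show "\<forall>\<^sub>F R in at_top. dist (integral {0..R} f) (integral {0..} f) < e"
    by (rule eventually_at_top_linorderI)
qed

lemma integral_atLeast_ftc:
  fixes f :: "real \<Rightarrow> 'a::banach"
  assumes f: "\<And>x. x \<ge> 0 \<Longrightarrow> (f has_vector_derivative f' x) (at x within {0..})"
    and f': "f' integrable_on {0..}" and L: "(f \<longlongrightarrow> L) at_top"
  shows "integral {0..} f' = L - f 0"
proof (rule tendsto_unique[OF _ integral_upto_tendsto[OF f']])
  have "integral {0..R} f' = f R - f 0" if "R \<ge> 0" for R
    using that by (intro integral_unique fundamental_theorem_of_calculus)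
      (auto intro: has_vector_derivative_within_subset[OF f])
  then have "\<forall>\<^sub>F R in at_top. f R - f 0 = integral {0..R} f'"
    by (intro eventually_at_top_linorderI[of 0]) simp
  moreover have "((\<lambda>R. f R - f 0) \<longlongrightarrow> L - f 0) at_top"
    by (intro tendsto_intros L)
  ultimately show "((\<lambda>R. integral {0..R} f') \<longlongrightarrow> L - f 0) at_top"
    by (rule Lim_transform_eventually[rotated])
qed simp

lemma inverse_quadratic_integrable: "(\<lambda>x::real. C / (1 + x\<^sup>2)) integrable_on {0..}"
proof -
  have "set_integrable lborel {0<..} (\<lambda>x::real. 1 / (1 + x\<^sup>2))"
    using integrable_I0i_1_div_plus_square by (simp add: interval_lebesgue_integrable_def zero_ereal_def)
  then have "(\<lambda>x::real. 1 / (1 + x\<^sup>2)) integrable_on {0<..}"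
    by (rule set_borel_integral_eq_integral(1))
  then have "(\<lambda>x::real. 1 / (1 + x\<^sup>2)) integrable_on {0..}"
    by (rule integrable_spike_set)
      (rule negligible_subset[OF negligible_sing[of 0]], auto)+
  from integrable_cmul[OF this, of C] show ?thesis by simp
qed

lemma integrable_by_bound:
  fixes h :: "real \<Rightarrow> 'a::euclidean_space"
  assumes "continuous_on {0..} h" "\<And>x. x \<ge> 0 \<Longrightarrow> norm (h x) \<le> g x" "g integrable_on {0..}"
  shows "h integrable_on {0..}" "norm (integral {0..} h) \<le> integral {0..} g"
proof -
  show *: "h integrable_on {0..}"
    by (rule measurable_bounded_by_integrable_imp_integrable[OF _ assms(3)])
      (use assms in \<open>auto intro: continuous_imp_measurable_on_sets_lebesgue\<close>)
  show "norm (integral {0..} h) \<le> integral {0..} g"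
    by (rule integral_norm_bound_integral[OF * assms(3)]) (use assms in auto)
qed

lemma dominated_convergence_at_within:
  fixes f :: "'c::first_countable_topology \<Rightarrow> 'n::euclidean_space \<Rightarrow> 'm::euclidean_space"
  assumes f: "\<And>y. y \<in> U \<Longrightarrow> y \<noteq> x \<Longrightarrow> f y integrable_on S" and h: "h integrable_on S"
    and le: "\<And>y w. y \<in> U \<Longrightarrow> y \<noteq> x \<Longrightarrow> w \<in> S \<Longrightarrow> norm (f y w) \<le> h w"
    and lim: "\<And>w. w \<in> S \<Longrightarrow> ((\<lambda>y. f y w) \<longlongrightarrow> g w) (at x within U)"
  shows "((\<lambda>y. integral S (f y)) \<longlongrightarrow> integral S g) (at x within U)"
  unfolding tendsto_at_iff_sequentially
proof (intro allI impI)
  fix X assume X: "\<forall>i. X i \<in> U - {x}" "X \<longlonglongrightarrow> x"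
  have "(\<lambda>n. integral S (f (X n))) \<longlonglongrightarrow> integral S g"
  proof (rule dominated_convergence(2)[OF _ h])
    fix w assume "w \<in> S"
    from lim[OF this] show "(\<lambda>n. f (X n) w) \<longlonglongrightarrow> g w"
      using X unfolding tendsto_at_iff_sequentially o_def by blast
  qed (use X f le in auto)
  then show "((\<lambda>y. integral S (f y)) \<circ> X) \<longlonglongrightarrow> integral S g"
    by (simp add: o_def)
qed

lemma dominated_convergence_at_top:
  fixes f :: "real \<Rightarrow> 'n::euclidean_space \<Rightarrow> 'm::euclidean_space"
  assumes f: "\<And>y. y \<ge> K \<Longrightarrow> f y integrable_on S" and h: "h integrable_on S"
    and le: "\<And>y w. y \<ge> K \<Longrightarrow> w \<in> S \<Longrightarrow> norm (f y w) \<le> h w"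
    and lim: "\<And>w. w \<in> S \<Longrightarrow> ((\<lambda>y. f y w) \<longlongrightarrow> g w) at_top"
  shows "((\<lambda>y. integral S (f y)) \<longlongrightarrow> integral S g) at_top"
proof (rule tendsto_at_topI_sequentially)
  fix X :: "nat \<Rightarrow> real" assume X: "filterlim X at_top sequentially"
  \<comment> \<open>Replacing \<open>X n\<close> by \<open>max K (X n)\<close> keeps all members of
    the sequence in the range of the hypotheses; since \<open>X\<close> tends to infinity, only
    finitely many of them are changed.\<close>
  have "(\<lambda>n. integral S (f (max K (X n)))) \<longlonglongrightarrow> integral S g"
  proof (rule dominated_convergence(2)[OF _ h])
    fix w assume "w \<in> S"
    have "filterlim (\<lambda>n. max K (X n)) at_top sequentially"
      by (rule filterlim_at_top_mono[OF X]) simp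
    from filterlim_compose[OF lim[OF \<open>w \<in> S\<close>] this]
    show "(\<lambda>n. f (max K (X n)) w) \<longlonglongrightarrow> g w" .
  qed (use f le in auto)
  moreover have "\<forall>\<^sub>F n in sequentially. K \<le> X n"
    using X by (simp add: filterlim_at_top)
  then have "\<forall>\<^sub>F n in sequentially. integral S (f (max K (X n))) = integral S (f (X n))"
    by (rule eventually_mono) (simp add: max_absorb2)
  ultimately show "(\<lambda>n. integral S (f (X n))) \<longlonglongrightarrow> integral S g"
    by (rule Lim_transform_eventually)
qed

lemma has_vector_derivative_quotient_tendsto:
  fixes f :: "real \<Rightarrow> 'a::real_normed_vector"
  assumes "(f has_vector_derivative f') (at x within U)"
  shows "((\<lambda>y. (1 / (y - x)) *\<^sub>R (f y - f x)) \<longlongrightarrow> f') (at x within U)"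
proof -
  let ?r = "\<lambda>y. (1 / norm (y - x)) *\<^sub>R (f y - (f x + (y - x) *\<^sub>R f'))"
  have "(?r \<longlongrightarrow> 0) (at x within U)"
    using assms by (simp add: has_vector_derivative_def has_derivative_within)
  then have "((\<lambda>y. norm (?r y)) \<longlongrightarrow> 0) (at x within U)"
    by (rule tendsto_norm_zero)
  moreover have "\<forall>\<^sub>F y in at x within U. norm (?r y) = norm ((1 / (y - x)) *\<^sub>R (f y - f x) - f')"
    unfolding eventually_at_filter
  proof (intro always_eventually allI impI)
    fix y assume "y \<noteq> x"
    then have "(1 / (y - x)) *\<^sub>R (f y - f x) - f' = (1 / (y - x)) *\<^sub>R (f y - (f x + (y - x) *\<^sub>R f'))"
      unfolding diff_diff_eq[symmetric] scaleR_diff_right[of _ "f y - f x"] by simp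
    then show "norm (?r y) = norm ((1 / (y - x)) *\<^sub>R (f y - f x) - f')"
      by simp
  qed
  ultimately have "((\<lambda>y. norm ((1 / (y - x)) *\<^sub>R (f y - f x) - f')) \<longlongrightarrow> 0) (at x within U)"
    by (rule Lim_transform_eventually)
  then show ?thesis
    by (rule LIM_zero_cancel[OF tendsto_norm_zero_cancel])
qed

text \<open>The mean value inequality on the convex set \<open>U\<close> bounds all difference
  quotients by the majorant \<open>h\<close> of the derivative; dominated convergence and
  Caratheodory's criterion then finish.\<close>

lemma has_vector_derivative_integral_dominated:
  fixes f :: "real \<Rightarrow> 'n::euclidean_space \<Rightarrow> 'm::euclidean_space"
  assumes U: "convex U" "x \<in> U"
    and f: "\<And>y. y \<in> U \<Longrightarrow> f y integrable_on S" and h: "h integrable_on S"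
    and f': "\<And>y w. y \<in> U \<Longrightarrow> w \<in> S \<Longrightarrow> ((\<lambda>y. f y w) has_vector_derivative f' y w) (at y within U)"
    and le: "\<And>y w. y \<in> U \<Longrightarrow> w \<in> S \<Longrightarrow> norm (f' y w) \<le> h w"
  shows "((\<lambda>y. integral S (f y)) has_vector_derivative integral S (f' x)) (at x within U)"
proof -
  let ?q = "\<lambda>y w. (1 / (y - x)) *\<^sub>R (f y w - f x w)"
  have "((\<lambda>y. integral S (?q y)) \<longlongrightarrow> integral S (f' x)) (at x within U)"
  proof (rule dominated_convergence_at_within[OF _ h])
    fix y w assume y: "y \<in> U" "y \<noteq> x" and w: "w \<in> S"
    have "norm (f y w - f x w) \<le> h w * norm (y - x)"
    proof (rule differentiable_bound[OF U(1)])
      fix v assume "v \<in> U"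
      then show "((\<lambda>y. f y w) has_derivative (\<lambda>r. r *\<^sub>R f' v w)) (at v within U)"
        using f' w by (simp add: has_vector_derivative_def)
      show "onorm (\<lambda>r. r *\<^sub>R f' v w) \<le> h w"
        using le[OF \<open>v \<in> U\<close> w] by (intro onorm_le) (simp add: mult.commute mult_left_mono)
    qed (use y U in auto)
    then show "norm (?q y w) \<le> h w"
      using y(2) by (simp add: divide_simps mult.commute split: if_splits)
  next
    fix w assume "w \<in> S"
    from f'[OF U(2) this]
    show "((\<lambda>y. ?q y w) \<longlongrightarrow> f' x w) (at x within U)"
      by (rule has_vector_derivative_quotient_tendsto)
  qed (intro integrable_cmul integrable_diff f U)
  then have lim: "((\<lambda>y. if y = x then integral S (f' x) else integral S (?q y)) \<longlongrightarrow> integral S (f' x)) (at x within U)"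
    by (rule Lim_transform_eventually) (simp add: eventually_at_filter)
  define q where "q = (\<lambda>y. if y = x then integral S (f' x) else integral S (?q y))"
  have "((\<lambda>y. integral S (f y)) has_vector_derivative q x) (at x within U)"
  proof (rule has_vector_derivative_caratheodory)
    fix y assume "y \<in> U"
    then show "integral S (f y) - integral S (f x) = (y - x) *\<^sub>R q y"
      using f U by (simp add: q_def integral_diff)
  qed (use lim in \<open>simp add: q_def\<close>)
  then show ?thesis by (simp add: q_def)
qed

section \<open>Gaussian estimates in frequency and time\<close>

lemma power2_has_vector_derivative: "((\<lambda>\<omega>::real. \<omega>\<^sup>2) has_vector_derivative 2 * \<omega>) (at \<omega> within S)"
  by (auto intro!: derivative_eq_intros simp: has_real_derivative_iff_has_vector_derivative[symmetric])

text \<open>From y \<le> exp y with y = c X: each power of \<open>X\<close> uses up one of the four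
  units of the rate 4 c, so up to two powers can be absorbed with the rate c left over. Applied with
  X = \<omega>^2 t.\<close>

lemma mult_exp_le:
  fixes c X :: real
  assumes c: "c > 0" and X: "X \<ge> 0"
  shows "exp (- 4 * c * X) \<le> exp (- c * X)" "X * exp (- 4 * c * X) \<le> (1 / c) * exp (- c * X)"
    "X\<^sup>2 * exp (- 4 * c * X) \<le> (1 / c\<^sup>2) * exp (- c * X)"
proof -
  have cX: "c * X \<ge> 0" using c X by simp
  show "exp (- 4 * c * X) \<le> exp (- c * X)" using cX by (simp add: mult.commute)
  have "c * X \<le> exp (c * X)"
    using exp_ge_add_one_self[of "c * X"] by linarith
  then have le: "X \<le> (1 / c) * exp (c * X)"
    using c by (simp add: field_simps)
  have "X * exp (- 4 * c * X) \<le> (1 / c) * exp (c * X) * exp (- 4 * c * X)"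
    by (rule mult_right_mono[OF le]) simp
  also have "\<dots> = (1 / c) * exp (- 3 * c * X)"
    by (simp add: exp_add[symmetric])
  also have "\<dots> \<le> (1 / c) * exp (- c * X)"
    using c X by (intro mult_left_mono) auto
  finally show "X * exp (- 4 * c * X) \<le> (1 / c) * exp (- c * X)" .
  have "X\<^sup>2 * exp (- 4 * c * X) \<le> ((1 / c) * exp (c * X))\<^sup>2 * exp (- 4 * c * X)"
    by (intro mult_right_mono power_mono le X) simp
  also have "\<dots> = (1 / c\<^sup>2) * exp (- 2 * c * X)"
    by (simp add: power2_eq_square exp_add[symmetric])
  also have "\<dots> \<le> (1 / c\<^sup>2) * exp (- c * X)"
    using c X by (intro mult_left_mono) auto
  finally show "X\<^sup>2 * exp (- 4 * c * X) \<le> (1 / c\<^sup>2) * exp (- c * X)" .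
qed

text \<open>For times bounded away from 0 the Gaussian is dominated by a power that still leaves
  quadratic decay after multiplication by 1 + \<omega>^2. The bound is the square of 1 + r
  \<omega>^2 \<le> exp (r \<omega>^2); the squaring explains the half in \<open>r\<close>.\<close>

lemma gaussian_le:
  fixes k d \<omega> t :: real
  assumes "k > 0" "0 < d" "d \<le> t"
  shows "exp (- k * (\<omega>\<^sup>2 * t)) \<le> (1 + 2 / (k * d))\<^sup>2 / (1 + \<omega>\<^sup>2)\<^sup>2"
proof -
  define r where "r = k * d / 2"
  have r: "r > 0" using assms by (simp add: r_def)
  have "1 + \<omega>\<^sup>2 \<le> (1 + 1 / r) * (1 + r * \<omega>\<^sup>2)"
    using r by (simp add: algebra_simps)
  also have "\<dots> \<le> (1 + 1 / r) * exp (r * \<omega>\<^sup>2)"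
    using r by (intro mult_left_mono exp_ge_add_one_self) auto
  finally have "(1 + \<omega>\<^sup>2)\<^sup>2 \<le> ((1 + 1 / r) * exp (r * \<omega>\<^sup>2))\<^sup>2"
    by (intro power_mono) auto
  also have "\<dots> = (1 + 1 / r)\<^sup>2 * exp (k * (\<omega>\<^sup>2 * d))"
    by (simp add: power_mult_distrib exp_double[symmetric] r_def mult_ac)
  also have "\<dots> \<le> (1 + 1 / r)\<^sup>2 * exp (k * (\<omega>\<^sup>2 * t))"
    using assms by (intro mult_left_mono) (auto intro!: mult_left_mono)
  finally have "(1 + \<omega>\<^sup>2)\<^sup>2 \<le> (1 + 1 / r)\<^sup>2 * exp (k * (\<omega>\<^sup>2 * t))" .
  then have "(1 + \<omega>\<^sup>2)\<^sup>2 * exp (- (k * (\<omega>\<^sup>2 * t))) \<le> (1 + 1 / r)\<^sup>2"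
    by (simp add: exp_minus divide_inverse[symmetric] divide_le_eq)
  moreover have "(1 + \<omega>\<^sup>2)\<^sup>2 > 0"
    by (intro zero_less_power add_pos_nonneg) auto
  ultimately have "exp (- (k * (\<omega>\<^sup>2 * t))) \<le> (1 + 1 / r)\<^sup>2 / (1 + \<omega>\<^sup>2)\<^sup>2"
    by (simp add: le_divide_eq mult.commute)
  then show ?thesis
    by (simp add: r_def)
qed

text \<open>Bounding the integrand by 1 gives the summand T; integrating k \<omega>^2 times the
  exponential exactly gives 1 / k for the part with \<omega>^2. A time integral thus gains a factor
  1 / (1 + \<omega>^2) uniformly up to time T, including times near 0.\<close>

lemma integral_exp_bound:
  fixes k \<omega> t :: real
  assumes k: "k > 0" and t: "0 \<le> t" "t \<le> T"
  shows "(1 + \<omega>\<^sup>2) * integral {0..t} (\<lambda>s. exp (- k * (\<omega>\<^sup>2 * (t - s)))) \<le> T + 1 / k"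
proof -
  let ?e = "\<lambda>s. exp (- k * (\<omega>\<^sup>2 * (t - s)))"
  have int: "?e integrable_on {0..t}"
    by (intro integrable_continuous_interval continuous_intros)
  have "integral {0..t} ?e \<le> integral {0..t} (\<lambda>_. 1)"
    using k by (intro integral_le int) auto
  then have 1: "integral {0..t} ?e \<le> T"
    using t by simp
  have "((\<lambda>s. (k * \<omega>\<^sup>2) * ?e s) has_integral ?e t - ?e 0) {0..t}"
    using t by (intro fundamental_theorem_of_calculus)
      (auto intro!: derivative_eq_intros simp: has_real_derivative_iff_has_vector_derivative[symmetric])
  then have "(k * \<omega>\<^sup>2) * integral {0..t} ?e = ?e t - ?e 0"
    by (metis integral_mult_right integral_unique)
  also have "\<dots> \<le> 1" by simp
  finally have "\<omega>\<^sup>2 * integral {0..t} ?e \<le> 1 / k"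
    using k by (simp add: field_simps)
  with 1 show ?thesis
    by (simp add: algebra_simps)
qed

text \<open>The weight \<open>w\<close> stands for the power of the frequency gained by the kernel:
  1 for \<open>E\<close>, 1 + |\<omega>| for \<open>E'\<close> and 1 + \<omega>^2 for
  \<open>E''\<close>.\<close>

lemma conv_norm_bound:
  fixes X :: "real \<Rightarrow> real^'n^'n" and c :: "real \<Rightarrow> real^'n"
  assumes k: "k > 0" and t: "0 \<le> t" "t \<le> T" and C: "C \<ge> 0" and w: "w \<ge> 0"
    and X: "continuous_on {0..} X" and c: "continuous_on {0..} c"
    and X_le: "\<And>r. 0 \<le> r \<Longrightarrow> r \<le> T \<Longrightarrow> w * norm (X r) \<le> C * exp (- k * (\<omega>\<^sup>2 * r))"
    and c_le: "\<And>s. 0 \<le> s \<Longrightarrow> s \<le> T \<Longrightarrow> norm (c s) \<le> K"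
  shows "w * norm (integral {0..t} (\<lambda>s. X (t - s) *v c s)) \<le> C * K * (T + 1 / k) / (1 + \<omega>\<^sup>2)"
proof -
  let ?e = "\<lambda>s. exp (- k * (\<omega>\<^sup>2 * (t - s)))"
  have K: "K \<ge> 0" using c_le[of 0] t norm_ge_zero[of "c 0"] by linarith
  have "norm (integral {0..t} (\<lambda>s. w *\<^sub>R (X (t - s) *v c s))) \<le> integral {0..t} (\<lambda>s. (C * K) * ?e s)"
  proof (rule integral_norm_bound_integral)
    show "(\<lambda>s. w *\<^sub>R (X (t - s) *v c s)) integrable_on {0..t}"
      by (intro integrable_continuous_interval continuous_intros matrix_vector_mult.continuous_on
          continuous_on_compose2[OF X] continuous_on_subset[OF c]) auto
    fix s assume s: "s \<in> {0..t}"
    have "norm (w *\<^sub>R (X (t - s) *v c s)) \<le> w * (norm (X (t - s)) * norm (c s))"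
      using w by (simp add: mult_left_mono norm_matrix_vector_mult_le)
    also have "\<dots> = (w * norm (X (t - s))) * norm (c s)" by simp
    also have "\<dots> \<le> (C * ?e s) * K"
      using s t C by (intro mult_mono X_le c_le) auto
    finally show "norm (w *\<^sub>R (X (t - s) *v c s)) \<le> (C * K) * ?e s" by (simp add: mult_ac)
  qed (intro integrable_continuous_interval continuous_intros)
  then have "w * norm (integral {0..t} (\<lambda>s. X (t - s) *v c s)) \<le> (C * K) * integral {0..t} ?e"
    using w by simp
  also have "\<dots> \<le> (C * K) * ((T + 1 / k) / (1 + \<omega>\<^sup>2))"
  proof (rule mult_left_mono)
    have "1 + \<omega>\<^sup>2 > 0" by (simp add: add_pos_nonneg)
    with integral_exp_bound[OF k t, of \<omega>] show "integral {0..t} ?e \<le> (T + 1 / k) / (1 + \<omega>\<^sup>2)"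
      by (simp add: le_divide_eq mult.commute)
  qed (use C K in simp)
  finally show ?thesis by simp
qed

section \<open>The exponential and its derivatives as functions of the frequency\<close>

context parabolic_matrices
begin

definition E :: "real \<Rightarrow> real \<Rightarrow> real^'n^'n" where
  "E \<omega> t = P (\<omega>\<^sup>2) t"

definition E' :: "real \<Rightarrow> real \<Rightarrow> real^'n^'n" where
  "E' \<omega> t = (2 * \<omega>) *\<^sub>R P' (\<omega>\<^sup>2) t"

definition E'' :: "real \<Rightarrow> real \<Rightarrow> real^'n^'n" where
  "E'' \<omega> t = 2 *\<^sub>R P' (\<omega>\<^sup>2) t + (4 * \<omega>\<^sup>2) *\<^sub>R P'' (\<omega>\<^sup>2) t"

lemma E_0 [simp]: "E \<omega> 0 = mat 1" and E'_0 [simp]: "E' \<omega> 0 = 0" and E''_0 [simp]: "E'' \<omega> 0 = 0"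
  by (simp_all add: E_def E'_def E''_def)

lemma continuous_on_E [continuous_intros]:
  fixes f g :: "'z::topological_space \<Rightarrow> real"
  assumes "continuous_on S f" "continuous_on S g"
  shows "continuous_on S (\<lambda>x. E (f x) (g x))"
  using assms unfolding E_def by (intro continuous_intros)

lemma continuous_on_E' [continuous_intros]:
  fixes f g :: "'z::topological_space \<Rightarrow> real"
  assumes "continuous_on S f" "continuous_on S g" "\<And>x. x \<in> S \<Longrightarrow> g x \<ge> 0"
  shows "continuous_on S (\<lambda>x. E' (f x) (g x))"
  using assms unfolding E'_def by (intro continuous_intros)

lemma continuous_on_E'' [continuous_intros]:
  fixes f g :: "'z::topological_space \<Rightarrow> real"
  assumes "continuous_on S f" "continuous_on S g" "\<And>x. x \<in> S \<Longrightarrow> g x \<ge> 0"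
  shows "continuous_on S (\<lambda>x. E'' (f x) (g x))"
  using assms unfolding E''_def by (intro continuous_intros)

lemma E_deriv_freq: "t \<ge> 0 \<Longrightarrow> ((\<lambda>\<omega>. E \<omega> t) has_vector_derivative E' \<omega> t) (at \<omega>)"
  using vector_diff_chain_at[OF power2_has_vector_derivative P_deriv_param, of t \<omega>]
  by (simp add: o_def E_def E'_def)

lemma E'_deriv_freq:
  assumes "t \<ge> 0"
  shows "((\<lambda>\<omega>. E' \<omega> t) has_vector_derivative E'' \<omega> t) (at \<omega>)"
proof -
  have 1: "((\<lambda>\<omega>. P' (\<omega>\<^sup>2) t) has_vector_derivative (2 * \<omega>) *\<^sub>R P'' (\<omega>\<^sup>2) t) (at \<omega>)"
    using vector_diff_chain_at[OF power2_has_vector_derivative P'_deriv_param, of t \<omega>] assms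
    by (simp add: o_def)
  have 2: "((\<lambda>\<omega>. 2 * \<omega>) has_real_derivative 2) (at \<omega>)"
    by (auto intro!: derivative_eq_intros)
  show ?thesis
    unfolding E'_def
    by (rule has_vector_derivative_eq_rhs[OF has_vector_derivative_scaleR[OF 2 1]])
      (simp add: E''_def power2_eq_square)
qed

lemma E_deriv_time: "(E \<omega> has_vector_derivative (A - \<omega>\<^sup>2 *\<^sub>R B) ** E \<omega> t) (at t within S)"
  unfolding E_def[abs_def] by (rule P_deriv_time)

lemma E_commute: "(A - \<omega>\<^sup>2 *\<^sub>R B) ** E \<omega> t = E \<omega> t ** (A - \<omega>\<^sup>2 *\<^sub>R B)"
  unfolding E_def by (rule P_commute)

lemma E''_deriv_time:
  assumes "t \<ge> 0"
  shows "(E'' \<omega> has_vector_derivative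
      (A - \<omega>\<^sup>2 *\<^sub>R B) ** E'' \<omega> t - 2 *\<^sub>R (B ** E \<omega> t) - (4 * \<omega>) *\<^sub>R (B ** E' \<omega> t)) (at t within {0..})"
  unfolding E''_def[abs_def]
  by (rule has_vector_derivative_eq_rhs, rule has_vector_derivative_add;
      (rule bounded_linear.has_vector_derivative[OF bounded_linear_scaleR_right P'_deriv_time[OF assms]]
        bounded_linear.has_vector_derivative[OF bounded_linear_scaleR_right P''_deriv_time[OF assms]])?)
    (simp add: E_def E'_def matrix_mult.scaleR_right matrix_mult.add_right scaleR_diff_right power2_eq_square mult_ac)

text \<open>The energy estimate decays at rate b = 4 \<kappa>; this is the normalisation under which
  \<open>mult_exp_le\<close> leaves the rate \<kappa>.\<close>

definition \<kappa> :: real where "\<kappa> = b / 4"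

lemma \<kappa>_pos: "\<kappa> > 0"
  using b_pos by (simp add: \<kappa>_def)

text \<open>A \<mu>-derivative costs a factor t, and the chain rule a factor \<omega>; powers of
  \<omega>^2 t are then absorbed into the exponential. The third and fourth bounds exploit the same
  estimate of \<open>E''\<close> differently: the weighted one yields decay in \<omega>, the last
  keeps the factor t that drives the limit t \<rightarrow> 0.\<close>

lemma E_bounds:
  assumes T: "T \<ge> 0"
  obtains C where "C > 0"
    "\<And>\<omega> t. 0 \<le> t \<Longrightarrow> t \<le> T \<Longrightarrow> norm (E \<omega> t) \<le> C * exp (- \<kappa> * (\<omega>\<^sup>2 * t))"
    "\<And>\<omega> t. 0 \<le> t \<Longrightarrow> t \<le> T \<Longrightarrow> (1 + \<bar>\<omega>\<bar>) * norm (E' \<omega> t) \<le> C * exp (- \<kappa> * (\<omega>\<^sup>2 * t))"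
    "\<And>\<omega> t. 0 \<le> t \<Longrightarrow> t \<le> T \<Longrightarrow> (1 + \<omega>\<^sup>2) * norm (E'' \<omega> t) \<le> C * exp (- \<kappa> * (\<omega>\<^sup>2 * t))"
    "\<And>\<omega> t. 0 \<le> t \<Longrightarrow> t \<le> T \<Longrightarrow> norm (E'' \<omega> t) \<le> C * t * exp (- \<kappa> * (\<omega>\<^sup>2 * t))"
proof -
  define k0 where "k0 = N\<^sub>1 * exp (norm A * T)"
  define k1 where "k1 = N\<^sub>1\<^sup>2 * norm B * exp (norm A * T)"
  define k2 where "k2 = N\<^sub>1 ^ 3 * (norm B)\<^sup>2 * exp (norm A * T)"
  have k: "k0 \<ge> 0" "k1 \<ge> 0" "k2 \<ge> 0"
    by (simp_all add: k0_def k1_def k2_def)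
  define C1 where "C1 = 2 * k1 * (T + 2 / \<kappa>)"
  define C2 where "C2 = 2 * k1 * T + 2 * k1 * (1 / \<kappa>) + 4 * k2 * T * (1 / \<kappa>) + 4 * k2 * (1 / \<kappa>\<^sup>2)"
  define C3 where "C3 = 2 * k1 + 4 * k2 * (1 / \<kappa>)"
  define C where "C = k0 + C1 + C2 + C3 + 1"
  have nonneg: "C1 \<ge> 0" "C2 \<ge> 0" "C3 \<ge> 0"
    using k T \<kappa>_pos by (simp_all add: C1_def C2_def C3_def)
  have C_le: "k0 \<le> C" "C1 \<le> C" "C2 \<le> C" "C3 \<le> C" "C > 0"
    using k nonneg by (simp_all add: C_def)
  show ?thesis
  proof (rule that[OF C_le(5)])
    fix \<omega> t :: real assume t: "0 \<le> t" "t \<le> T"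
    define X where "X = \<omega>\<^sup>2 * t"
    define q where "q = exp (- \<kappa> * X)"
    define e where "e = exp (- 4 * \<kappa> * X)"
    have X: "X \<ge> 0" using t by (simp add: X_def)
    have q: "q > 0" and e: "e > 0" by (simp_all add: q_def e_def)
    note ex = mult_exp_le[OF \<kappa>_pos X, folded e_def q_def]
    have te: "t * e \<le> T * q"
      by (rule mult_mono) (use t e ex T in auto)
    have tXe: "t * (X * e) \<le> T * ((1 / \<kappa>) * q)"
      by (rule mult_mono) (use t e ex T X in auto)
    have "exp ((norm A - b * \<omega>\<^sup>2) * t) = exp (norm A * t) * e"
      by (simp add: e_def X_def \<kappa>_def exp_add[symmetric] algebra_simps)
    also have "\<dots> \<le> exp (norm A * T) * e"
      using t e by (intro mult_right_mono) (auto intro: mult_left_mono)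
    finally have exp_le: "exp ((norm A - b * \<omega>\<^sup>2) * t) \<le> exp (norm A * T) * e" .
    have P: "norm (P (\<omega>\<^sup>2) t) \<le> k0 * e"
      using norm_P_le[OF t(1), of "\<omega>\<^sup>2"] mult_left_mono[OF exp_le, of "N\<^sub>1"]
      unfolding k0_def mult.assoc by simp
    have P': "norm (P' (\<omega>\<^sup>2) t) \<le> k1 * t * e"
      using norm_P'_le[OF t(1), of "\<omega>\<^sup>2"] mult_left_mono[OF exp_le, of "N\<^sub>1\<^sup>2 * norm B * t"] t
      unfolding k1_def by (simp add: mult_ac)
    have P'': "norm (P'' (\<omega>\<^sup>2) t) \<le> k2 * t\<^sup>2 * e"
      using norm_P''_le[OF t(1), of "\<omega>\<^sup>2"] mult_left_mono[OF exp_le, of "N\<^sub>1 ^ 3 * (norm B)\<^sup>2 * t\<^sup>2"] t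
      unfolding k2_def by (simp add: mult_ac)
    have "norm (E \<omega> t) \<le> k0 * q"
      using P mult_left_mono[OF ex(1) k(1)] by (simp add: E_def)
    also have "\<dots> \<le> C * q" using C_le q by simp
    finally show "norm (E \<omega> t) \<le> C * exp (- \<kappa> * (\<omega>\<^sup>2 * t))"
      by (simp add: q_def X_def)
    have "\<bar>\<omega>\<bar> \<le> 1 + \<omega>\<^sup>2"
    proof -
      have "0 \<le> (\<bar>\<omega>\<bar> - 1)\<^sup>2" "0 \<le> \<omega>\<^sup>2" by simp_all
      then show ?thesis by (simp add: power2_diff)
    qed
    then have w: "(1 + \<bar>\<omega>\<bar>) * \<bar>\<omega>\<bar> \<le> 1 + 2 * \<omega>\<^sup>2"
      by (simp add: algebra_simps power2_eq_square)
    have "(1 + \<bar>\<omega>\<bar>) * norm (E' \<omega> t) = ((1 + \<bar>\<omega>\<bar>) * \<bar>\<omega>\<bar>) * (2 * norm (P' (\<omega>\<^sup>2) t))"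
      by (simp add: E'_def abs_mult)
    also have "\<dots> \<le> (1 + 2 * \<omega>\<^sup>2) * (2 * (k1 * t * e))"
      using P' w by (intro mult_mono) auto
    also have "\<dots> = 2 * k1 * (t * e + 2 * (X * e))"
      by (simp add: X_def algebra_simps)
    also have "\<dots> \<le> 2 * k1 * (T * q + 2 * ((1 / \<kappa>) * q))"
      using te ex(2) k by (intro mult_left_mono add_mono) auto
    also have "\<dots> = C1 * q"
      by (simp add: C1_def algebra_simps)
    also have "\<dots> \<le> C * q" using C_le q by simp
    finally show "(1 + \<bar>\<omega>\<bar>) * norm (E' \<omega> t) \<le> C * exp (- \<kappa> * (\<omega>\<^sup>2 * t))"
      by (simp add: q_def X_def)
    have "norm (E'' \<omega> t) \<le> 2 * norm (P' (\<omega>\<^sup>2) t) + (4 * \<omega>\<^sup>2) * norm (P'' (\<omega>\<^sup>2) t)"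
      unfolding E''_def by (rule norm_triangle_le) simp
    also have "\<dots> \<le> 2 * (k1 * t * e) + (4 * \<omega>\<^sup>2) * (k2 * t\<^sup>2 * e)"
      using P' P'' by (intro add_mono mult_left_mono) auto
    also have "\<dots> = t * (2 * k1 * e + 4 * k2 * (X * e))"
      by (simp add: X_def power2_eq_square algebra_simps)
    finally have E'': "norm (E'' \<omega> t) \<le> t * (2 * k1 * e + 4 * k2 * (X * e))" .
    also have "\<dots> \<le> t * (2 * k1 * q + 4 * k2 * ((1 / \<kappa>) * q))"
      using t ex k by (intro mult_left_mono add_mono) auto
    also have "\<dots> = C3 * (t * q)"
      by (simp add: C3_def algebra_simps)
    also have "\<dots> \<le> C * (t * q)" using C_le q t by (intro mult_right_mono) auto
    finally show "norm (E'' \<omega> t) \<le> C * t * exp (- \<kappa> * (\<omega>\<^sup>2 * t))"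
      by (simp add: q_def X_def mult.assoc)
    \<comment> \<open>Here the factor t is spent: together with \<omega>^2 from the weight it
      becomes another power of \<open>X\<close>.\<close>
    have "(1 + \<omega>\<^sup>2) * norm (E'' \<omega> t) \<le> (1 + \<omega>\<^sup>2) * (t * (2 * k1 * e + 4 * k2 * (X * e)))"
      by (intro mult_left_mono E'') auto
    also have "\<dots> = 2 * k1 * (t * e) + 2 * k1 * (X * e) + 4 * k2 * (t * (X * e)) + 4 * k2 * (X\<^sup>2 * e)"
      by (simp add: X_def power2_eq_square algebra_simps)
    also have "\<dots> \<le> 2 * k1 * (T * q) + 2 * k1 * ((1 / \<kappa>) * q) + 4 * k2 * (T * ((1 / \<kappa>) * q)) + 4 * k2 * ((1 / \<kappa>\<^sup>2) * q)"
      using te tXe ex(2,3) k by (intro add_mono mult_left_mono) auto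
    also have "\<dots> = C2 * q"
      by (simp add: C2_def algebra_simps)
    also have "\<dots> \<le> C * q" using C_le q by simp
    finally show "(1 + \<omega>\<^sup>2) * norm (E'' \<omega> t) \<le> C * exp (- \<kappa> * (\<omega>\<^sup>2 * t))"
      by (simp add: q_def X_def)
  qed
qed

end

subsection \<open>The frequency density of the boundary term\<close>

context parabolic_matrices
begin

definition G :: "(real \<Rightarrow> real^'n) \<Rightarrow> real \<Rightarrow> real \<Rightarrow> real^'n" where
  "G c \<omega> t = integral {0..t} (\<lambda>s. E \<omega> (t - s) *v c s)"

definition G' :: "(real \<Rightarrow> real^'n) \<Rightarrow> real \<Rightarrow> real \<Rightarrow> real^'n" where
  "G' c \<omega> t = integral {0..t} (\<lambda>s. E' \<omega> (t - s) *v c s)"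

definition G'' :: "(real \<Rightarrow> real^'n) \<Rightarrow> real \<Rightarrow> real \<Rightarrow> real^'n" where
  "G'' c \<omega> t = integral {0..t} (\<lambda>s. E'' \<omega> (t - s) *v c s)"

text \<open>A reflection of the fact that G is even in \<omega>. It removes the boundary term in the
  second integration by parts of the cosine integral of G.\<close>

lemma G'_0 [simp]: "G' c 0 t = 0"
  by (simp add: G'_def E'_def)

context
  fixes c :: "real \<Rightarrow> real^'n"
  assumes c: "continuous_on {0..} c"
begin

lemma continuous_on_source:
  "continuous_on S f \<Longrightarrow> (\<And>x. x \<in> S \<Longrightarrow> f x \<ge> 0) \<Longrightarrow> continuous_on S (\<lambda>x. c (f x))"
  by (rule continuous_on_compose2[OF c]) auto

lemma G_deriv_freq:
  assumes "t \<ge> 0"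
  shows "((\<lambda>\<omega>. G c \<omega> t) has_vector_derivative G' c \<omega> t) (at \<omega> within UNIV)"
  unfolding G_def G'_def interval_cbox
proof (rule leibniz_rule_vector_derivative)
  show "((\<lambda>\<omega>. E \<omega> (t - s) *v c s) has_vector_derivative E' \<omega> (t - s) *v c s) (at \<omega> within UNIV)"
    if "s \<in> cbox 0 t" for \<omega> s
    using that by (intro bounded_linear.has_vector_derivative[OF matrix_vector_mult.bounded_linear_left] E_deriv_freq) auto
  show "continuous_on (UNIV \<times> cbox 0 t) (\<lambda>(\<omega>, s). E' \<omega> (t - s) *v c s)"
    unfolding split_beta by (auto intro!: continuous_intros continuous_on_source matrix_vector_mult.continuous_on)
qed (auto intro!: integrable_continuous_interval continuous_intros continuous_on_source matrix_vector_mult.continuous_on)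

lemma G'_deriv_freq:
  assumes "t \<ge> 0"
  shows "((\<lambda>\<omega>. G' c \<omega> t) has_vector_derivative G'' c \<omega> t) (at \<omega> within UNIV)"
  unfolding G'_def G''_def interval_cbox
proof (rule leibniz_rule_vector_derivative)
  show "((\<lambda>\<omega>. E' \<omega> (t - s) *v c s) has_vector_derivative E'' \<omega> (t - s) *v c s) (at \<omega> within UNIV)"
    if "s \<in> cbox 0 t" for \<omega> s
    using that by (intro bounded_linear.has_vector_derivative[OF matrix_vector_mult.bounded_linear_left] E'_deriv_freq) auto
  show "continuous_on (UNIV \<times> cbox 0 t) (\<lambda>(\<omega>, s). E'' \<omega> (t - s) *v c s)"
    unfolding split_beta by (auto intro!: continuous_intros continuous_on_source matrix_vector_mult.continuous_on)
qed (auto intro!: integrable_continuous_interval continuous_intros continuous_on_source matrix_vector_mult.continuous_on)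

lemma continuous_on_G:
  assumes "t \<ge> 0"
  shows "continuous_on S (\<lambda>\<omega>. G c \<omega> t)" "continuous_on S (\<lambda>\<omega>. G' c \<omega> t)" "continuous_on S (\<lambda>\<omega>. G'' c \<omega> t)"
proof -
  show "continuous_on S (\<lambda>\<omega>. G c \<omega> t)"
    by (rule continuous_on_vector_derivative, rule has_vector_derivative_within_subset[OF G_deriv_freq])
      (use assms in auto)
  show "continuous_on S (\<lambda>\<omega>. G' c \<omega> t)"
    by (rule continuous_on_vector_derivative, rule has_vector_derivative_within_subset[OF G'_deriv_freq])
      (use assms in auto)
  have "continuous_on UNIV (\<lambda>\<omega>. integral (cbox 0 t) (\<lambda>s. E'' \<omega> (t - s) *v c s))"
    by (rule integral_continuous_on_param)
      (unfold split_beta, auto intro!: continuous_intros continuous_on_source matrix_vector_mult.continuous_on)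
  then show "continuous_on S (\<lambda>\<omega>. G'' c \<omega> t)"
    unfolding G''_def by (auto intro: continuous_on_subset)
qed

lemma integral_matrix_vector:
  "continuous_on {0..t} h \<Longrightarrow> integral {0..t} (\<lambda>s. M *v h s) = M *v integral {0..t} h"
  for M :: "real^'n^'n" and h :: "real \<Rightarrow> real^'n"
  by (subst integral_linear[OF _ matrix_vector_mult.bounded_linear_right, symmetric])
    (auto simp: o_def intro: integrable_continuous_interval)

lemma G_deriv_time:
  assumes "t \<ge> 0"
  shows "(G c \<omega> has_vector_derivative c t + (A - \<omega>\<^sup>2 *\<^sub>R B) *v G c \<omega> t) (at t within {0..})"
proof -
  have "(G c \<omega> has_vector_derivative E \<omega> 0 *v c t +
      integral {0..t} (\<lambda>s. ((A - \<omega>\<^sup>2 *\<^sub>R B) ** E \<omega> (t - s)) *v c s)) (at t within {0..})"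
    unfolding G_def[abs_def]
    by (rule convolution_has_vector_derivative[OF bounded_bilinear_matrix_vector_mult])
      (auto intro!: E_deriv_time continuous_intros continuous_on_source matrix_mult.continuous_on c assms)
  moreover have "integral {0..t} (\<lambda>s. ((A - \<omega>\<^sup>2 *\<^sub>R B) ** E \<omega> (t - s)) *v c s) = (A - \<omega>\<^sup>2 *\<^sub>R B) *v G c \<omega> t"
    unfolding G_def matrix_vector_mul_assoc[symmetric]
    by (rule integral_matrix_vector) (auto intro!: continuous_intros continuous_on_source matrix_vector_mult.continuous_on)
  ultimately show ?thesis by simp
qed

text \<open>The equation of \<open>G\<close> contains the source \<open>c t\<close>, which does not
  decay in \<omega>. For \<open>G''\<close> the boundary term of the convolution is
  \<open>E'' \<omega> 0 *v c t = 0\<close>, so every term on the right decays quadratically and the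
  time derivative may be taken under the frequency integral.\<close>

lemma G''_deriv_time:
  assumes "t \<ge> 0"
  shows "(G'' c \<omega> has_vector_derivative (A - \<omega>\<^sup>2 *\<^sub>R B) *v G'' c \<omega> t
      - 2 *\<^sub>R (B *v G c \<omega> t) - (4 * \<omega>) *\<^sub>R (B *v G' c \<omega> t)) (at t within {0..})"
proof -
  let ?M = "A - \<omega>\<^sup>2 *\<^sub>R B"
  have "(G'' c \<omega> has_vector_derivative E'' \<omega> 0 *v c t +
      integral {0..t} (\<lambda>s. (?M ** E'' \<omega> (t - s) - 2 *\<^sub>R (B ** E \<omega> (t - s)) - (4 * \<omega>) *\<^sub>R (B ** E' \<omega> (t - s))) *v c s))
      (at t within {0..})"
    unfolding G''_def[abs_def]
    by (rule convolution_has_vector_derivative[OF bounded_bilinear_matrix_vector_mult])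
      (auto intro!: E''_deriv_time continuous_intros continuous_on_source matrix_mult.continuous_on c assms)
  moreover have "integral {0..t} (\<lambda>s. (?M ** E'' \<omega> (t - s) - 2 *\<^sub>R (B ** E \<omega> (t - s)) - (4 * \<omega>) *\<^sub>R (B ** E' \<omega> (t - s))) *v c s) =
     integral {0..t} (\<lambda>s. (?M *v (E'' \<omega> (t - s) *v c s) - 2 *\<^sub>R (B *v (E \<omega> (t - s) *v c s)))
        - (4 * \<omega>) *\<^sub>R (B *v (E' \<omega> (t - s) *v c s)))"
    by (simp add: matrix_vector_mult.diff_left matrix_vector_mult.scaleR_left matrix_vector_mul_assoc)
  moreover have "\<dots> = integral {0..t} (\<lambda>s. ?M *v (E'' \<omega> (t - s) *v c s) - 2 *\<^sub>R (B *v (E \<omega> (t - s) *v c s)))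
      - integral {0..t} (\<lambda>s. (4 * \<omega>) *\<^sub>R (B *v (E' \<omega> (t - s) *v c s)))"
    by (rule integral_diff)
      (auto intro!: integrable_continuous_interval continuous_intros continuous_on_source matrix_vector_mult.continuous_on)
  moreover have "integral {0..t} (\<lambda>s. ?M *v (E'' \<omega> (t - s) *v c s) - 2 *\<^sub>R (B *v (E \<omega> (t - s) *v c s))) =
      integral {0..t} (\<lambda>s. ?M *v (E'' \<omega> (t - s) *v c s)) - integral {0..t} (\<lambda>s. 2 *\<^sub>R (B *v (E \<omega> (t - s) *v c s)))"
    by (rule integral_diff)
      (auto intro!: integrable_continuous_interval continuous_intros continuous_on_source matrix_vector_mult.continuous_on)
  moreover have "integral {0..t} (\<lambda>s. ?M *v (E'' \<omega> (t - s) *v c s)) = ?M *v G'' c \<omega> t"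
    unfolding G''_def
    by (rule integral_matrix_vector) (auto intro!: continuous_intros continuous_on_source matrix_vector_mult.continuous_on)
  moreover have "integral {0..t} (\<lambda>s. B *v (E \<omega> (t - s) *v c s)) = B *v G c \<omega> t"
    unfolding G_def
    by (rule integral_matrix_vector) (auto intro!: continuous_intros continuous_on_source matrix_vector_mult.continuous_on)
  moreover have "integral {0..t} (\<lambda>s. B *v (E' \<omega> (t - s) *v c s)) = B *v G' c \<omega> t"
    unfolding G'_def
    by (rule integral_matrix_vector) (auto intro!: continuous_intros continuous_on_source matrix_vector_mult.continuous_on)
  ultimately show ?thesis by simp
qed

lemma source_bounded:
  obtains K where "K \<ge> 0" "\<And>s. 0 \<le> s \<Longrightarrow> s \<le> T \<Longrightarrow> norm (c s) \<le> K"
proof -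
  have "bounded (c ` {0..T})"
    by (intro compact_imp_bounded compact_continuous_image continuous_on_subset[OF c]) auto
  then obtain K where "K > 0" "\<forall>x\<in>c ` {0..T}. norm x \<le> K"
    using bounded_pos by blast
  then show ?thesis
    using that[of K] by auto
qed

text \<open>The weights are those of \<open>E_bounds\<close>; the further quotient by 1 + \<omega>^2
  comes from integrating the Gaussian in time. One constant serves all times up to T, which later
  allows majorants independent of t.\<close>

lemma G_bounds:
  assumes T: "T \<ge> 0"
  obtains C where "C \<ge> 0"
    "\<And>\<omega> t. 0 \<le> t \<Longrightarrow> t \<le> T \<Longrightarrow> norm (G c \<omega> t) \<le> C / (1 + \<omega>\<^sup>2)"
    "\<And>\<omega> t. 0 \<le> t \<Longrightarrow> t \<le> T \<Longrightarrow> (1 + \<bar>\<omega>\<bar>) * norm (G' c \<omega> t) \<le> C / (1 + \<omega>\<^sup>2)"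
    "\<And>\<omega> t. 0 \<le> t \<Longrightarrow> t \<le> T \<Longrightarrow> (1 + \<omega>\<^sup>2) * norm (G'' c \<omega> t) \<le> C / (1 + \<omega>\<^sup>2)"
proof -
  obtain D where D: "D > 0"
    "\<And>\<omega> t. 0 \<le> t \<Longrightarrow> t \<le> T \<Longrightarrow> norm (E \<omega> t) \<le> D * exp (- \<kappa> * (\<omega>\<^sup>2 * t))"
    "\<And>\<omega> t. 0 \<le> t \<Longrightarrow> t \<le> T \<Longrightarrow> (1 + \<bar>\<omega>\<bar>) * norm (E' \<omega> t) \<le> D * exp (- \<kappa> * (\<omega>\<^sup>2 * t))"
    "\<And>\<omega> t. 0 \<le> t \<Longrightarrow> t \<le> T \<Longrightarrow> (1 + \<omega>\<^sup>2) * norm (E'' \<omega> t) \<le> D * exp (- \<kappa> * (\<omega>\<^sup>2 * t))"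
    using E_bounds[OF T] by metis
  obtain K where K: "K \<ge> 0" "\<And>s. 0 \<le> s \<Longrightarrow> s \<le> T \<Longrightarrow> norm (c s) \<le> K"
    using source_bounded by blast
  show ?thesis
  proof (rule that[of "D * K * (T + 1 / \<kappa>)"])
    show "D * K * (T + 1 / \<kappa>) \<ge> 0"
      using D(1) K(1) T \<kappa>_pos by simp
    fix \<omega> t assume t: "0 \<le> t" "t \<le> T"
    have "1 * norm (G c \<omega> t) \<le> D * K * (T + 1 / \<kappa>) / (1 + \<omega>\<^sup>2)"
      unfolding G_def using D K
      by (intro conv_norm_bound \<kappa>_pos t c) (auto intro!: continuous_intros continuous_on_source)
    then show "norm (G c \<omega> t) \<le> D * K * (T + 1 / \<kappa>) / (1 + \<omega>\<^sup>2)"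
      by simp
    show "(1 + \<bar>\<omega>\<bar>) * norm (G' c \<omega> t) \<le> D * K * (T + 1 / \<kappa>) / (1 + \<omega>\<^sup>2)"
      unfolding G'_def using D K
      by (intro conv_norm_bound \<kappa>_pos t c) (auto intro!: continuous_intros continuous_on_source)
    show "(1 + \<omega>\<^sup>2) * norm (G'' c \<omega> t) \<le> D * K * (T + 1 / \<kappa>) / (1 + \<omega>\<^sup>2)"
      unfolding G''_def using D K
      by (intro conv_norm_bound \<kappa>_pos t c) (auto intro!: continuous_intros continuous_on_source)
  qed
qed

end

end

subsection \<open>Cosine and sine transforms of functions with quadratic decay\<close>

definition cos_int :: "(real \<Rightarrow> 'a::euclidean_space) \<Rightarrow> real \<Rightarrow> 'a" where
  "cos_int h z = integral {0..} (\<lambda>w. cos (w * z) *\<^sub>R h w)"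

definition sin_int :: "(real \<Rightarrow> 'a::euclidean_space) \<Rightarrow> real \<Rightarrow> 'a" where
  "sin_int h z = integral {0..} (\<lambda>w. sin (w * z) *\<^sub>R h w)"

text \<open>An integrability criterion with an explicit constant. Factors of modulus at most 1, such
  as cos (w z), preserve the constant, so all majorants and tail bounds obtained from it are uniform
  in z.\<close>

definition quad_decay :: "real \<Rightarrow> (real \<Rightarrow> 'a::euclidean_space) \<Rightarrow> bool" where
  "quad_decay C h \<longleftrightarrow> continuous_on {0..} h \<and> (\<forall>w\<ge>0. norm (h w) \<le> C / (1 + w\<^sup>2))"

lemma one_plus_square_pos [simp]: "0 < 1 + (w::real)\<^sup>2"
  by (simp add: add_pos_nonneg)

lemma quad_decay_continuous: "quad_decay C h \<Longrightarrow> continuous_on {0..} h"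
  and quad_decay_le: "quad_decay C h \<Longrightarrow> w \<ge> 0 \<Longrightarrow> norm (h w) \<le> C / (1 + w\<^sup>2)"
  by (auto simp: quad_decay_def)

lemma quad_decay_nonneg: "quad_decay C h \<Longrightarrow> C \<ge> 0"
  using order_trans[OF norm_ge_zero quad_decay_le[of C h 0]] by simp

lemma quad_decay_trig:
  fixes \<phi> :: "real \<Rightarrow> real"
  assumes h: "quad_decay C h" and \<phi>: "continuous_on {0..} \<phi>" "\<And>x. \<bar>\<phi> x\<bar> \<le> 1"
  shows "quad_decay C (\<lambda>w. \<phi> w *\<^sub>R h w)"
  unfolding quad_decay_def
proof (intro conjI allI impI)
  show "continuous_on {0..} (\<lambda>w. \<phi> w *\<^sub>R h w)"
    using h \<phi>(1) by (intro continuous_intros) (auto simp: quad_decay_def)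
  fix w :: real assume "w \<ge> 0"
  have "norm (\<phi> w *\<^sub>R h w) \<le> 1 * norm (h w)"
    unfolding norm_scaleR using \<phi>(2) by (intro mult_right_mono) auto
  then show "norm (\<phi> w *\<^sub>R h w) \<le> C / (1 + w\<^sup>2)"
    using quad_decay_le[OF h \<open>w \<ge> 0\<close>] by simp
qed

lemma quad_decay_integrable: "quad_decay C h \<Longrightarrow> h integrable_on {0..}"
  by (rule integrable_by_bound(1)[OF _ _ inverse_quadratic_integrable[of C]]) (auto simp: quad_decay_def)

lemma quad_decay_trig_integrable:
  assumes "quad_decay C h"
  shows "(\<lambda>w. cos (w * z) *\<^sub>R h w) integrable_on {0..}" "(\<lambda>w. sin (w * z) *\<^sub>R h w) integrable_on {0..}"
  using assms by (auto intro!: quad_decay_integrable quad_decay_trig continuous_intros)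

lemma inverse_quadratic_tendsto_0: "((\<lambda>w::real. C / (1 + w\<^sup>2)) \<longlongrightarrow> 0) at_top"
proof -
  have "w \<le> 1 + w\<^sup>2" for w :: real
  proof -
    have "0 \<le> (w - 1)\<^sup>2" by simp
    then have "2 * w \<le> 1 + w\<^sup>2" by (simp add: power2_diff)
    moreover have "0 \<le> w\<^sup>2" by simp
    ultimately show ?thesis by linarith
  qed
  then have "filterlim (\<lambda>w::real. 1 + w\<^sup>2) at_top at_top"
    by (intro filterlim_at_top_mono[OF filterlim_ident]) auto
  then show ?thesis
    by (intro tendsto_divide_0[OF tendsto_const] filterlim_at_top_imp_at_infinity)
qed

lemma quad_decay_tendsto:
  assumes "quad_decay C h" shows "(h \<longlongrightarrow> 0) at_top"
proof (rule Lim_null_comparison[OF _ inverse_quadratic_tendsto_0])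
  show "\<forall>\<^sub>F w in at_top. norm (h w) \<le> C / (1 + w\<^sup>2)"
    using assms by (auto simp: quad_decay_def intro!: eventually_at_top_linorderI[of 0])
qed

lemma quad_decay_add:
  assumes "quad_decay C f" "quad_decay D g"
  shows "quad_decay (C + D) (\<lambda>w. f w + g w)"
  using assms unfolding quad_decay_def
  by (auto intro!: continuous_intros norm_triangle_le simp: add_divide_distrib add_mono)

lemma quad_decay_scaleR:
  assumes "quad_decay C f" shows "quad_decay (\<bar>r\<bar> * C) (\<lambda>w. r *\<^sub>R f w)"
  using assms unfolding quad_decay_def
  by (auto intro!: continuous_intros mult_left_mono simp: times_divide_eq_right[symmetric] simp del: times_divide_eq_right)

lemma cos_int_linear:
  assumes "quad_decay C f" "quad_decay D g"
  shows "cos_int (\<lambda>w. f w + g w) z = cos_int f z + cos_int g z"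
    "sin_int (\<lambda>w. f w + g w) z = sin_int f z + sin_int g z"
    "cos_int (\<lambda>w. f w - g w) z = cos_int f z - cos_int g z"
  unfolding cos_int_def sin_int_def scaleR_add_right scaleR_diff_right
  by (intro integral_add integral_diff quad_decay_trig_integrable[OF assms(1)] quad_decay_trig_integrable[OF assms(2)])+

lemma cos_int_scaleR: "cos_int (\<lambda>w. r *\<^sub>R f w) z = r *\<^sub>R cos_int f z"
  unfolding cos_int_def scaleR_left_commute[of _ r] by (rule integral_cmul)

lemma cos_int_matrix:
  fixes M :: "real^'n^'n"
  assumes "quad_decay C f"
  shows "cos_int (\<lambda>w. M *v f w) z = M *v cos_int f z"
  unfolding cos_int_def
  by (subst integral_linear[OF quad_decay_trig_integrable(1)[OF assms] matrix_vector_mult.bounded_linear_right, symmetric])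
    (simp add: o_def matrix_vector_mult.scaleR_right)

lemma quad_decay_matrix:
  fixes M :: "real^'n^'n"
  assumes "quad_decay C f"
  shows "quad_decay (norm M * C) (\<lambda>w. M *v f w)"
  unfolding quad_decay_def
proof (intro conjI allI impI)
  show "continuous_on {0..} (\<lambda>w. M *v f w)"
    using assms by (intro matrix_vector_mult.continuous_on continuous_intros) (auto simp: quad_decay_def)
  fix w :: real assume "w \<ge> 0"
  have "norm (M *v f w) \<le> norm M * norm (f w)"
    by (rule norm_matrix_vector_mult_le)
  also have "\<dots> \<le> norm M * (C / (1 + w\<^sup>2))"
    by (intro mult_left_mono quad_decay_le[OF assms \<open>w \<ge> 0\<close>]) simp
  finally show "norm (M *v f w) \<le> norm M * C / (1 + w\<^sup>2)" by simp
qed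

text \<open>The boundary terms at infinity vanish by decay. At 0 the sine vanishes and the cosine
  does not, so \<open>h 0\<close> appears only in the second identity.\<close>

lemma trig_int_by_parts:
  assumes h: "\<And>w. w \<ge> 0 \<Longrightarrow> (h has_vector_derivative h' w) (at w within {0..})"
    and dh: "quad_decay C h" and dh': "quad_decay C' h'"
  shows "z *\<^sub>R cos_int h z = - sin_int h' z" "z *\<^sub>R sin_int h z = h 0 + cos_int h' z"
proof -
  note int = quad_decay_trig_integrable[OF dh, of z] quad_decay_trig_integrable[OF dh', of z]
  have sin': "((\<lambda>w. sin (w * z)) has_real_derivative z * cos (w * z)) (at w within {0..})" for w
    by (auto intro!: derivative_eq_intros)
  have cos': "((\<lambda>w. cos (w * z)) has_real_derivative - (z * sin (w * z))) (at w within {0..})" for w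
    by (auto intro!: derivative_eq_intros)
  have lim: "((\<lambda>w. sin (w * z) *\<^sub>R h w) \<longlongrightarrow> 0) at_top" "((\<lambda>w. cos (w * z) *\<^sub>R h w) \<longlongrightarrow> 0) at_top"
    by (intro quad_decay_tendsto[of C] quad_decay_trig dh; auto intro!: continuous_intros)+
  have "integral {0..} (\<lambda>w. sin (w * z) *\<^sub>R h' w + (z * cos (w * z)) *\<^sub>R h w) = 0 - sin (0 * z) *\<^sub>R h 0"
  proof (rule integral_atLeast_ftc[OF _ _ lim(1)])
    show "(\<lambda>w. sin (w * z) *\<^sub>R h' w + (z * cos (w * z)) *\<^sub>R h w) integrable_on {0..}"
      using integrable_cmul[OF int(1), of z] by (intro integrable_add int) simp
  qed (intro has_vector_derivative_scaleR sin' h)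
  then have "sin_int h' z + integral {0..} (\<lambda>w. z *\<^sub>R (cos (w * z) *\<^sub>R h w)) = 0"
    unfolding sin_int_def using int by (subst (asm) integral_add) (auto simp: scaleR_scaleR[symmetric] simp del: scaleR_scaleR intro: integrable_cmul)
  then show "z *\<^sub>R cos_int h z = - sin_int h' z"
    by (simp only: integral_cmul cos_int_def[symmetric] add_eq_0_iff)
  have "integral {0..} (\<lambda>w. cos (w * z) *\<^sub>R h' w + (- (z * sin (w * z))) *\<^sub>R h w) = 0 - cos (0 * z) *\<^sub>R h 0"
  proof (rule integral_atLeast_ftc[OF _ _ lim(2)])
    show "(\<lambda>w. cos (w * z) *\<^sub>R h' w + (- (z * sin (w * z))) *\<^sub>R h w) integrable_on {0..}"
      using integrable_cmul[OF int(2), of "- z"] by (intro integrable_add int) simp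
  qed (intro has_vector_derivative_scaleR cos' h)
  then have "cos_int h' z + integral {0..} (\<lambda>w. (- z) *\<^sub>R (sin (w * z) *\<^sub>R h w)) = - h 0"
    unfolding cos_int_def using integrable_cmul[OF int(2), of "- z"] by (subst (asm) integral_add[OF int(3)]) auto
  then have "cos_int h' z - z *\<^sub>R sin_int h z = - h 0"
    by (simp only: integral_cmul sin_int_def[symmetric]) simp
  then show "z *\<^sub>R sin_int h z = h 0 + cos_int h' z"
    by (simp add: algebra_simps)
qed

text \<open>The weight 1 + w lets a single bound provide the integrability of \<open>h\<close> as
  well as the majorant for w h, the integrand after differentiation in z.\<close>

lemma trig_int_deriv:
  assumes h: "continuous_on {0..} h" and le: "\<And>w. w \<ge> 0 \<Longrightarrow> (1 + w) * norm (h w) \<le> C / (1 + w\<^sup>2)"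
  shows "(cos_int h has_vector_derivative - sin_int (\<lambda>w. w *\<^sub>R h w) z) (at z within S)"
    "(sin_int h has_vector_derivative cos_int (\<lambda>w. w *\<^sub>R h w) z) (at z within S)"
proof -
  have "norm (h w) \<le> C / (1 + w\<^sup>2)" if "w \<ge> 0" for w
  proof -
    have "1 * norm (h w) \<le> (1 + w) * norm (h w)"
      using that by (intro mult_right_mono) auto
    with le[OF that] show ?thesis by simp
  qed
  with h have d: "quad_decay C h" by (simp add: quad_decay_def)
  have wh: "norm (\<phi> *\<^sub>R (w *\<^sub>R h w)) \<le> C / (1 + w\<^sup>2)" if "w \<ge> 0" "\<bar>\<phi>\<bar> \<le> 1" for w \<phi>
  proof -
    have "norm (\<phi> *\<^sub>R (w *\<^sub>R h w)) \<le> 1 * (w * norm (h w))"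
      unfolding norm_scaleR using that by (intro mult_mono) auto
    also have "\<dots> \<le> (1 + w) * norm (h w)"
      by (simp add: algebra_simps)
    finally show ?thesis using le[OF that(1)] by simp
  qed
  have "(cos_int h has_vector_derivative integral {0..} (\<lambda>w. (- sin (w * z)) *\<^sub>R (w *\<^sub>R h w))) (at z within UNIV)"
    unfolding cos_int_def[abs_def]
  proof (rule has_vector_derivative_integral_dominated[OF _ _ _ inverse_quadratic_integrable[of C]])
    show "((\<lambda>z. cos (w * z) *\<^sub>R h w) has_vector_derivative (- sin (w * z)) *\<^sub>R (w *\<^sub>R h w)) (at z within UNIV)" for z w
      by (rule has_vector_derivative_eq_rhs, rule has_vector_derivative_scaleR[where f' = "- (w * sin (w * z))"])
        (auto intro!: derivative_eq_intros)
  qed (use wh d quad_decay_trig_integrable in auto)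
  then have "(cos_int h has_vector_derivative - sin_int (\<lambda>w. w *\<^sub>R h w) z) (at z within UNIV)"
    by (simp add: sin_int_def)
  then show "(cos_int h has_vector_derivative - sin_int (\<lambda>w. w *\<^sub>R h w) z) (at z within S)"
    by (rule has_vector_derivative_within_subset) simp
  have "(sin_int h has_vector_derivative integral {0..} (\<lambda>w. cos (w * z) *\<^sub>R (w *\<^sub>R h w))) (at z within UNIV)"
    unfolding sin_int_def[abs_def]
  proof (rule has_vector_derivative_integral_dominated[OF _ _ _ inverse_quadratic_integrable[of C]])
    show "((\<lambda>z. sin (w * z) *\<^sub>R h w) has_vector_derivative cos (w * z) *\<^sub>R (w *\<^sub>R h w)) (at z within UNIV)" for z w
      by (rule has_vector_derivative_eq_rhs, rule has_vector_derivative_scaleR[where f' = "w * cos (w * z)"])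
        (auto intro!: derivative_eq_intros)
  qed (use wh d quad_decay_trig_integrable in auto)
  then show "(sin_int h has_vector_derivative cos_int (\<lambda>w. w *\<^sub>R h w) z) (at z within S)"
    unfolding cos_int_def by (rule has_vector_derivative_within_subset) simp
qed

text \<open>Shifting the frequency by half a period \<open>\<pi> / z\<close> changes the sign of the trigonometric factor.\<close>

lemma riemann_lebesgue:
  fixes \<phi> :: "real \<Rightarrow> real" and h :: "real \<Rightarrow> 'a::euclidean_space"
  assumes d: "quad_decay C h" and \<phi>: "continuous_on UNIV \<phi>" "\<And>x. \<bar>\<phi> x\<bar> \<le> 1" "\<And>x. \<phi> (x + pi) = - \<phi> x"
  shows "((\<lambda>z. integral {0..} (\<lambda>w. \<phi> (w * z) *\<^sub>R h w)) \<longlongrightarrow> 0) at_top"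
proof -
  note h = quad_decay_continuous[OF d]
  have C: "C \<ge> 0" by (rule quad_decay_nonneg[OF d])
  have ch: "continuous_on S (\<lambda>w. h (w + p))" if "p \<ge> 0" "S \<subseteq> {0..}" for p S
    by (rule continuous_on_compose2[OF h]) (use that in \<open>auto intro!: continuous_intros\<close>)
  have c\<phi>: "continuous_on S (\<lambda>w. \<phi> (w * z + c))" for S z c
    by (rule continuous_on_compose2[OF \<phi>(1)]) (auto intro!: continuous_intros)
  have shift_decay: "quad_decay C (\<lambda>w. h (w + p))" if "p \<ge> 0" for p
    unfolding quad_decay_def
  proof (intro conjI allI impI)
    fix w :: real assume w: "w \<ge> 0"
    have "norm (h (w + p)) \<le> C / (1 + (w + p)\<^sup>2)"
      using quad_decay_le[OF d, of "w + p"] w that by simp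
    also have "\<dots> \<le> C / (1 + w\<^sup>2)"
      using w that C by (intro divide_left_mono mult_pos_pos add_left_mono power_mono) auto
    finally show "norm (h (w + p)) \<le> C / (1 + w\<^sup>2)" .
  qed (use ch that in auto)
  have diff_decay: "quad_decay (2 * C) (\<lambda>w. h w - h (w + p))" if "p \<ge> 0" for p
    using quad_decay_add[OF d quad_decay_scaleR[OF shift_decay[OF that], of "-1"]] by simp
  have neg_sum: "a = j - x" if "- a = y" "j + y = x" for a j x y :: 'a
  proof -
    have "x = j - a" using that by (metis add_uminus_conv_diff)
    then show ?thesis by simp
  qed
  \<comment> \<open>With p = pi / z, the shift gives J = j - (the integral of \<phi> (w z) times h
    (w + p)), where j is the integral over the first half period. Hence 2 J is j, of size at most C
    p, plus an integral bounded by the L1 distance between \<open>h\<close> and its translate by p;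
    both tend to 0.\<close>
  have le: "norm (integral {0..} (\<lambda>w. \<phi> (w * z) *\<^sub>R h w)) \<le>
      (C * (pi / z) + integral {0..} (\<lambda>w. norm (h w - h (w + pi / z)))) / 2" if z: "z > 0" for z
  proof -
    define p where "p = pi / z"
    have p: "p > 0" "p * z = pi" using z by (simp_all add: p_def)
    let ?J = "integral {0..} (\<lambda>w. \<phi> (w * z) *\<^sub>R h w)"
    have d1: "quad_decay C (\<lambda>w. \<phi> (w * z) *\<^sub>R h w)" "quad_decay C (\<lambda>w. \<phi> (w * z) *\<^sub>R h (w + p))"
      using c\<phi>[of "{0..}" z 0] p \<phi>(2) quad_decay_trig[OF d] quad_decay_trig[OF shift_decay[of p]] by auto
    have i1: "((\<lambda>R. integral {0..R} (\<lambda>w. \<phi> (w * z) *\<^sub>R h (w + p))) \<longlongrightarrow> integral {0..} (\<lambda>w. \<phi> (w * z) *\<^sub>R h (w + p))) at_top"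
      by (rule integral_upto_tendsto[OF quad_decay_integrable[OF d1(2)]])
    have i2: "((\<lambda>R. integral {0..R + p} (\<lambda>w. \<phi> (w * z) *\<^sub>R h w)) \<longlongrightarrow> ?J) at_top"
      by (rule filterlim_compose[OF integral_upto_tendsto[OF quad_decay_integrable[OF d1(1)]]])
        (rule filterlim_at_top_mono[OF filterlim_ident], use p in simp)
    let ?j = "integral {0..p} (\<lambda>w. \<phi> (w * z) *\<^sub>R h w)"
    have "integral {0..R} (\<lambda>w. \<phi> (w * z) *\<^sub>R h (w + p)) = ?j - integral {0..R + p} (\<lambda>w. \<phi> (w * z) *\<^sub>R h w)"
      if R: "R \<ge> 0" for R
    proof -
      have c: "continuous_on {0..R + p} (\<lambda>w. \<phi> (w * z) *\<^sub>R h w)"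
        using c\<phi>[of _ z 0] by (intro continuous_intros continuous_on_subset[OF h]) auto
      have "integral {0..R} ((\<lambda>w. \<phi> (w * z) *\<^sub>R h w) \<circ> (\<lambda>x. x + p)) = integral {0 + p..R + p} (\<lambda>w. \<phi> (w * z) *\<^sub>R h w)"
        by (rule integral_shift) (use p in \<open>auto intro: continuous_on_subset[OF c]\<close>)
      moreover have "((\<lambda>w. \<phi> (w * z) *\<^sub>R h w) \<circ> (\<lambda>x. x + p)) = (\<lambda>w. - (\<phi> (w * z) *\<^sub>R h (w + p)))"
        by (auto simp: fun_eq_iff distrib_right p \<phi>(3))
      moreover have "?j + integral {p..R + p} (\<lambda>w. \<phi> (w * z) *\<^sub>R h w) = integral {0..R + p} (\<lambda>w. \<phi> (w * z) *\<^sub>R h w)"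
        using p R by (intro Henstock_Kurzweil_Integration.integral_combine integrable_continuous_interval c) auto
      ultimately show ?thesis using neg_sum by (simp only: integral_neg add_0_left)
    qed
    then have "\<forall>\<^sub>F R in at_top. ?j - integral {0..R + p} (\<lambda>w. \<phi> (w * z) *\<^sub>R h w) = integral {0..R} (\<lambda>w. \<phi> (w * z) *\<^sub>R h (w + p))"
      by (intro eventually_at_top_linorderI[of 0]) simp
    from Lim_transform_eventually[OF tendsto_diff[OF tendsto_const i2] this]
    have "integral {0..} (\<lambda>w. \<phi> (w * z) *\<^sub>R h (w + p)) = ?j - ?J"
      using i1 tendsto_unique trivial_limit_at_top_linorder by blast
    then have "2 *\<^sub>R ?J = ?j + (?J - integral {0..} (\<lambda>w. \<phi> (w * z) *\<^sub>R h (w + p)))"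
      by (simp add: scaleR_2)
    also have "?J - integral {0..} (\<lambda>w. \<phi> (w * z) *\<^sub>R h (w + p)) = integral {0..} (\<lambda>w. \<phi> (w * z) *\<^sub>R (h w - h (w + p)))"
      using integral_diff[OF quad_decay_integrable[OF d1(1)] quad_decay_integrable[OF d1(2)]]
      by (simp only: scaleR_diff_right)
    finally have "norm (2 *\<^sub>R ?J) = norm (?j + integral {0..} (\<lambda>w. \<phi> (w * z) *\<^sub>R (h w - h (w + p))))"
      by (rule arg_cong)
    also have "\<dots> \<le> norm ?j + norm (integral {0..} (\<lambda>w. \<phi> (w * z) *\<^sub>R (h w - h (w + p))))"
      by (rule norm_triangle_ineq)
    also have "norm ?j \<le> C * p"
    proof -
      have "norm (integral (cbox 0 p) (\<lambda>w. \<phi> (w * z) *\<^sub>R h w)) \<le> C * measure lborel (cbox 0 p)"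
      proof (rule integrable_bound[OF C])
        show "(\<lambda>w. \<phi> (w * z) *\<^sub>R h w) integrable_on cbox 0 p"
          using c\<phi>[of _ z 0] by (intro integrable_continuous continuous_intros continuous_on_subset[OF h]) auto
        fix w assume "w \<in> cbox 0 p"
        then have "norm (\<phi> (w * z) *\<^sub>R h w) \<le> C / (1 + w\<^sup>2)"
          by (intro quad_decay_le[OF d1(1)]) auto
        also have "\<dots> \<le> C / 1" using C by (intro divide_left_mono) auto
        finally show "norm (\<phi> (w * z) *\<^sub>R h w) \<le> C" by simp
      qed
      then show ?thesis using p by simp
    qed
    also have "norm (integral {0..} (\<lambda>w. \<phi> (w * z) *\<^sub>R (h w - h (w + p)))) \<le> integral {0..} (\<lambda>w. norm (h w - h (w + p)))"
    proof (rule integral_norm_bound_integral)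
      show "(\<lambda>w. \<phi> (w * z) *\<^sub>R (h w - h (w + p))) integrable_on {0..}"
        using c\<phi>[of "{0..}" z 0] p \<phi>(2) by (intro quad_decay_integrable[OF quad_decay_trig[OF diff_decay]]) auto
      show "(\<lambda>w. norm (h w - h (w + p))) integrable_on {0..}"
        using diff_decay[of p] p unfolding quad_decay_def
        by (intro integrable_by_bound(1)[OF _ _ inverse_quadratic_integrable[of "2 * C"]]) (auto intro!: continuous_on_norm)
      show "norm (\<phi> (w * z) *\<^sub>R (h w - h (w + p))) \<le> norm (h w - h (w + p))" for w
        using mult_right_mono[OF \<phi>(2), of "norm (h w - h (w + p))" "w * z"] by simp
    qed
    finally show ?thesis by (simp add: p_def)
  qed
  have p0: "((\<lambda>z. pi / z) \<longlongrightarrow> 0) at_top"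
    by (intro tendsto_divide_0[OF tendsto_const] filterlim_at_top_imp_at_infinity filterlim_ident)
  have "((\<lambda>z. integral {0..} (\<lambda>w. norm (h w - h (w + pi / z)))) \<longlongrightarrow> integral {0..} (\<lambda>w::real. 0 :: real)) at_top"
  proof (rule dominated_convergence_at_top[where K = 1, OF _ inverse_quadratic_integrable[of "2 * C"]])
    fix z :: real assume "z \<ge> 1"
    then have p: "pi / z \<ge> 0" by simp
    show le: "norm (norm (h w - h (w + pi / z))) \<le> 2 * C / (1 + w\<^sup>2)" if "w \<in> {0..}" for w
      using quad_decay_le[OF diff_decay[OF p], of w] that by simp
    show "(\<lambda>w. norm (h w - h (w + pi / z))) integrable_on {0..}"
      by (rule integrable_by_bound(1)[OF _ _ inverse_quadratic_integrable[of "2 * C"]])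
        (rule continuous_on_norm[OF quad_decay_continuous[OF diff_decay[OF p]]], use le in auto)
  next
    fix w :: real assume w: "w \<in> {0..}"
    have "((\<lambda>z. h (w + pi / z)) \<longlongrightarrow> h (w + 0)) at_top"
    proof (rule continuous_on_tendsto_compose[OF h])
      show "((\<lambda>z. w + pi / z) \<longlongrightarrow> w + 0) at_top"
        by (intro tendsto_intros p0)
      show "\<forall>\<^sub>F z in at_top. w + pi / z \<in> {0..}"
        using w by (intro eventually_at_top_linorderI[of 1]) simp
    qed (use w in simp)
    then have "((\<lambda>z. norm (h w - h (w + pi / z))) \<longlongrightarrow> norm (h w - h (w + 0))) at_top"
      by (intro tendsto_intros)
    then show "((\<lambda>z. norm (h w - h (w + pi / z))) \<longlongrightarrow> 0) at_top" by simp
  qed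
  then have "((\<lambda>z. (C * (pi / z) + integral {0..} (\<lambda>w. norm (h w - h (w + pi / z)))) / 2) \<longlongrightarrow> (C * 0 + 0) / 2) at_top"
    by (intro tendsto_intros p0) simp_all
  then have "((\<lambda>z. (C * (pi / z) + integral {0..} (\<lambda>w. norm (h w - h (w + pi / z)))) / 2) \<longlongrightarrow> 0) at_top"
    by simp
  then show ?thesis
    by (rule Lim_null_comparison[rotated]) (intro eventually_at_top_linorderI[of 1] le, simp)
qed

lemma trig_int_tendsto_0:
  assumes "quad_decay C h"
  shows "(cos_int h \<longlongrightarrow> 0) at_top" "(sin_int h \<longlongrightarrow> 0) at_top"
  unfolding cos_int_def[abs_def] sin_int_def[abs_def]
  by (rule riemann_lebesgue[OF assms]; simp add: continuous_on_cos continuous_on_sin continuous_on_id)+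

section \<open>Cosine transforms of profiles whose derivatives gain decay\<close>

lemma mult_le_one_plus_square: "(1 + w) * w \<le> 2 * (1 + (w::real)\<^sup>2)"
proof -
  have eq: "2 * (1 + w\<^sup>2) - (1 + w) * w = ((w - 1)\<^sup>2 + w\<^sup>2 + 3) / 2"
    by (simp add: power2_eq_square field_simps)
  have "0 \<le> ((w - 1)\<^sup>2 + w\<^sup>2 + 3) / 2" by simp
  then show ?thesis unfolding eq[symmetric] by (simp only: diff_ge_0_iff_ge)
qed

text \<open>Isolates what is used of the frequency density \<open>G\<close> at a fixed time: each
  derivative gains a power of the frequency, and the first derivative vanishes at 0, as for an even
  function.\<close>

locale decaying_profile =
  fixes H H' H'' :: "real \<Rightarrow> 'a::euclidean_space" and C :: real
  assumes H: "\<And>w. (H has_vector_derivative H' w) (at w within UNIV)"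
    and H': "\<And>w. (H' has_vector_derivative H'' w) (at w within UNIV)"
    and H'': "continuous_on UNIV H''"
    and H'0: "H' 0 = 0" and C: "C \<ge> 0"
    and H_le: "\<And>w. norm (H w) \<le> C / (1 + w\<^sup>2)"
    and H'_le: "\<And>w. (1 + \<bar>w\<bar>) * norm (H' w) \<le> C / (1 + w\<^sup>2)"
    and H''_le: "\<And>w. (1 + w\<^sup>2) * norm (H'' w) \<le> C / (1 + w\<^sup>2)"
begin

lemma continuous_profile: "continuous_on S H" "continuous_on S H'" "continuous_on S H''"
proof -
  show "continuous_on S H" "continuous_on S H'"
    by (rule continuous_on_vector_derivative; rule has_vector_derivative_within_subset[OF H subset_UNIV]
        has_vector_derivative_within_subset[OF H' subset_UNIV])+
  show "continuous_on S H''"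
    by (rule continuous_on_subset[OF H'']) simp
qed

lemma H''_le2: "w \<ge> 0 \<Longrightarrow> (1 + w) * norm (H'' w) \<le> 2 * C / (1 + w\<^sup>2)"
proof -
  have "0 \<le> (w - 1)\<^sup>2" by simp
  then have "1 + w \<le> 2 * (1 + w\<^sup>2)"
    by (simp add: power2_diff) (use zero_le_power2[of w] in linarith)
  then have "(1 + w) * norm (H'' w) \<le> (2 * (1 + w\<^sup>2)) * norm (H'' w)"
    by (intro mult_right_mono) auto
  also have "\<dots> = 2 * ((1 + w\<^sup>2) * norm (H'' w))"
    by (simp only: mult.assoc)
  also have "\<dots> \<le> 2 * (C / (1 + w\<^sup>2))"
    by (intro mult_left_mono H''_le) simp
  finally show ?thesis by simp
qed

lemma profile_decay:
  "quad_decay C H" "quad_decay C H'" "quad_decay C H''"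
  "quad_decay C (\<lambda>w. w *\<^sub>R H' w)" "quad_decay (2 * C) (\<lambda>w. w *\<^sub>R H'' w)" "quad_decay C (\<lambda>w. w\<^sup>2 *\<^sub>R H'' w)"
  unfolding quad_decay_def
proof (safe intro!: continuous_intros continuous_profile)
  fix w :: real assume w: "w \<ge> 0"
  show "norm (H w) \<le> C / (1 + w\<^sup>2)" by (rule H_le)
  have "1 * norm (H' w) \<le> (1 + \<bar>w\<bar>) * norm (H' w)" "w * norm (H' w) \<le> (1 + \<bar>w\<bar>) * norm (H' w)"
    using w by (intro mult_right_mono; simp)+
  with H'_le[of w] w show "norm (H' w) \<le> C / (1 + w\<^sup>2)" "norm (w *\<^sub>R H' w) \<le> C / (1 + w\<^sup>2)"
    by simp_all
  have "1 * norm (H'' w) \<le> (1 + w\<^sup>2) * norm (H'' w)" "w\<^sup>2 * norm (H'' w) \<le> (1 + w\<^sup>2) * norm (H'' w)"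
    by (intro mult_right_mono; simp)+
  with H''_le[of w] show "norm (H'' w) \<le> C / (1 + w\<^sup>2)" "norm (w\<^sup>2 *\<^sub>R H'' w) \<le> C / (1 + w\<^sup>2)"
    by simp_all
  have "w * norm (H'' w) \<le> (1 + w) * norm (H'' w)"
    using w by (intro mult_right_mono) auto
  with H''_le2[OF w] w show "norm (w *\<^sub>R H'' w) \<le> 2 * C / (1 + w\<^sup>2)"
    by simp
qed

text \<open>Two integrations by parts, the boundary term of the second being
  \<open>H' 0 = 0\<close>. The quadratic decay of \<open>H\<close> does not allow differentiation
  under the integral, but the quartic decay of \<open>H''\<close> allows it twice.\<close>

lemma cos_int_profile: "z \<noteq> 0 \<Longrightarrow> cos_int H z = - (1 / z\<^sup>2) *\<^sub>R cos_int H'' z"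
proof -
  assume z: "z \<noteq> 0"
  have "z *\<^sub>R cos_int H z = - sin_int H' z" "z *\<^sub>R sin_int H' z = H' 0 + cos_int H'' z"
    by (rule trig_int_by_parts(1)[OF _ profile_decay(1,2)] trig_int_by_parts(2)[OF _ profile_decay(2,3)];
        rule has_vector_derivative_within_subset[OF H subset_UNIV] has_vector_derivative_within_subset[OF H' subset_UNIV])+
  then have "z *\<^sub>R (z *\<^sub>R cos_int H z) = - cos_int H'' z"
    by (simp add: H'0)
  then have "(1 / z\<^sup>2) *\<^sub>R (z\<^sup>2 *\<^sub>R cos_int H z) = (1 / z\<^sup>2) *\<^sub>R - cos_int H'' z"
    by (simp add: power2_eq_square)
  with z show ?thesis by simp
qed

text \<open>Serves to eliminate the sine transform from the second derivative, leaving cosine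
  transforms in which the differential equation can be recognised.\<close>

lemma sin_int_profile: "sin_int (\<lambda>w. w *\<^sub>R H'' w) z = z *\<^sub>R cos_int H z - z *\<^sub>R cos_int (\<lambda>w. w *\<^sub>R H' w) z"
proof -
  have "((\<lambda>w. w *\<^sub>R H' w) has_vector_derivative w *\<^sub>R H'' w + 1 *\<^sub>R H' w) (at w within {0..})" for w
    by (intro has_vector_derivative_scaleR derivative_intros has_vector_derivative_within_subset[OF H' subset_UNIV])
  then have "z *\<^sub>R cos_int (\<lambda>w. w *\<^sub>R H' w) z = - sin_int (\<lambda>w. w *\<^sub>R H'' w + H' w) z"
    by (intro trig_int_by_parts(1)[OF _ profile_decay(4) quad_decay_add[OF profile_decay(5,2)]]) simp
  also have "sin_int (\<lambda>w. w *\<^sub>R H'' w + H' w) z = sin_int (\<lambda>w. w *\<^sub>R H'' w) z + sin_int H' z"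
    by (rule cos_int_linear(2)[OF profile_decay(5,2)])
  finally have "z *\<^sub>R cos_int (\<lambda>w. w *\<^sub>R H' w) z = - (sin_int (\<lambda>w. w *\<^sub>R H'' w) z + sin_int H' z)" .
  moreover have "z *\<^sub>R cos_int H z = - sin_int H' z"
    by (rule trig_int_by_parts(1)[OF _ profile_decay(1,2)], rule has_vector_derivative_within_subset[OF H subset_UNIV])
  ultimately show ?thesis by (simp add: algebra_simps)
qed

definition cos_int_d1 :: "real \<Rightarrow> 'a" where
  "cos_int_d1 z = (1 / z\<^sup>2) *\<^sub>R sin_int (\<lambda>w. w *\<^sub>R H'' w) z + (2 / z ^ 3) *\<^sub>R cos_int H'' z"

text \<open>Formally the second derivative is minus the transform of w^2 H, whose integral need not
  converge. The rule of \<open>cos_int_profile\<close>, applied to w^2 H, turns it into 1 / z^2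
  times the transform of (w^2 H)'' = w^2 H'' + 4 w H' + 2 H.\<close>

definition cos_int_d2 :: "real \<Rightarrow> 'a" where
  "cos_int_d2 z = (1 / z\<^sup>2) *\<^sub>R (cos_int (\<lambda>w. w\<^sup>2 *\<^sub>R H'' w) z + 4 *\<^sub>R cos_int (\<lambda>w. w *\<^sub>R H' w) z + 2 *\<^sub>R cos_int H z)"

lemma H''_trig_deriv:
  "(cos_int H'' has_vector_derivative - sin_int (\<lambda>w. w *\<^sub>R H'' w) z) (at z)"
  "(sin_int (\<lambda>w. w *\<^sub>R H'' w) has_vector_derivative cos_int (\<lambda>w. w\<^sup>2 *\<^sub>R H'' w) z) (at z)"
proof -
  show "(cos_int H'' has_vector_derivative - sin_int (\<lambda>w. w *\<^sub>R H'' w) z) (at z)"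
    by (rule trig_int_deriv(1)[OF continuous_profile(3) H''_le2])
  have "(1 + w) * norm (w *\<^sub>R H'' w) \<le> 2 * C / (1 + w\<^sup>2)" if w: "w \<ge> 0" for w
  proof -
    have "(1 + w) * norm (w *\<^sub>R H'' w) = ((1 + w) * w) * norm (H'' w)"
      using w by simp
    also have "\<dots> \<le> (2 * (1 + w\<^sup>2)) * norm (H'' w)"
      by (rule mult_right_mono[OF mult_le_one_plus_square]) simp
    also have "\<dots> = 2 * ((1 + w\<^sup>2) * norm (H'' w))"
      by (simp only: mult.assoc)
    also have "\<dots> \<le> 2 * (C / (1 + w\<^sup>2))"
      by (intro mult_left_mono H''_le) simp
    finally show ?thesis by simp
  qed
  then have "(sin_int (\<lambda>w. w *\<^sub>R H'' w) has_vector_derivative cos_int (\<lambda>w. w *\<^sub>R (w *\<^sub>R H'' w)) z) (at z)"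
    by (intro trig_int_deriv(2)) (auto intro!: continuous_intros continuous_profile)
  then show "(sin_int (\<lambda>w. w *\<^sub>R H'' w) has_vector_derivative cos_int (\<lambda>w. w\<^sup>2 *\<^sub>R H'' w) z) (at z)"
    by (simp add: power2_eq_square)
qed

lemma cos_int_deriv1:
  assumes z: "z > 0"
  shows "(cos_int H has_vector_derivative cos_int_d1 z) (at z)"
proof -
  have "((\<lambda>z. - (1 / z\<^sup>2)) has_real_derivative 2 / z ^ 3) (at z)"
    using z by (auto intro!: derivative_eq_intros simp: field_simps power2_eq_square power3_eq_cube)
  from has_vector_derivative_scaleR[OF this H''_trig_deriv(1)]
  have "((\<lambda>z. - (1 / z\<^sup>2) *\<^sub>R cos_int H'' z) has_vector_derivative cos_int_d1 z) (at z)"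
    by (simp add: cos_int_d1_def)
  then show ?thesis
    by (rule has_vector_derivative_transform_within_open[where S = "{0<..}"])
      (use z in \<open>auto simp: cos_int_profile\<close>)
qed

lemma cos_int_deriv2:
  assumes z: "z > 0"
  shows "(cos_int_d1 has_vector_derivative cos_int_d2 z) (at z)"
proof -
  have 1: "((\<lambda>z. 1 / z\<^sup>2) has_real_derivative - (2 / z ^ 3)) (at z)"
    using z by (auto intro!: derivative_eq_intros simp: field_simps power2_eq_square power3_eq_cube)
  have 2: "((\<lambda>z. 2 / z ^ 3) has_real_derivative - (6 / z ^ 4)) (at z)"
    using z by (auto intro!: derivative_eq_intros simp: field_simps power2_eq_square power3_eq_cube power4_eq_xxxx)
  have h: "cos_int H'' z = - (z\<^sup>2 *\<^sub>R cos_int H z)"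
    using z by (simp add: cos_int_profile)
  have k: "2 / z ^ 3 * z = 2 / z\<^sup>2" "6 / z ^ 4 * z\<^sup>2 = 6 / z\<^sup>2"
    using z by (simp_all add: field_simps power2_eq_square power3_eq_cube power4_eq_xxxx)
  note d = has_vector_derivative_add[OF has_vector_derivative_scaleR[OF 1 H''_trig_deriv(2)]
      has_vector_derivative_scaleR[OF 2 H''_trig_deriv(1)]]
  let ?S = "sin_int (\<lambda>w. w *\<^sub>R H'' w) z" and ?a = "cos_int H z" and ?b = "cos_int (\<lambda>w. w *\<^sub>R H' w) z"
  \<comment> \<open>The product rule leaves -4 / z^3 times the sine transform and -6 / z^4 times the
    transform of \<open>H''\<close>. Writing the former as z (a - b) and the latter as - z^2 a
    produces the coefficients 4 of b and -4 + 6 = 2 of a.\<close>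
  have S: "(2 / z ^ 3) *\<^sub>R ?S = (2 / z\<^sup>2) *\<^sub>R ?a - (2 / z\<^sup>2) *\<^sub>R ?b"
    unfolding sin_int_profile scaleR_diff_right scaleR_scaleR k ..
  have c: "(6 / z ^ 4) *\<^sub>R cos_int H'' z = - ((6 / z\<^sup>2) *\<^sub>R ?a)"
    unfolding h scaleR_minus_right scaleR_scaleR k ..
  have two: "(4 / z\<^sup>2) *\<^sub>R x = (2 / z\<^sup>2) *\<^sub>R x + (2 / z\<^sup>2) *\<^sub>R x"
    "(6 / z\<^sup>2) *\<^sub>R x = (2 / z\<^sup>2) *\<^sub>R x + (2 / z\<^sup>2) *\<^sub>R x + (2 / z\<^sup>2) *\<^sub>R x" for x :: 'a
    by (simp_all add: scaleR_add_left[symmetric])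
  show ?thesis
    unfolding cos_int_d1_def[abs_def]
    by (rule has_vector_derivative_eq_rhs[OF d])
      (simp add: cos_int_d2_def scaleR_add_right S c two)
qed

lemma cos_int_d1_tendsto_0: "(cos_int_d1 \<longlongrightarrow> 0) at_top"
proof -
  have "((\<lambda>z::real. 1 / z ^ 2) \<longlongrightarrow> 0) at_top" "((\<lambda>z::real. 2 / z ^ 3) \<longlongrightarrow> 0) at_top"
    by (intro tendsto_divide_0[OF tendsto_const] filterlim_at_top_imp_at_infinity filterlim_pow_at_top filterlim_ident; simp)+
  from tendsto_add[OF tendsto_scaleR[OF this(1) trig_int_tendsto_0(2)[OF profile_decay(5)]]
      tendsto_scaleR[OF this(2) trig_int_tendsto_0(1)[OF profile_decay(3)]]]
  show ?thesis
    unfolding cos_int_d1_def[abs_def] by simp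
qed

end

subsection \<open>The Fejer kernel\<close>

text \<open>The value at \<open>0\<close> is the junk value \<open>0\<close> instead of the limit \<open>a / 2\<close>.\<close>

definition fejer :: "real \<Rightarrow> real \<Rightarrow> real" where
  "fejer a x = (1 - cos (a * x)) / (a * x\<^sup>2)"

lemma one_minus_cos_le: "1 - cos x \<le> x\<^sup>2 / 2" for x :: real
proof -
  have "(sin (x / 2))\<^sup>2 \<le> (x / 2)\<^sup>2"
    using abs_sin_x_le_abs_x[of "x / 2"] by (simp only: abs_le_square_iff)
  moreover have "cos x = 1 - 2 * (sin (x / 2))\<^sup>2"
    using cos_double_sin[of "x / 2"] by simp
  ultimately show ?thesis
    by (simp add: power_divide)
qed

lemma fejer_nonneg: "a > 0 \<Longrightarrow> 0 \<le> fejer a x"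
  by (simp add: fejer_def)

lemma fejer_le: "a > 0 \<Longrightarrow> fejer a x \<le> a / 2"
proof (cases "x = 0")
  case False
  assume "a > 0"
  then have "fejer a x \<le> ((a * x)\<^sup>2 / 2) / (a * x\<^sup>2)"
    unfolding fejer_def by (intro divide_right_mono one_minus_cos_le) simp
  also have "\<dots> = a / 2"
    using False \<open>a > 0\<close> by (simp add: power2_eq_square)
  finally show ?thesis .
qed (simp add: fejer_def)

lemma fejer_le_inverse_square:
  assumes "a > 0" "d > 0" "d \<le> \<bar>x\<bar>"
  shows "fejer a x \<le> 2 / (a * d\<^sup>2)"
proof -
  have "d\<^sup>2 \<le> x\<^sup>2"
    using assms by (metis abs_le_square_iff abs_of_pos)
  then have "2 / (a * x\<^sup>2) \<le> 2 / (a * d\<^sup>2)"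
    using assms by (intro divide_left_mono mult_left_mono mult_pos_pos) auto
  moreover have "fejer a x \<le> 2 / (a * x\<^sup>2)"
    unfolding fejer_def using assms cos_ge_minus_one[of "a * x"]
    by (intro divide_right_mono) (linarith, simp)
  ultimately show ?thesis by linarith
qed

lemma fejer_measurable [measurable]: "fejer a \<in> borel_measurable borel"
  unfolding fejer_def[abs_def] by measurable

text \<open>An antiderivative of (1 - cos v) / v^2, found by integrating by parts towards the sine
  integral. At 0 the default value of the quotient agrees with its limit 0, so the function is
  continuous there.\<close>

definition fejer_primitive :: "real \<Rightarrow> real" where
  "fejer_primitive v = Si v - (1 - cos v) / v"

lemma fejer_primitive_deriv:
  assumes "v \<noteq> 0"
  shows "(fejer_primitive has_real_derivative (1 - cos v) / v\<^sup>2) (at v)"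
proof -
  have "((\<lambda>v. (1 - cos v) / v) has_real_derivative sin v / v - (1 - cos v) / v\<^sup>2) (at v)"
    using assms by (auto intro!: derivative_eq_intros simp: field_simps power2_eq_square)
  from DERIV_diff[OF DERIV_Si this]
  show ?thesis
    using assms by (simp add: fejer_primitive_def[abs_def])
qed

lemma fejer_primitive_continuous: "continuous_on UNIV fejer_primitive"
proof (rule continuous_at_imp_continuous_on, intro ballI)
  fix v :: real
  show "isCont fejer_primitive v"
  proof (cases "v = 0")
    case True
    have "((\<lambda>v::real. (1 - cos v) / v) \<longlongrightarrow> 0) (at 0)"
    proof (rule Lim_null_comparison)
      have half: "(x * x / 2) / x \<le> x" if "x > 0" for x :: real
        using that by simp
      have "norm ((1 - cos v) / v) \<le> \<bar>v\<bar>" for v :: real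
      proof (cases "v = 0")
        case False
        have "norm ((1 - cos v) / v) = (1 - cos v) / \<bar>v\<bar>"
          by (simp add: abs_divide)
        also have "\<dots> \<le> (v\<^sup>2 / 2) / \<bar>v\<bar>"
          by (intro divide_right_mono one_minus_cos_le) simp
        also have "v\<^sup>2 = \<bar>v\<bar> * \<bar>v\<bar>"
          by (simp add: power2_eq_square)
        also have "(\<bar>v\<bar> * \<bar>v\<bar> / 2) / \<bar>v\<bar> \<le> \<bar>v\<bar>"
          using False by (intro half) simp
        finally show ?thesis .
      qed simp
      then show "\<forall>\<^sub>F v in at 0. norm ((1 - cos v) / v) \<le> \<bar>v\<bar>" for v :: real
        by simp
      show "((\<lambda>v::real. \<bar>v\<bar>) \<longlongrightarrow> 0) (at 0)"
        using tendsto_rabs_zero tendsto_ident_at by blast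
    qed
    then have "isCont (\<lambda>v::real. (1 - cos v) / v) 0"
      by (simp add: isCont_def)
    then show ?thesis
      unfolding True fejer_primitive_def[abs_def] by (intro continuous_diff DERIV_isCont[OF DERIV_Si])
  qed (rule DERIV_isCont[OF fejer_primitive_deriv])
qed

lemma fejer_primitive_odd: "fejer_primitive (- v) = - fejer_primitive v" if "v \<ge> 0"
  using that by (simp add: fejer_primitive_def Si_neg)

lemma fejer_primitive_0 [simp]: "fejer_primitive 0 = 0"
  using fejer_primitive_odd[of 0] by simp

lemma fejer_primitive_tendsto: "(fejer_primitive \<longlongrightarrow> pi / 2) at_top"
proof -
  have "((\<lambda>v::real. (1 - cos v) / v) \<longlongrightarrow> 0) at_top"
  proof (rule Lim_null_comparison)
    show "\<forall>\<^sub>F v in at_top. norm ((1 - cos v) / v) \<le> 2 / v" for v :: real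
    proof (rule eventually_at_top_linorderI[of 1])
      fix v :: real assume "v \<ge> 1"
      then show "norm ((1 - cos v) / v) \<le> 2 / v"
        using cos_ge_minus_one[of v] by (simp add: divide_right_mono)
    qed
    show "((\<lambda>v::real. 2 / v) \<longlongrightarrow> 0) at_top"
      by (intro tendsto_divide_0[OF tendsto_const] filterlim_at_top_imp_at_infinity filterlim_ident)
  qed
  from tendsto_diff[OF Si_at_top this] show ?thesis
    by (simp add: fejer_primitive_def[abs_def])
qed

lemma fejer_has_integral:
  assumes a: "a > 0" and "u \<le> v"
  shows "((\<lambda>x. fejer a (x - z)) has_integral fejer_primitive (a * (v - z)) - fejer_primitive (a * (u - z))) {u..v}"
\<comment> \<open>The centre \<open>z\<close> is exempted: the kernel has its default value 0 there,
  whereas the primitive has derivative a / 2. Continuity of the primitive bridges the point.\<close>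
proof (rule fundamental_theorem_of_calculus_interior_strong[where S = "{z}"])
  show "continuous_on {u..v} (\<lambda>x. fejer_primitive (a * (x - z)))"
    by (rule continuous_on_compose2[OF fejer_primitive_continuous]) (auto intro!: continuous_intros)
  fix x assume "x \<in> {u<..<v} - {z}"
  then have "a * (x - z) \<noteq> 0" using a by auto
  moreover have "((\<lambda>x. a * (x - z)) has_real_derivative a) (at x)"
    by (auto intro!: derivative_eq_intros)
  ultimately have "((\<lambda>x. fejer_primitive (a * (x - z))) has_real_derivative (1 - cos (a * (x - z))) / (a * (x - z))\<^sup>2 * a) (at x)"
    by (intro DERIV_chain2[OF fejer_primitive_deriv])
  then show "((\<lambda>x. fejer_primitive (a * (x - z))) has_vector_derivative fejer a (x - z)) (at x)"
    using a by (simp add: has_real_derivative_iff_has_vector_derivative fejer_def power2_eq_square mult_ac)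
qed (use assms in auto)

lemma fejer_integrable: "a > 0 \<Longrightarrow> fejer a integrable_on {0..}"
proof -
  assume a: "a > 0"
  let ?C = "a / 2 + 2 / a"
  show ?thesis
  proof (rule measurable_bounded_by_integrable_imp_integrable[OF _ inverse_quadratic_integrable[of ?C]])
    show "fejer a \<in> borel_measurable (lebesgue_on {0..})"
      by (intro measurable_restrict_space1 measurable_completion) simp
    fix x :: real assume "x \<in> {0..}"
    have "fejer a x * (1 + x\<^sup>2) \<le> ?C"
    proof (cases "x = 0")
      case False
      have "fejer a x * x\<^sup>2 \<le> (2 / (a * \<bar>x\<bar>\<^sup>2)) * x\<^sup>2"
        using False a by (intro mult_right_mono fejer_le_inverse_square) auto
      also have "\<dots> = 2 / a" using False a by simp
      finally show ?thesis using fejer_le[OF a, of x] by (simp add: algebra_simps)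
    qed (use a in \<open>simp add: fejer_def\<close>)
    then show "norm (fejer a x) \<le> ?C / (1 + x\<^sup>2)"
      using fejer_nonneg[OF a, of x] by (simp add: le_divide_eq)
  qed auto
qed

lemma integral_fejer:
  assumes a: "a > 0"
  shows "integral {0..} (fejer a) = pi / 2"
proof (rule tendsto_unique[OF _ integral_upto_tendsto[OF fejer_integrable[OF a]]])
  have "integral {0..R} (fejer a) = fejer_primitive (a * R)" if "R \<ge> 0" for R
    using integral_unique[OF fejer_has_integral[OF a that, of 0]] by simp
  then have "\<forall>\<^sub>F R in at_top. fejer_primitive (a * R) = integral {0..R} (fejer a)"
    by (intro eventually_at_top_linorderI[of 0]) simp
  moreover have "filterlim (\<lambda>R. a * R) at_top at_top"
    by (rule filterlim_tendsto_pos_mult_at_top[OF tendsto_const a filterlim_ident])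
  from filterlim_compose[OF fejer_primitive_tendsto this]
  have "((\<lambda>R. fejer_primitive (a * R)) \<longlongrightarrow> pi / 2) at_top" .
  ultimately show "((\<lambda>R. integral {0..R} (fejer a)) \<longlongrightarrow> pi / 2) at_top"
    by (rule Lim_transform_eventually[rotated])
qed simp

subsection \<open>Lebesgue points\<close>

text \<open>The oscillation is compared with the half-length h of the interval, the form in which
  the dyadic summation for the Fejer kernel consumes it.\<close>

definition lebesgue_point :: "(real \<Rightarrow> 'a::euclidean_space) \<Rightarrow> real \<Rightarrow> bool" where
  "lebesgue_point f z \<longleftrightarrow>
     (\<forall>e>0. \<exists>d>0. \<forall>h. 0 < h \<and> h \<le> d \<longrightarrow> integral {z - h..z + h} (\<lambda>y. norm (f y - f z)) \<le> e * h)"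

lemma absolutely_integrable_norm_diff:
  fixes f :: "real \<Rightarrow> 'a::euclidean_space"
  assumes f: "f absolutely_integrable_on {0..}" and "0 \<le> u"
  shows "(\<lambda>y. norm (f y - q)) absolutely_integrable_on {u..v}"
proof -
  have "f absolutely_integrable_on {u..v}"
    by (rule set_integrable_subset[OF f]) (use \<open>0 \<le> u\<close> in auto)
  moreover have "(\<lambda>y. q) absolutely_integrable_on {u..v}"
    by (rule absolutely_integrable_continuous_real) simp
  ultimately have "(\<lambda>y. f y - q) absolutely_integrable_on {u..v}"
    by (rule set_integral_diff(1))
  from absolutely_integrable_norm[OF this] show ?thesis
    by (simp add: o_def)
qed

lemma isCont_imp_lebesgue_point:
  assumes f: "f absolutely_integrable_on {0..}" and "z > 0" and "isCont f z"
  shows "lebesgue_point f z"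
  unfolding lebesgue_point_def
proof (intro allI impI)
  fix e :: real assume "e > 0"
  with \<open>isCont f z\<close> obtain d where d: "d > 0" "\<And>y. dist y z < d \<Longrightarrow> dist (f y) (f z) < e / 2"
    unfolding continuous_at_eps_delta by (meson half_gt_zero)
  define d' where "d' = min (d / 2) (z / 2)"
  show "\<exists>d>0. \<forall>h. 0 < h \<and> h \<le> d \<longrightarrow> integral {z - h..z + h} (\<lambda>y. norm (f y - f z)) \<le> e * h"
  proof (intro exI[of _ d'] conjI allI impI)
    show "d' > 0" using d \<open>z > 0\<close> by (simp add: d'_def)
    fix h assume h: "0 < h \<and> h \<le> d'"
    have "integral {z - h..z + h} (\<lambda>y. norm (f y - f z)) \<le> integral {z - h..z + h} (\<lambda>y. e / 2)"
    proof (rule integral_le)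
      show "(\<lambda>y. norm (f y - f z)) integrable_on {z - h..z + h}"
        using absolutely_integrable_norm_diff[OF f] h \<open>z > 0\<close>
        by (intro set_lebesgue_integral_eq_integral(1)) (auto simp: d'_def)
      fix y assume "y \<in> {z - h..z + h}"
      then have "dist y z < d" using h d(1) by (auto simp: d'_def dist_real_def)
      from d(2)[OF this] show "norm (f y - f z) \<le> e / 2" by (simp add: dist_norm)
    qed auto
    also have "\<dots> = e * h" using h by simp
    finally show "integral {z - h..z + h} (\<lambda>y. norm (f y - f z)) \<le> e * h" .
  qed
qed

text \<open>A one-sided upper estimate is enough: the functions to be averaged are nonnegative and
  only smallness of their means matters, and averages from the left are reduced to this case by
  reflection.\<close>

lemma indefinite_integral_right_derivative:
  fixes g :: "real \<Rightarrow> real"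
  assumes "\<And>a b. g integrable_on cbox a b"
  obtains N where "negligible N" "\<And>x e. x \<notin> N \<Longrightarrow> 0 < e \<Longrightarrow>
    \<exists>d>0. \<forall>h. 0 < h \<and> h < d \<longrightarrow> integral {x..x + h} g \<le> h * (g x + e)"
proof -
  obtain N where N: "negligible N" "\<And>x e. \<lbrakk>x \<notin> N; 0 < e\<rbrakk> \<Longrightarrow>
      \<exists>d>0. \<forall>h. 0 < h \<and> h < d \<longrightarrow> norm (integral (cbox x (x + h *\<^sub>R One)) g /\<^sub>R h ^ DIM(real) - g x) < e"
    using integrable_ccontinuous_explicit[OF assms] by metis
  show ?thesis
  proof (rule that[OF N(1)])
    fix x e :: real assume "x \<notin> N" "0 < e"
    from N(2)[OF this] obtain d where d: "d > 0" "\<And>h. 0 < h \<and> h < d \<Longrightarrow>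
        norm (integral (cbox x (x + h *\<^sub>R One)) g /\<^sub>R h ^ DIM(real) - g x) < e"
      by blast
    show "\<exists>d>0. \<forall>h. 0 < h \<and> h < d \<longrightarrow> integral {x..x + h} g \<le> h * (g x + e)"
    proof (intro exI[of _ d] conjI d(1) allI impI)
      fix h assume h: "0 < h \<and> h < d"
      have "norm (integral {x..x + h} g / h - g x) < e"
        using d(2)[OF h] by (simp add: divide_inverse mult.commute)
      then have "integral {x..x + h} g / h \<le> g x + e"
        by simp
      then show "integral {x..x + h} g \<le> h * (g x + e)"
        using h by (simp add: divide_le_eq mult.commute)
    qed
  qed
qed

text \<open>Differentiating the indefinite integrals of \<open>norm (f - q)\<close> for a countable dense set of
  vectors \<open>q\<close> yields all points at which \<open>f\<close> can be approximated in mean.\<close>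

lemma AE_lebesgue_point:
  fixes f :: "real \<Rightarrow> 'a::euclidean_space"
  assumes f: "f absolutely_integrable_on {0..}"
  shows "AE z in lebesgue. 0 < z \<longrightarrow> lebesgue_point f z"
proof -
  obtain D :: "'a set" where D: "countable D" "\<And>X. open X \<Longrightarrow> X \<noteq> {} \<Longrightarrow> \<exists>d\<in>D. d \<in> X"
    using countable_dense_setE by blast
  define g where "g = (\<lambda>q y. if y \<in> {0..} then norm (f y - q) else 0)"
  have g_int: "g q integrable_on cbox u v" for q u v
  proof -
    have "(\<lambda>y. norm (f y - q)) integrable_on {max 0 u..v}"
      by (intro set_lebesgue_integral_eq_integral(1) absolutely_integrable_norm_diff[OF f]) simp
    moreover have "{0..} \<inter> {u..v} = {max 0 u..v}" by auto
    ultimately have "(\<lambda>y. norm (f y - q)) integrable_on {0..} \<inter> {u..v}"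
      by simp
    then show ?thesis
      unfolding g_def cbox_interval by (simp only: integrable_restrict_Int)
  qed
  have "\<exists>N. negligible N \<and> (\<forall>x e. x \<notin> N \<longrightarrow> 0 < e \<longrightarrow>
      (\<exists>d>0. \<forall>h. 0 < h \<and> h < d \<longrightarrow> integral {x..x + h} (g q) \<le> h * (g q x + e)))" for q
    by (rule indefinite_integral_right_derivative[OF g_int[of q]]) blast
  then obtain N1 where N1: "\<And>q. negligible (N1 q)" "\<And>q x e. x \<notin> N1 q \<Longrightarrow> 0 < e \<Longrightarrow>
      (\<exists>d>0. \<forall>h. 0 < h \<and> h < d \<longrightarrow> integral {x..x + h} (g q) \<le> h * (g q x + e))"
    by metis
  \<comment> \<open>Reflecting y \<mapsto> -y turns averages to the left of z into averages to the
    right of -z; the exceptional set is reflected back when \<open>N\<close> is formed.\<close>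
  have g_int': "(\<lambda>y. g q (- y)) integrable_on cbox u v" for q u v
  proof -
    have "g q integrable_on {- v..- u}"
      using g_int[of q "- v" "- u"] by (simp only: cbox_interval)
    then have "(\<lambda>y. g q (- y)) integrable_on {- (- u)..- (- v)}"
      by (rule Henstock_Kurzweil_Integration.integrable_reflect_real[THEN iffD2])
    then show ?thesis by (simp only: minus_minus cbox_interval)
  qed
  have "\<exists>N. negligible N \<and> (\<forall>x e. x \<notin> N \<longrightarrow> 0 < e \<longrightarrow>
      (\<exists>d>0. \<forall>h. 0 < h \<and> h < d \<longrightarrow> integral {x..x + h} (\<lambda>y. g q (- y)) \<le> h * (g q (- x) + e)))" for q
    by (rule indefinite_integral_right_derivative[OF g_int'[of q]]) blast
  then obtain N2 where N2: "\<And>q. negligible (N2 q)" "\<And>q x e. x \<notin> N2 q \<Longrightarrow> 0 < e \<Longrightarrow>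
      (\<exists>d>0. \<forall>h. 0 < h \<and> h < d \<longrightarrow> integral {x..x + h} (\<lambda>y. g q (- y)) \<le> h * (g q (- x) + e))"
    by metis
  define N where "N = (\<Union>q\<in>D. N1 q \<union> uminus ` N2 q)"
  have "negligible (uminus ` N2 q)" for q
    by (intro negligible_differentiable_image_negligible[OF _ N2(1)] order_refl differentiable_on_minus differentiable_on_ident)
  then have "negligible N"
    unfolding N_def by (intro negligible_countable_Union) (use D(1) N1(1) in auto)
  moreover have "lebesgue_point f z" if z: "z \<notin> N" "z > 0" for z
    unfolding lebesgue_point_def
  proof (intro allI impI)
    fix e :: real assume e: "e > 0"
    \<comment> \<open>Six errors of e / 6 arise: on each of the two sides, the value
      \<open>g q z\<close>, the error of differentiation, and the replacement of \<open>f z\<close>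
      by \<open>q\<close>.\<close>
    obtain q where q: "q \<in> D" "q \<in> ball (f z) (e / 6)"
      using D(2)[of "ball (f z) (e / 6)"] e by auto
    then have gz: "g q z < e / 6"
      using z by (simp add: g_def dist_norm)
    have "z \<notin> N1 q" "- z \<notin> N2 q"
      using z(1) q(1) unfolding N_def by (auto, metis image_eqI minus_minus)
    with N1(2)[of z q "e / 6"] N2(2)[of "- z" q "e / 6"] e obtain d1 d2 where
      d1: "d1 > 0" "\<And>h. 0 < h \<Longrightarrow> h < d1 \<Longrightarrow> integral {z..z + h} (g q) \<le> h * (g q z + e / 6)" and
      d2: "d2 > 0" "\<And>h. 0 < h \<Longrightarrow> h < d2 \<Longrightarrow> integral {- z..- z + h} (\<lambda>y. g q (- y)) \<le> h * (g q (- (- z)) + e / 6)"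
      by auto
    define d where "d = min (min (d1 / 2) (d2 / 2)) z"
    show "\<exists>d>0. \<forall>h. 0 < h \<and> h \<le> d \<longrightarrow> integral {z - h..z + h} (\<lambda>y. norm (f y - f z)) \<le> e * h"
    proof (intro exI[of _ d] conjI allI impI)
      show "d > 0" using d1(1) d2(1) z by (simp add: d_def)
      fix h assume "0 < h \<and> h \<le> d"
      then have h: "0 < h" "h < d1" "h < d2" "h \<le> z"
        using d1(1) d2(1) by (auto simp: d_def)
      have gq: "g q integrable_on {u..v}" for u v
        using g_int[of q u v] by simp
      have "integral {z - h..z + h} (\<lambda>y. norm (f y - f z)) \<le> integral {z - h..z + h} (\<lambda>y. g q y + e / 6)"
      proof (rule integral_le)
        show "(\<lambda>y. norm (f y - f z)) integrable_on {z - h..z + h}"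
          using h by (intro set_lebesgue_integral_eq_integral(1) absolutely_integrable_norm_diff[OF f]) simp
        show "(\<lambda>y. g q y + e / 6) integrable_on {z - h..z + h}"
          by (intro integrable_add gq integrable_const_ivl)
        fix y assume "y \<in> {z - h..z + h}"
        then have "g q y = norm (f y - q)"
          using h by (simp add: g_def)
        moreover have "norm (f y - f z) \<le> norm (f y - q) + norm (q - f z)"
          using norm_triangle_ineq[of "f y - q" "q - f z"] by simp
        moreover have "norm (q - f z) \<le> e / 6"
          using q(2) by (simp add: dist_norm norm_minus_commute)
        ultimately show "norm (f y - f z) \<le> g q y + e / 6" by linarith
      qed
      also have "\<dots> = integral {z - h..z + h} (g q) + 2 * h * (e / 6)"
        using h by (subst integral_add[OF gq integrable_const_ivl]) simp
      also have "integral {z - h..z + h} (g q) = integral {z - h..z} (g q) + integral {z..z + h} (g q)"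
        using h by (intro Henstock_Kurzweil_Integration.integral_combine[symmetric] gq) auto
      also have "integral {z - h..z} (g q) = integral {- z..- z + h} (\<lambda>y. g q (- y))"
        using Henstock_Kurzweil_Integration.integral_reflect_real[where f = "g q" and b = z and a = "z - h"] by simp
      finally have "integral {z - h..z + h} (\<lambda>y. norm (f y - f z)) \<le>
          h * (g q z + e / 6) + h * (g q z + e / 6) + 2 * h * (e / 6)"
        using d1(2)[OF h(1,2)] d2(2)[OF h(1,3)] by simp
      also have "\<dots> \<le> h * (e / 6 + e / 6) + h * (e / 6 + e / 6) + 2 * h * (e / 6)"
        using h gz by (intro add_mono mult_left_mono) auto
      also have "\<dots> = e * h" by (simp add: field_simps)
      finally show "integral {z - h..z + h} (\<lambda>y. norm (f y - f z)) \<le> e * h" .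
    qed
  qed
  ultimately show ?thesis
    by (intro AE_I'[of N]) (auto simp: negligible_iff_null_sets)
qed

subsection \<open>Fejer's theorem for the cosine transform\<close>

text \<open>Dyadic summation. On the innermost interval, of radius 1 / a, the kernel is at most a /
  2 and contributes at most e / 2. On the ring between r = 2^n / a and 2 r it is at most 2 / (a
  r^2), while \<phi> has mass at most 2 r e there, so the ring contributes 4 e / 2^n. The term 9 - 8
  / 2^n majorises the geometric sum and is exactly reproduced by adding 4 / 2^n.\<close>

lemma fejer_mean_core:
  fixes \<phi> :: "real \<Rightarrow> real"
  assumes a: "a > 0" and e: "e \<ge> 0" and d: "d > 0"
    and \<phi>: "\<And>y. \<phi> y \<ge> 0"
    and \<phi>_int: "\<And>h. 0 < h \<Longrightarrow> h \<le> d \<Longrightarrow> \<phi> integrable_on {z - h..z + h}"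
    and k\<phi>_int: "\<And>h. 0 < h \<Longrightarrow> h \<le> d \<Longrightarrow> (\<lambda>y. fejer a (y - z) * \<phi> y) integrable_on {z - h..z + h}"
    and le: "\<And>h. 0 < h \<Longrightarrow> h \<le> d \<Longrightarrow> integral {z - h..z + h} \<phi> \<le> e * h"
  shows "2 ^ n / a \<le> d \<Longrightarrow>
    integral {z - 2 ^ n / a..z + 2 ^ n / a} (\<lambda>y. fejer a (y - z) * \<phi> y) \<le> e * (9 - 8 / 2 ^ n)"
proof (induction n)
  case 0
  let ?J = "{z - 1 / a..z + 1 / a}"
  have r: "0 < 1 / a" "1 / a \<le> d" using a 0 by auto
  have "integral ?J (\<lambda>y. fejer a (y - z) * \<phi> y) \<le> integral ?J (\<lambda>y. (a / 2) * \<phi> y)"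
    by (intro integral_le k\<phi>_int[OF r] integrable_on_mult_right \<phi>_int[OF r] mult_right_mono fejer_le a \<phi>)
  also have "\<dots> = (a / 2) * integral ?J \<phi>" by simp
  also have "\<dots> \<le> (a / 2) * (e * (1 / a))"
    using a by (intro mult_left_mono le[OF r]) simp
  also have "\<dots> = e / 2" using a by simp
  also have "\<dots> \<le> e" using e by simp
  finally show ?case by simp
next
  case (Suc n)
  define r where "r = 2 ^ n / a"
  have r: "r > 0" using a by (simp add: r_def)
  have r2: "2 ^ Suc n / a = 2 * r" by (simp add: r_def)
  have rd: "2 * r \<le> d" using Suc.prems unfolding r2 .
  have r': "0 < r" "r \<le> d" "0 < 2 * r" using r rd by auto
  let ?k = "\<lambda>y. fejer a (y - z) * \<phi> y"
  define c where "c = 2 / (a * r\<^sup>2)"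
  have c: "c \<ge> 0" using a by (simp add: c_def)
  let ?J = "{z - 2 * r..z + 2 * r}"
  have restr: "(\<lambda>y. if y \<in> {z - r..z + r} then ?k y else 0) integrable_on ?J"
    "integral ?J (\<lambda>y. if y \<in> {z - r..z + r} then ?k y else 0) = integral {z - r..z + r} ?k"
  proof -
    have *: "{z - r..z + r} \<inter> ?J = {z - r..z + r}" using r by auto
    show "(\<lambda>y. if y \<in> {z - r..z + r} then ?k y else 0) integrable_on ?J"
      unfolding integrable_restrict_Int * by (rule k\<phi>_int[OF r'(1,2)])
    show "integral ?J (\<lambda>y. if y \<in> {z - r..z + r} then ?k y else 0) = integral {z - r..z + r} ?k"
      unfolding integral_restrict_Int * ..
  qed
  \<comment> \<open>Outside the old interval the kernel is bounded by \<open>c\<close>. The term c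
    \<phi> is added inside as well, which only enlarges the bound because \<phi> is nonnegative, and
    permits the hypothesis \<open>le\<close> on the full interval.\<close>
  have "integral ?J ?k \<le> integral ?J (\<lambda>y. (if y \<in> {z - r..z + r} then ?k y else 0) + c * \<phi> y)"
  proof (rule integral_le)
    show "?k integrable_on ?J" by (rule k\<phi>_int[OF r'(3) rd])
    show "(\<lambda>y. (if y \<in> {z - r..z + r} then ?k y else 0) + c * \<phi> y) integrable_on ?J"
      by (intro integrable_add restr(1) integrable_on_mult_right \<phi>_int[OF r'(3) rd])
    fix y assume "y \<in> ?J"
    show "?k y \<le> (if y \<in> {z - r..z + r} then ?k y else 0) + c * \<phi> y"
    proof (cases "y \<in> {z - r..z + r}")
      case False
      then have "r \<le> \<bar>y - z\<bar>" by auto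
      from mult_right_mono[OF fejer_le_inverse_square[OF a r this] \<phi>[of y]] have "?k y \<le> c * \<phi> y"
        unfolding c_def .
      with False show ?thesis by (simp only: if_False add_0_left)
    qed (use c \<phi>[of y] in simp)
  qed
  also have "\<dots> = integral {z - r..z + r} ?k + c * integral ?J \<phi>"
    by (subst integral_add[OF restr(1) integrable_on_mult_right[OF \<phi>_int[OF r'(3) rd]]]) (simp only: restr(2) integral_mult_right)
  also have "\<dots> \<le> e * (9 - 8 / 2 ^ n) + c * (e * (2 * r))"
    using Suc.IH r'(2) by (intro add_mono mult_left_mono le r' rd c) (simp add: r_def)
  also have "c * (e * (2 * r)) = e * (4 / 2 ^ n)"
    using r a by (simp add: c_def power2_eq_square) (simp add: r_def field_simps)
  also have "e * (9 - 8 / 2 ^ n) + e * (4 / 2 ^ n) = e * (9 - 8 / 2 ^ Suc n)"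
    by (simp add: algebra_simps)
  finally show ?case unfolding r2 .
qed

lemma bounded_mult_absolutely_integrable:
  fixes f :: "real \<Rightarrow> 'a::euclidean_space" and \<phi> :: "real \<Rightarrow> real"
  assumes f: "f absolutely_integrable_on S" and S: "S \<in> sets lebesgue"
    and \<phi>: "\<phi> \<in> borel_measurable borel" "\<And>y. \<bar>\<phi> y\<bar> \<le> M"
  shows "(\<lambda>y. \<phi> y *\<^sub>R f y) absolutely_integrable_on S"
proof (rule absolutely_integrable_bounded_measurable_product[where h = "(*\<^sub>R)" and f = \<phi>, OF _ _ S _ f])
  show "bilinear ((*\<^sub>R) :: real \<Rightarrow> 'a \<Rightarrow> 'a)"
    by (simp add: bilinear_conv_bounded_bilinear bounded_bilinear_scaleR)
  show "\<phi> \<in> borel_measurable (lebesgue_on S)"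
    using \<phi>(1) by (intro measurable_restrict_space1 measurable_completion) simp
  show "bounded (\<phi> ` S)"
    using \<phi>(2) unfolding bounded_iff by (intro exI[of _ M]) auto
qed

lemma fejer_mult_absolutely_integrable:
  fixes f :: "real \<Rightarrow> 'a::euclidean_space"
  assumes a: "a > 0" and f: "f absolutely_integrable_on S" and S: "S \<in> sets lebesgue"
  shows "(\<lambda>y. fejer a (y - z) *\<^sub>R f y) absolutely_integrable_on S"
  using fejer_le[OF a] fejer_nonneg[OF a]
  by (intro bounded_mult_absolutely_integrable[OF f S, where M = "a / 2"]) auto

text \<open>Fits a dyadic radius 2^n / a between d / 2 and the fixed radius d, so that the
  complement of the dyadic interval stays away from the centre as a grows.\<close>

lemma dyadic_scale:
  fixes a d :: real
  assumes "a > 0" "a * d \<ge> 1"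
  obtains n :: nat where "2 ^ n / a \<le> d" "d < 2 * (2 ^ n / a)"
proof -
  have "\<exists>n. 2 ^ n \<le> a * d \<and> a * d < 2 ^ Suc n"
  proof -
    obtain m where m: "a * d < 2 ^ m"
      using real_arch_pow[of 2 "a * d"] by auto
    define k where "k = (LEAST m. a * d < 2 ^ m)"
    have k: "a * d < 2 ^ k"
      unfolding k_def by (rule LeastI[of _ m]) (rule m)
    then have "k \<noteq> 0" using assms by (metis not_less power_0)
    then obtain n where n: "k = Suc n" using not0_implies_Suc by blast
    have "\<not> a * d < 2 ^ n"
      using not_less_Least[of n "\<lambda>m. a * d < 2 ^ m"] n k_def by simp
    with k n show ?thesis by (intro exI[of _ n]) auto
  qed
  then obtain n where "2 ^ n \<le> a * d" "a * d < 2 ^ Suc n" by blast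
  then show ?thesis
    using assms by (intro that[of n]) (simp_all add: divide_le_eq less_divide_eq mult.commute)
qed

text \<open>Three errors are separated at the dyadic radius. The oscillation of \<open>f\<close>
  inside is handled by \<open>fejer_mean_core\<close>; outside, the kernel is at most 8 / (a d^2)
  and integrability of \<open>f\<close> suffices; and the mass of the kernel inside tends to pi. The
  limit is pi rather than pi / 2 because the centre z > 0 lies inside the half-line.\<close>

lemma fejer_mean_tendsto:
  fixes f :: "real \<Rightarrow> 'a::euclidean_space"
  assumes f: "f absolutely_integrable_on {0..}" and z: "z > 0" and lp: "lebesgue_point f z"
  shows "((\<lambda>a. integral {0..} (\<lambda>y. fejer a (y - z) *\<^sub>R f y)) \<longlongrightarrow> pi *\<^sub>R f z) at_top"
proof (rule tendstoI)
  fix e0 :: real assume e0: "e0 > 0"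
  \<comment> \<open>The dyadic summation returns at most 9 e = e0 / 2; the other two errors get e0 /
    4 each.\<close>
  define e where "e = e0 / 18"
  have e: "e > 0" using e0 by (simp add: e_def)
  obtain d0 where d0: "d0 > 0" "\<And>h. 0 < h \<Longrightarrow> h \<le> d0 \<Longrightarrow> integral {z - h..z + h} (\<lambda>y. norm (f y - f z)) \<le> e * h"
    using lp e unfolding lebesgue_point_def by blast
  define d where "d = min d0 z"
  have d: "d > 0" "d \<le> d0" "d \<le> z" using d0 z by (auto simp: d_def)
  define K where "K = integral {0..} (\<lambda>y. norm (f y))"
  have nf: "(\<lambda>y. norm (f y)) integrable_on {0..}"
    using f by (simp add: absolutely_integrable_on_def)
  have bound: "norm (integral {0..} (\<lambda>y. fejer a (y - z) *\<^sub>R f y) - pi *\<^sub>R f z) \<le>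
      9 * e + (8 / (a * d\<^sup>2)) * K + \<bar>2 * fejer_primitive (2 ^ n) - pi\<bar> * norm (f z)"
    if a: "a > 0" and n: "2 ^ n / a \<le> d" "d < 2 * (2 ^ n / a)" for a n
  proof -
    define r where "r = 2 ^ n / a"
    have r: "0 < r" "r \<le> d" "d / 2 < r" using a n by (simp_all add: r_def mult.commute)
    let ?J = "{z - r..z + r}"
    have J: "?J \<subseteq> {0..}" using r d by auto
    have J_int: "{0..} \<inter> ?J = ?J" using J by auto
    define k where "k = (\<lambda>y. fejer a (y - z))"
    have kf: "(\<lambda>y. k y *\<^sub>R f y) absolutely_integrable_on {0..}"
      unfolding k_def by (rule fejer_mult_absolutely_integrable[OF a f]) auto
    then have kfJ: "(\<lambda>y. k y *\<^sub>R f y) integrable_on ?J"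
      by (intro set_lebesgue_integral_eq_integral(1) set_integrable_subset[OF kf] J) auto
    have k_int: "(k has_integral 2 * fejer_primitive (2 ^ n)) ?J"
    proof -
      have "fejer_primitive (a * (z + r - z)) - fejer_primitive (a * (z - r - z)) = 2 * fejer_primitive (2 ^ n)"
        using a fejer_primitive_odd[of "2 ^ n"] by (simp add: r_def)
      with fejer_has_integral[OF a, of "z - r" "z + r" z] r show ?thesis
        by (simp add: k_def)
    qed
    then have kz: "((\<lambda>y. k y *\<^sub>R f z) has_integral (2 * fejer_primitive (2 ^ n)) *\<^sub>R f z) ?J"
      by (rule has_integral_scaleR_left)
    let ?out = "\<lambda>y. if y \<in> ?J then 0 else k y *\<^sub>R f y"
    let ?in = "\<lambda>y. if y \<in> ?J then k y *\<^sub>R f y else 0"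
    have in_int: "?in integrable_on {0..}" "integral {0..} ?in = integral ?J (\<lambda>y. k y *\<^sub>R f y)"
      using kfJ by (simp_all only: integrable_restrict_Int integral_restrict_Int Int_commute[of ?J] J_int)
    have out_eq: "?out = (\<lambda>y. k y *\<^sub>R f y - ?in y)" by auto
    have kf_int: "(\<lambda>y. k y *\<^sub>R f y) integrable_on {0..}"
      using kf by (rule set_lebesgue_integral_eq_integral(1))
    have out_int: "?out integrable_on {0..}"
      unfolding out_eq by (rule integrable_diff[OF kf_int in_int(1)])
    have "integral {0..} (\<lambda>y. k y *\<^sub>R f y) = integral {0..} ?in + integral {0..} ?out"
      unfolding out_eq using integral_diff[OF kf_int in_int(1)] by simp
    also have "integral {0..} ?in = integral ?J (\<lambda>y. k y *\<^sub>R (f y - f z)) + (2 * fejer_primitive (2 ^ n)) *\<^sub>R f z"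
      unfolding in_int(2) scaleR_diff_right
      using integral_diff[OF kfJ has_integral_integrable[OF kz]] integral_unique[OF kz] by simp
    finally have eq: "integral {0..} (\<lambda>y. k y *\<^sub>R f y) - pi *\<^sub>R f z =
        integral ?J (\<lambda>y. k y *\<^sub>R (f y - f z)) + integral {0..} ?out + (2 * fejer_primitive (2 ^ n) - pi) *\<^sub>R f z"
      by (simp add: algebra_simps)
    have n_int: "(\<lambda>y. norm (f y - f z)) absolutely_integrable_on {z - h..z + h}" if "h \<le> d" for h
      using absolutely_integrable_norm_diff[OF f, where u = "z - h" and q = "f z" and v = "z + h"] that d by simp
    have nk_int: "(\<lambda>y. fejer a (y - z) * norm (f y - f z)) integrable_on {z - h..z + h}" if "h \<le> d" for h
      using fejer_mult_absolutely_integrable[OF a n_int[OF that]] by (intro set_lebesgue_integral_eq_integral(1)) simp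
    have "norm (integral ?J (\<lambda>y. k y *\<^sub>R (f y - f z))) \<le> integral ?J (\<lambda>y. fejer a (y - z) * norm (f y - f z))"
    proof (rule integral_norm_bound_integral)
      show "(\<lambda>y. k y *\<^sub>R (f y - f z)) integrable_on ?J"
        unfolding scaleR_diff_right by (rule integrable_diff[OF kfJ has_integral_integrable[OF kz]])
      show "norm (k y *\<^sub>R (f y - f z)) \<le> fejer a (y - z) * norm (f y - f z)" for y
        using fejer_nonneg[OF a, of "y - z"] by (simp add: k_def)
    qed (rule nk_int[OF r(2)])
    also have "\<dots> \<le> e * (9 - 8 / 2 ^ n)"
      unfolding r_def
    proof (rule fejer_mean_core[OF a _ d(1)])
      show "(\<lambda>y. norm (f y - f z)) integrable_on {z - h..z + h}" if "h \<le> d" for h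
        using n_int[OF that] by (rule set_lebesgue_integral_eq_integral(1))
    qed (use e d d0 n nk_int in auto)
    also have "\<dots> \<le> 9 * e" using e by simp
    finally have 1: "norm (integral ?J (\<lambda>y. k y *\<^sub>R (f y - f z))) \<le> 9 * e" .
    have "norm (integral {0..} ?out) \<le> integral {0..} (\<lambda>y. (8 / (a * d\<^sup>2)) * norm (f y))"
    proof (rule integral_norm_bound_integral[OF out_int integrable_on_mult_right[OF nf]])
      fix y :: real
      show "norm (?out y) \<le> (8 / (a * d\<^sup>2)) * norm (f y)"
      proof (cases "y \<in> ?J")
        case False
        then have "d / 2 \<le> \<bar>y - z\<bar>" using r by auto
        from fejer_le_inverse_square[OF a _ this] d have "k y \<le> 8 / (a * d\<^sup>2)"
          by (simp add: k_def power_divide)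
        from mult_right_mono[OF this, of "norm (f y)"] fejer_nonneg[OF a, of "y - z"]
        have "norm (k y *\<^sub>R f y) \<le> (8 / (a * d\<^sup>2)) * norm (f y)"
          by (simp add: k_def)
        with False show ?thesis by (simp only: if_False)
      qed (use a in simp)
    qed
    then have 2: "norm (integral {0..} ?out) \<le> (8 / (a * d\<^sup>2)) * K"
      unfolding integral_mult_right K_def .
    have 3: "norm ((2 * fejer_primitive (2 ^ n) - pi) *\<^sub>R f z) \<le> \<bar>2 * fejer_primitive (2 ^ n) - pi\<bar> * norm (f z)"
      by simp
    have "norm (integral {0..} (\<lambda>y. k y *\<^sub>R f y) - pi *\<^sub>R f z) \<le>
        9 * e + (8 / (a * d\<^sup>2)) * K + \<bar>2 * fejer_primitive (2 ^ n) - pi\<bar> * norm (f z)"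
      unfolding eq by (intro norm_triangle_le add_mono 1 2 3)
    then show ?thesis by (simp add: k_def)
  qed
  have "((\<lambda>v. \<bar>2 * fejer_primitive v - pi\<bar> * norm (f z)) \<longlongrightarrow> \<bar>2 * (pi / 2) - pi\<bar> * norm (f z)) at_top"
    by (intro tendsto_intros fejer_primitive_tendsto)
  then have "\<forall>\<^sub>F v in at_top. \<bar>2 * fejer_primitive v - pi\<bar> * norm (f z) < e0 / 4"
    using e0 by (intro order_tendstoD(2)) auto
  then obtain V where V: "\<And>v. v \<ge> V \<Longrightarrow> \<bar>2 * fejer_primitive v - pi\<bar> * norm (f z) < e0 / 4"
    unfolding eventually_at_top_linorder by blast
  have "((\<lambda>a. (8 / (a * d\<^sup>2)) * K) \<longlongrightarrow> 0 * K) at_top"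
    using d by (intro tendsto_intros tendsto_divide_0[OF tendsto_const] filterlim_at_top_imp_at_infinity
        filterlim_at_top_mult_tendsto_pos[OF tendsto_const _ filterlim_ident]) auto
  then have "\<forall>\<^sub>F a in at_top. (8 / (a * d\<^sup>2)) * K < e0 / 4"
    using e0 by (intro order_tendstoD(2)) auto
  then show "\<forall>\<^sub>F a in at_top. dist (integral {0..} (\<lambda>y. fejer a (y - z) *\<^sub>R f y)) (pi *\<^sub>R f z) < e0"
    using eventually_ge_at_top[of "max (1 / d) (2 * V / d)"]
  proof eventually_elim
    case (elim a)
    have "1 / d > 0" using d by simp
    then have a: "a > 0" using elim by linarith
    have "a * d \<ge> 1" "a * d \<ge> 2 * V"
      using elim d by (auto simp: divide_le_eq)
    then obtain n where n: "2 ^ n / a \<le> d" "d < 2 * (2 ^ n / a)"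
      using dyadic_scale[OF a] by blast
    then have "2 ^ n \<ge> V"
      using a \<open>a * d \<ge> 2 * V\<close> by (simp add: less_divide_eq mult.commute)
    with bound[OF a n] V[of "2 ^ n"] elim show ?case
      by (simp add: dist_norm e_def)
  qed
qed

lemma trig_mult_integrable:
  fixes f :: "real \<Rightarrow> 'a::euclidean_space"
  assumes "f absolutely_integrable_on {0..}"
  shows "(\<lambda>y. cos (r * (y - s)) *\<^sub>R f y) integrable_on {0..}" "(\<lambda>y. cos (y * r) *\<^sub>R f y) integrable_on {0..}"
  by (intro set_lebesgue_integral_eq_integral(1) bounded_mult_absolutely_integrable[OF assms, where M = 1]; simp)+

text \<open>Integrating cos (r (y - s)) twice in r yields (1 - cos (r (y - s))) / (y - s)^2.
  Differentiating the resulting integrals in r lets the iterated frequency integrals be evaluated by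
  the fundamental theorem, without exchanging the order of integration. The bound \<open>M\<close>
  on r makes the majorant M |f| uniform.\<close>

lemma integral_one_minus_cos_deriv:
  fixes f :: "real \<Rightarrow> 'a::euclidean_space"
  assumes f: "f absolutely_integrable_on {0..}" and r: "0 \<le> r" "r \<le> M"
  shows "((\<lambda>r. integral {0..} (\<lambda>y. ((1 - cos (r * (y - s))) / (y - s)\<^sup>2) *\<^sub>R f y)) has_vector_derivative
      integral {0..} (\<lambda>y. (sin (r * (y - s)) / (y - s)) *\<^sub>R f y)) (at r within {0..M})"
    and "((\<lambda>r. integral {0..} (\<lambda>y. (sin (r * (y - s)) / (y - s)) *\<^sub>R f y)) has_vector_derivative
      integral {0..} (\<lambda>y. cos (r * (y - s)) *\<^sub>R f y)) (at r within {0..M})"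
proof -
  have nf: "(\<lambda>y. norm (f y)) integrable_on {0..}"
    using f by (simp add: absolutely_integrable_on_def)
  have sin_le: "\<bar>sin (r * x) / x\<bar> \<le> M" if "0 \<le> r" "r \<le> M" for r x :: real
  proof (cases "x = 0")
    case False
    have "\<bar>sin (r * x)\<bar> \<le> \<bar>r * x\<bar>" by (rule abs_sin_x_le_abs_x)
    then have "\<bar>sin (r * x) / x\<bar> \<le> \<bar>r\<bar>"
      using False by (simp add: abs_divide divide_le_eq abs_mult)
    then show ?thesis using that by simp
  qed (use that in simp)
  have cos_le: "\<bar>(1 - cos (r * x)) / x\<^sup>2\<bar> \<le> r\<^sup>2 / 2" for r x :: real
  proof (cases "x = 0")
    case False
    have "(1 - cos (r * x)) / x\<^sup>2 \<le> ((r * x)\<^sup>2 / 2) / x\<^sup>2"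
      by (intro divide_right_mono one_minus_cos_le) simp
    also have "\<dots> = r\<^sup>2 / 2"
      using False by (simp add: power_mult_distrib)
    finally show ?thesis by simp
  qed simp
  show "((\<lambda>r. integral {0..} (\<lambda>y. ((1 - cos (r * (y - s))) / (y - s)\<^sup>2) *\<^sub>R f y)) has_vector_derivative
      integral {0..} (\<lambda>y. (sin (r * (y - s)) / (y - s)) *\<^sub>R f y)) (at r within {0..M})"
  proof (rule has_vector_derivative_integral_dominated[OF _ _ _ integrable_on_mult_right[OF nf, of M]])
    show "(\<lambda>y. ((1 - cos (r * (y - s))) / (y - s)\<^sup>2) *\<^sub>R f y) integrable_on {0..}" for r
      by (intro set_lebesgue_integral_eq_integral(1) bounded_mult_absolutely_integrable[OF f, where M = "r\<^sup>2 / 2"] cos_le) auto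
    fix r y :: real assume "r \<in> {0..M}"
    then show "norm ((sin (r * (y - s)) / (y - s)) *\<^sub>R f y) \<le> M * norm (f y)"
      unfolding norm_scaleR real_norm_def by (intro mult_right_mono sin_le) auto
    have "((\<lambda>r. (1 - cos (r * (y - s))) / (y - s)\<^sup>2) has_real_derivative sin (r * (y - s)) / (y - s)) (at r within {0..M})"
      by (cases "y = s") (auto intro!: derivative_eq_intros simp: power2_eq_square)
    then show "((\<lambda>r. ((1 - cos (r * (y - s))) / (y - s)\<^sup>2) *\<^sub>R f y) has_vector_derivative
        (sin (r * (y - s)) / (y - s)) *\<^sub>R f y) (at r within {0..M})"
      by (rule has_vector_derivative_eq_rhs[OF has_vector_derivative_scaleR[OF _ has_vector_derivative_const]]) simp
  qed (use r in auto)
  have "((\<lambda>r. integral {0..} (\<lambda>y. (sin (r * (y - s)) / (y - s)) *\<^sub>R f y)) has_vector_derivative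
      integral {0..} (\<lambda>y. (if y = s then 0 else cos (r * (y - s))) *\<^sub>R f y)) (at r within {0..M})"
  proof (rule has_vector_derivative_integral_dominated[OF _ _ _ nf])
    show "(\<lambda>y. (sin (r * (y - s)) / (y - s)) *\<^sub>R f y) integrable_on {0..}" if "r \<in> {0..M}" for r
      using that by (intro set_lebesgue_integral_eq_integral(1) bounded_mult_absolutely_integrable[OF f, where M = M] sin_le) auto
    fix r y :: real
    show "norm ((if y = s then 0 else cos (r * (y - s))) *\<^sub>R f y) \<le> norm (f y)"
      by (simp add: mult_left_le_one_le)
    have "((\<lambda>r. sin (r * (y - s)) / (y - s)) has_real_derivative (if y = s then 0 else cos (r * (y - s)))) (at r within {0..M})"
      by (cases "y = s") (auto intro!: derivative_eq_intros)
    then show "((\<lambda>r. (sin (r * (y - s)) / (y - s)) *\<^sub>R f y) has_vector_derivative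
        (if y = s then 0 else cos (r * (y - s))) *\<^sub>R f y) (at r within {0..M})"
      by (rule has_vector_derivative_eq_rhs[OF has_vector_derivative_scaleR[OF _ has_vector_derivative_const]]) simp
  qed (use r in auto)
  \<comment> \<open>At y = s the quotient has the default value 0 for all r, so its derivative there
    is 0 instead of cos 0; a single point does not affect the integral.\<close>
  moreover have "integral {0..} (\<lambda>y. (if y = s then 0 else cos (r * (y - s))) *\<^sub>R f y) = integral {0..} (\<lambda>y. cos (r * (y - s)) *\<^sub>R f y)"
    by (rule integral_spike[OF negligible_sing[of s]]) auto
  ultimately show "((\<lambda>r. integral {0..} (\<lambda>y. (sin (r * (y - s)) / (y - s)) *\<^sub>R f y)) has_vector_derivative
      integral {0..} (\<lambda>y. cos (r * (y - s)) *\<^sub>R f y)) (at r within {0..M})"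
    by simp
qed

lemma cos_int_bounded_continuous:
  fixes f :: "real \<Rightarrow> 'a::euclidean_space"
  assumes f: "f absolutely_integrable_on {0..}"
  shows "norm (cos_int f w) \<le> integral {0..} (\<lambda>y. norm (f y))" "continuous_on S (cos_int f)"
proof -
  have nf: "(\<lambda>y. norm (f y)) integrable_on {0..}"
    using f by (simp add: absolutely_integrable_on_def)
  have le: "norm (cos c *\<^sub>R f y) \<le> norm (f y)" for c y
    by (simp add: mult_left_le_one_le)
  show "norm (cos_int f w) \<le> integral {0..} (\<lambda>y. norm (f y))"
    unfolding cos_int_def
    by (rule integral_norm_bound_integral[OF trig_mult_integrable(2)[OF f] nf le])
  show "continuous_on S (cos_int f)"
    unfolding continuous_on_def cos_int_def[abs_def]
  proof (intro ballI, rule dominated_convergence_at_within[OF trig_mult_integrable(2)[OF f] nf le])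
    show "((\<lambda>w. cos (y * w) *\<^sub>R f y) \<longlongrightarrow> cos (y * x) *\<^sub>R f y) (at x within S)" for x y
      by (intro tendsto_intros)
  qed
qed

text \<open>The Cesaro means of the inverse cosine integral, as iterated integrals of the partial
  integrals.\<close>

lemma fejer_theorem:
  fixes f :: "real \<Rightarrow> 'a::euclidean_space"
  assumes f: "f absolutely_integrable_on {0..}" and z: "z > 0" and lp: "lebesgue_point f z"
  shows "((\<lambda>R. (1 / R) *\<^sub>R integral {0..R} (\<lambda>r. integral {0..r} (\<lambda>w. cos (w * z) *\<^sub>R cos_int f w))) \<longlongrightarrow> (pi / 2) *\<^sub>R f z) at_top"
proof -
  define A where "A = (\<lambda>s r. integral {0..} (\<lambda>y. ((1 - cos (r * (y - s))) / (y - s)\<^sup>2) *\<^sub>R f y))"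
  define A' where "A' = (\<lambda>s r. integral {0..} (\<lambda>y. (sin (r * (y - s)) / (y - s)) *\<^sub>R f y))"
  have A: "(A s has_vector_derivative A' s r) (at r within {0..M})" if "0 \<le> r" "r \<le> M" for s r M
    using integral_one_minus_cos_deriv(1)[OF f that] unfolding A_def A'_def .
  have A': "(A' s has_vector_derivative integral {0..} (\<lambda>y. cos (r * (y - s)) *\<^sub>R f y)) (at r within {0..M})"
    if "0 \<le> r" "r \<le> M" for s r M
    using integral_one_minus_cos_deriv(2)[OF f that] unfolding A'_def .
  have A0: "A s 0 = 0" "A' s 0 = 0" for s
    by (simp_all add: A_def A'_def)
  \<comment> \<open>The product formula for cos (w z) cos (y w) splits the even extension of the
    problem into two Fejer kernels, centred at z and at its mirror image -z.\<close>
  have cos_sum: "(1 / 2) *\<^sub>R (integral {0..} (\<lambda>y. cos (w * (y - z)) *\<^sub>R f y) + integral {0..} (\<lambda>y. cos (w * (y - - z)) *\<^sub>R f y))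
      = cos (w * z) *\<^sub>R cos_int f w" for w
  proof -
    have "integral {0..} (\<lambda>y. cos (w * (y - z)) *\<^sub>R f y) + integral {0..} (\<lambda>y. cos (w * (y - - z)) *\<^sub>R f y)
        = integral {0..} (\<lambda>y. cos (w * (y - z)) *\<^sub>R f y + cos (w * (y - - z)) *\<^sub>R f y)"
      by (rule integral_add[symmetric]) (rule trig_mult_integrable[OF f])+
    also have "(\<lambda>y. cos (w * (y - z)) *\<^sub>R f y + cos (w * (y - - z)) *\<^sub>R f y) = (\<lambda>y. (2 * cos (w * z)) *\<^sub>R (cos (y * w) *\<^sub>R f y))"
      by (simp add: fun_eq_iff scaleR_add_left[symmetric] right_diff_distrib distrib_left cos_diff cos_add mult_ac)
    also have "integral {0..} \<dots> = (2 * cos (w * z)) *\<^sub>R cos_int f w"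
      unfolding cos_int_def by (rule integral_cmul)
    finally show ?thesis by simp
  qed
  have S1: "integral {0..r} (\<lambda>w. cos (w * z) *\<^sub>R cos_int f w) = (1 / 2) *\<^sub>R (A' z r + A' (- z) r)" if "r \<ge> 0" for r
  proof -
    have "((\<lambda>w. cos (w * z) *\<^sub>R cos_int f w) has_integral
        (1 / 2) *\<^sub>R (A' z r + A' (- z) r) - (1 / 2) *\<^sub>R (A' z 0 + A' (- z) 0)) {0..r}"
      unfolding cos_sum[symmetric]
      by (intro fundamental_theorem_of_calculus that bounded_linear.has_vector_derivative[OF bounded_linear_scaleR_right]
          has_vector_derivative_add A') auto
    from integral_unique[OF this] show ?thesis by (simp add: A0)
  qed
  have S2: "integral {0..R} (\<lambda>r. integral {0..r} (\<lambda>w. cos (w * z) *\<^sub>R cos_int f w)) = (1 / 2) *\<^sub>R (A z R + A (- z) R)" if "R \<ge> 0" for R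
  proof -
    have int: "((\<lambda>r. (1 / 2) *\<^sub>R (A' z r + A' (- z) r)) has_integral
        (1 / 2) *\<^sub>R (A z R + A (- z) R) - (1 / 2) *\<^sub>R (A z 0 + A (- z) 0)) {0..R}"
      by (intro fundamental_theorem_of_calculus that bounded_linear.has_vector_derivative[OF bounded_linear_scaleR_right]
          has_vector_derivative_add A) auto
    have eq: "integral {0..R} (\<lambda>r. integral {0..r} (\<lambda>w. cos (w * z) *\<^sub>R cos_int f w)) = integral {0..R} (\<lambda>r. (1 / 2) *\<^sub>R (A' z r + A' (- z) r))"
      by (rule integral_cong) (rule S1, simp)
    show ?thesis unfolding eq integral_unique[OF int] by (simp add: A0)
  qed
  have AF: "(1 / R) *\<^sub>R A s R = integral {0..} (\<lambda>y. fejer R (y - s) *\<^sub>R f y)" if "R > 0" for s R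
    unfolding A_def using that by (subst integral_cmul[symmetric]) (simp add: fejer_def)
  define K where "K = integral {0..} (\<lambda>y. norm (f y))"
  have nf: "(\<lambda>y. norm (f y)) integrable_on {0..}"
    using f by (simp add: absolutely_integrable_on_def)
  \<comment> \<open>The mirror centre -z has distance at least z from the half-line, so its kernel
    is uniformly small there and contributes nothing in the limit.\<close>
  have "norm (integral {0..} (\<lambda>y. fejer R (y - - z) *\<^sub>R f y)) \<le> (2 / (R * z\<^sup>2)) * K" if R: "R > 0" for R
  proof -
    have "norm (integral {0..} (\<lambda>y. fejer R (y - - z) *\<^sub>R f y)) \<le> integral {0..} (\<lambda>y. (2 / (R * z\<^sup>2)) * norm (f y))"
    proof (rule integral_norm_bound_integral[OF _ integrable_on_mult_right[OF nf]])
      show "(\<lambda>y. fejer R (y - - z) *\<^sub>R f y) integrable_on {0..}"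
        by (intro set_lebesgue_integral_eq_integral(1) fejer_mult_absolutely_integrable[OF R f]) simp
      fix y :: real assume "y \<in> {0..}"
      then have "fejer R (y - - z) \<le> 2 / (R * z\<^sup>2)"
        using z by (intro fejer_le_inverse_square R) auto
      then show "norm (fejer R (y - - z) *\<^sub>R f y) \<le> (2 / (R * z\<^sup>2)) * norm (f y)"
        unfolding norm_scaleR using fejer_nonneg[OF R, of "y - - z"] by (intro mult_right_mono) auto
    qed
    then show ?thesis unfolding integral_mult_right K_def .
  qed
  then have "\<forall>\<^sub>F R in at_top. norm (integral {0..} (\<lambda>y. fejer R (y - - z) *\<^sub>R f y)) \<le> (2 / (R * z\<^sup>2)) * K"
    using eventually_gt_at_top[of 0] by (rule eventually_mono[rotated])
  moreover have "((\<lambda>R. (2 / (R * z\<^sup>2)) * K) \<longlongrightarrow> 0) at_top"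
    by (rule tendsto_mult_left_zero)
      (use z in \<open>auto intro!: tendsto_divide_0[OF tendsto_const] filterlim_at_top_imp_at_infinity
        filterlim_at_top_mult_tendsto_pos[OF tendsto_const _ filterlim_ident]\<close>)
  ultimately have lim0: "((\<lambda>R. integral {0..} (\<lambda>y. fejer R (y - - z) *\<^sub>R f y)) \<longlongrightarrow> 0) at_top"
    by (rule Lim_null_comparison)
  have "((\<lambda>R. (1 / 2) *\<^sub>R (integral {0..} (\<lambda>y. fejer R (y - z) *\<^sub>R f y) + integral {0..} (\<lambda>y. fejer R (y - - z) *\<^sub>R f y)))
      \<longlongrightarrow> (1 / 2) *\<^sub>R (pi *\<^sub>R f z + 0)) at_top"
    by (intro tendsto_intros fejer_mean_tendsto f z lp lim0)
  then have lim: "((\<lambda>R. (1 / 2) *\<^sub>R (integral {0..} (\<lambda>y. fejer R (y - z) *\<^sub>R f y) + integral {0..} (\<lambda>y. fejer R (y - - z) *\<^sub>R f y)))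
      \<longlongrightarrow> (pi / 2) *\<^sub>R f z) at_top"
    by simp
  have "\<forall>\<^sub>F R in at_top. (1 / 2) *\<^sub>R (integral {0..} (\<lambda>y. fejer R (y - z) *\<^sub>R f y) + integral {0..} (\<lambda>y. fejer R (y - - z) *\<^sub>R f y))
      = (1 / R) *\<^sub>R integral {0..R} (\<lambda>r. integral {0..r} (\<lambda>w. cos (w * z) *\<^sub>R cos_int f w))"
    using eventually_gt_at_top[of 0]
  proof eventually_elim
    case (elim R)
    then have "(1 / R) *\<^sub>R integral {0..R} (\<lambda>r. integral {0..r} (\<lambda>w. cos (w * z) *\<^sub>R cos_int f w))
       = (1 / 2) *\<^sub>R ((1 / R) *\<^sub>R A z R + (1 / R) *\<^sub>R A (- z) R)"
      by (simp add: S2 scaleR_add_right mult.commute)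
    with AF[OF elim] show ?case by simp
  qed
  from Lim_transform_eventually[OF lim this] show ?thesis .
qed

subsection \<open>Summability of the inverse cosine integral\<close>

lemma integral_upto_deriv:
  fixes S :: "real \<Rightarrow> 'a::euclidean_space"
  assumes S: "continuous_on {0..} S" and r: "r \<ge> 0"
  shows "((\<lambda>r. integral {0..r} S) has_vector_derivative S r) (at r within {0..})"
proof (rule has_vector_derivative_within_atLeast[of _ _ _ _ "r + 1"])
  show "((\<lambda>r. integral {0..r} S) has_vector_derivative S r) (at r within {0..r + 1})"
    using r by (intro integral_has_vector_derivative continuous_on_subset[OF S]) auto
qed simp

lemma continuous_integral_upto:
  fixes S :: "real \<Rightarrow> 'a::euclidean_space"
  assumes "continuous_on {0..} S"
  shows "continuous_on {0..} (\<lambda>r. integral {0..r} S)"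
  by (rule continuous_on_vector_derivative, rule integral_upto_deriv[OF assms]) simp

lemma norm_integral_upto_le:
  fixes S :: "real \<Rightarrow> 'a::euclidean_space"
  assumes S: "continuous_on {0..} S" and r: "r \<ge> 0" and C: "C \<ge> 0" "\<And>w. 0 \<le> w \<Longrightarrow> w \<le> r \<Longrightarrow> norm (S w) \<le> C"
  shows "norm (integral {0..r} S) \<le> C * r"
proof -
  have "norm (integral (cbox 0 r) S) \<le> C * measure lborel (cbox 0 r)"
    using C r by (intro integrable_bound integrable_continuous continuous_on_subset[OF S]) auto
  then show ?thesis using r by simp
qed

text \<open>Serves the formula at t = 0: if the inverse cosine integral converges, its value must
  coincide with the Cesaro limit supplied by \<open>fejer_theorem\<close>.\<close>

lemma cesaro_mean_tendsto:
  fixes g :: "real \<Rightarrow> 'a::euclidean_space"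
  assumes g: "continuous_on {0..} g" and lim: "(g \<longlongrightarrow> L) at_top"
  shows "((\<lambda>R. (1 / R) *\<^sub>R integral {0..R} g) \<longlongrightarrow> L) at_top"
proof (rule tendstoI)
  fix e :: real assume e: "e > 0"
  then have "\<forall>\<^sub>F w in at_top. dist (g w) L < e / 2"
    using lim by (intro tendstoD) auto
  then obtain W0 where W0: "\<And>w. w \<ge> W0 \<Longrightarrow> dist (g w) L < e / 2"
    unfolding eventually_at_top_linorder by blast
  define W where "W = max W0 1"
  have W: "W \<ge> 1" "\<And>w. w \<ge> W \<Longrightarrow> norm (g w - L) \<le> e / 2"
    using W0 by (auto simp: W_def dist_norm intro: less_imp_le)
  have gL: "continuous_on {0..} (\<lambda>w. g w - L)"
    by (intro continuous_intros g)
  define M where "M = norm (integral {0..W} (\<lambda>w. g w - L))"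
  have bound: "norm ((1 / R) *\<^sub>R integral {0..R} g - L) \<le> M / R + e / 2" if R: "R \<ge> W" for R
  proof -
    have R0: "R > 0" using R W by simp
    have int: "(\<lambda>w. g w - L) integrable_on {a..b}" if "a \<ge> 0" for a b
      by (rule integrable_continuous_interval, rule continuous_on_subset[OF gL]) (use that in auto)
    have gi: "g integrable_on {0..R}"
      by (rule integrable_continuous_interval, rule continuous_on_subset[OF g]) auto
    have "integral {0..R} (\<lambda>w. g w - L) = integral {0..R} g - R *\<^sub>R L"
      using R0 by (subst integral_diff[OF gi integrable_const_ivl]) simp
    then have eq: "(1 / R) *\<^sub>R integral {0..R} g - L = (1 / R) *\<^sub>R integral {0..R} (\<lambda>w. g w - L)"
      using R0 by (simp add: scaleR_diff_right)
    have "integral {0..R} (\<lambda>w. g w - L) = integral {0..W} (\<lambda>w. g w - L) + integral {W..R} (\<lambda>w. g w - L)"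
      using W R by (intro Henstock_Kurzweil_Integration.integral_combine[symmetric] int) auto
    moreover have "norm (integral (cbox W R) (\<lambda>w. g w - L)) \<le> e / 2 * measure lborel (cbox W R)"
      using e W int[of W R] by (intro integrable_bound) auto
    ultimately have "norm (integral {0..R} (\<lambda>w. g w - L)) \<le> M + e / 2 * (R - W)"
      unfolding M_def using R by (auto intro!: norm_triangle_le)
    also have "\<dots> \<le> M + e / 2 * R"
      using e W by (intro add_left_mono mult_left_mono) auto
    finally have "norm (integral {0..R} (\<lambda>w. g w - L)) / R \<le> (M + e / 2 * R) / R"
      using R0 by (intro divide_right_mono) auto
    then show ?thesis
      unfolding eq using R0 by (simp add: add_divide_distrib)
  qed
  have "((\<lambda>R. M / R) \<longlongrightarrow> 0) at_top"
    by (intro tendsto_divide_0[OF tendsto_const] filterlim_at_top_imp_at_infinity filterlim_ident)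
  then have "\<forall>\<^sub>F R in at_top. M / R < e / 2"
    using e by (intro order_tendstoD(2)) auto
  then show "\<forall>\<^sub>F R in at_top. dist ((1 / R) *\<^sub>R integral {0..R} g) L < e"
    using eventually_ge_at_top[of W]
  proof eventually_elim
    case (elim R)
    show ?case using bound[OF elim(2)] elim(1) unfolding dist_norm by linarith
  qed
qed

text \<open>As z decreases to 0 the kernel keeps its mass pi / 2 while its height is at most z / 2.
  Its mass therefore escapes to infinity, where \<open>k\<close> is close to \<open>L\<close>; any
  bounded range of frequencies contributes an error proportional to z.\<close>

lemma fejer_concentrates:
  fixes k :: "real \<Rightarrow> 'a::euclidean_space"
  assumes k: "continuous_on {0..} k" "\<And>w. w \<ge> 0 \<Longrightarrow> norm (k w) \<le> K" and lim: "(k \<longlongrightarrow> L) at_top"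
  shows "((\<lambda>z. integral {0..} (\<lambda>w. fejer z w *\<^sub>R k w)) \<longlongrightarrow> (pi / 2) *\<^sub>R L) (at_right 0)"
proof (rule tendstoI)
  fix e :: real assume e: "e > 0"
  \<comment> \<open>Multiplied by the total mass pi / 2 of the kernel, this gives e / 2.\<close>
  define e' where "e' = e / pi"
  have e': "e' > 0" using e by (simp add: e'_def)
  then have "\<forall>\<^sub>F w in at_top. dist (k w) L < e'"
    using lim by (intro tendstoD) auto
  then obtain W0 where W0: "\<And>w. w \<ge> W0 \<Longrightarrow> dist (k w) L < e'"
    unfolding eventually_at_top_linorder by blast
  define W where "W = max W0 1"
  have W: "W \<ge> 1" "\<And>w. w \<ge> W \<Longrightarrow> norm (k w - L) \<le> e'"
    using W0 by (auto simp: W_def dist_norm intro: less_imp_le)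
  define M where "M = K + norm L"
  have M: "norm (k w - L) \<le> M" if "w \<ge> 0" for w
    unfolding M_def using norm_triangle_ineq4[of "k w" L] k(2)[OF that] by linarith
  have M0: "M \<ge> 0" using order_trans[OF norm_ge_zero M[of 0]] by simp
  have bound: "norm (integral {0..} (\<lambda>w. fejer z w *\<^sub>R k w) - (pi / 2) *\<^sub>R L) \<le> e / 2 + M * (z / 2) * W" if z: "z > 0" for z
  proof -
    have fint: "fejer z absolutely_integrable_on {0..}"
      using fejer_integrable[OF z] by (rule nonnegative_absolutely_integrable_1) (simp add: fejer_nonneg z)
    have fk: "(\<lambda>w. fejer z w *\<^sub>R k w) integrable_on {0..}"
    proof (rule measurable_bounded_by_integrable_imp_integrable[OF _ integrable_on_mult_left[OF fejer_integrable[OF z], of K]])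
      have "fejer z \<in> borel_measurable (lebesgue_on {0..})"
        by (intro measurable_restrict_space1 measurable_completion) simp
      moreover have "k \<in> borel_measurable (lebesgue_on {0..})"
        by (rule continuous_imp_measurable_on_sets_lebesgue[OF k(1)]) simp
      ultimately show "(\<lambda>w. fejer z w *\<^sub>R k w) \<in> borel_measurable (lebesgue_on {0..})"
        by (rule borel_measurable_scaleR)
      show "norm (fejer z w *\<^sub>R k w) \<le> fejer z w * K" if "w \<in> {0..}" for w
        using that k(2)[of w] fejer_nonneg[OF z, of w] by (simp add: mult_left_mono)
    qed simp
    have fL: "((\<lambda>w. fejer z w *\<^sub>R L) has_integral (pi / 2) *\<^sub>R L) {0..}"
      using has_integral_scaleR_left[OF integrable_integral[OF fejer_integrable[OF z]], of L]
      by (simp add: integral_fejer z)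
    let ?h = "\<lambda>w. e' * fejer z w + (if w \<in> {0..W} then M * (z / 2) else 0)"
    have i1: "(\<lambda>w. e' * fejer z w) integrable_on {0..}"
      by (rule integrable_on_mult_right[OF fejer_integrable[OF z]])
    have *: "{0..W} \<inter> {0..} = {0..W}" by auto
    have i2: "(\<lambda>w. if w \<in> {0..W} then M * (z / 2) else 0) integrable_on {0..}"
      unfolding integrable_restrict_Int * by (rule integrable_const_ivl)
    have "norm (integral {0..} (\<lambda>w. fejer z w *\<^sub>R k w - fejer z w *\<^sub>R L)) \<le> integral {0..} ?h"
    proof (rule integral_norm_bound_integral)
      show "(\<lambda>w. fejer z w *\<^sub>R k w - fejer z w *\<^sub>R L) integrable_on {0..}"
        by (rule integrable_diff[OF fk has_integral_integrable[OF fL]])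
      show "?h integrable_on {0..}" by (rule integrable_add[OF i1 i2])
      fix w :: real assume w: "w \<in> {0..}"
      have n: "norm (fejer z w *\<^sub>R k w - fejer z w *\<^sub>R L) = fejer z w * norm (k w - L)"
        using fejer_nonneg[OF z, of w] by (simp add: scaleR_diff_right[symmetric])
      show "norm (fejer z w *\<^sub>R k w - fejer z w *\<^sub>R L) \<le> ?h w"
      proof (cases "w \<le> W")
        case True
        have "fejer z w * norm (k w - L) \<le> (z / 2) * M"
          using M[of w] w z by (intro mult_mono fejer_le) auto
        moreover have "0 \<le> e' * fejer z w"
          using e' fejer_nonneg[OF z] by simp
        ultimately show ?thesis
          unfolding n using w True by (simp add: mult.commute)
      next
        case False
        have "fejer z w * norm (k w - L) \<le> fejer z w * e'"
          using W(2)[of w] False fejer_nonneg[OF z] by (intro mult_left_mono) auto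
        then show ?thesis unfolding n using False by (simp add: mult.commute)
      qed
    qed
    also have "integral {0..} ?h = e' * (pi / 2) + M * (z / 2) * W"
      using W(1) by (subst integral_add[OF i1 i2], unfold integral_restrict_Int *) (simp add: integral_fejer z)
    also have "integral {0..} (\<lambda>w. fejer z w *\<^sub>R k w - fejer z w *\<^sub>R L) = integral {0..} (\<lambda>w. fejer z w *\<^sub>R k w) - (pi / 2) *\<^sub>R L"
      using integral_diff[OF fk has_integral_integrable[OF fL]] integral_unique[OF fL] by simp
    finally show ?thesis by (simp add: e'_def)
  qed
  have "((\<lambda>z. M * (z / 2) * W) \<longlongrightarrow> M * (0 / 2) * W) (at_right 0)"
    by (intro tendsto_intros) simp
  then have "\<forall>\<^sub>F z in at_right 0. M * (z / 2) * W < e / 2"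
    using e by (intro order_tendstoD(2)) auto
  then show "\<forall>\<^sub>F z in at_right 0. dist (integral {0..} (\<lambda>w. fejer z w *\<^sub>R k w)) ((pi / 2) *\<^sub>R L) < e"
    using eventually_at_right_less[of 0]
  proof eventually_elim
    case (elim z)
    show ?case using bound[OF elim(2)] elim(1) unfolding dist_norm by linarith
  qed
qed

text \<open>The bound knows \<open>h\<close> only through \<open>C\<close>. With h multiplied by cos
  (w z) it is therefore the same for all z, which is the source of the uniform convergence of the
  truncated solution.\<close>

lemma quad_decay_tail:
  assumes h: "quad_decay C h" and R: "R \<ge> 0"
  shows "norm (integral {0..R} h - integral {0..} h) \<le> integral {0..} (\<lambda>w. C / (1 + w\<^sup>2)) - integral {0..R} (\<lambda>w. C / (1 + w\<^sup>2))"
proof -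
  let ?c = "\<lambda>w::real. C / (1 + w\<^sup>2)"
  have tail: "(\<lambda>w. if w \<in> {0..R} then 0 else k w) integrable_on {0..}"
    "integral {0..} (\<lambda>w. if w \<in> {0..R} then 0 else k w) = integral {0..} k - integral {0..R} k"
    if k: "k integrable_on {0..}" for k :: "real \<Rightarrow> 'z::euclidean_space"
  proof -
    have *: "{0..R} \<inter> {0..} = {0..R}" by auto
    have eq: "(\<lambda>w. if w \<in> {0..R} then 0 else k w) = (\<lambda>w. k w - (if w \<in> {0..R} then k w else 0))"
      by auto
    have "k integrable_on {0..R}"
      by (rule integrable_on_subinterval[OF k]) auto
    then have i: "(\<lambda>w. if w \<in> {0..R} then k w else 0) integrable_on {0..}"
      unfolding integrable_restrict_Int * .
    show "(\<lambda>w. if w \<in> {0..R} then 0 else k w) integrable_on {0..}"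
      unfolding eq by (rule integrable_diff[OF k i])
    show "integral {0..} (\<lambda>w. if w \<in> {0..R} then 0 else k w) = integral {0..} k - integral {0..R} k"
      unfolding eq integral_diff[OF k i] unfolding integral_restrict_Int * ..
  qed
  have "norm (integral {0..} (\<lambda>w. if w \<in> {0..R} then 0 else h w)) \<le> integral {0..} (\<lambda>w. if w \<in> {0..R} then 0 else ?c w)"
    by (rule integral_norm_bound_integral[OF tail(1)[OF quad_decay_integrable[OF h]] tail(1)[OF inverse_quadratic_integrable]])
      (use quad_decay_le[OF h] in auto)
  then show ?thesis
    unfolding tail(2)[OF quad_decay_integrable[OF h]] tail(2)[OF inverse_quadratic_integrable]
    by (simp add: norm_minus_commute)
qed

context parabolic_matrices
begin

text \<open>Quartic decay of the matrix factor pays for quadratic growth of the vector factor, as it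
  occurs for iterated primitives of a bounded function.\<close>

lemma quad_decay_product:
  fixes X :: "real \<Rightarrow> real^'n^'n" and v :: "real \<Rightarrow> real^'n"
  assumes X: "continuous_on {0..} X" "\<And>w. w \<ge> 0 \<Longrightarrow> norm (X w) \<le> D / (1 + w\<^sup>2)\<^sup>2"
    and v: "continuous_on {0..} v" "\<And>w. w \<ge> 0 \<Longrightarrow> norm (v w) \<le> c * (1 + w\<^sup>2)"
  shows "quad_decay (D * c) (\<lambda>w. X w *v v w)"
  unfolding quad_decay_def
proof (intro conjI allI impI)
  show "continuous_on {0..} (\<lambda>w. X w *v v w)"
    by (rule matrix_vector_mult.continuous_on[OF X(1) v(1)])
  fix w :: real assume w: "w \<ge> 0"
  have "norm (X w *v v w) \<le> norm (X w) * norm (v w)"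
    by (rule norm_matrix_vector_mult_le)
  also have "\<dots> \<le> (D / (1 + w\<^sup>2)\<^sup>2) * (c * (1 + w\<^sup>2))"
    using X(2)[OF w] v(2)[OF w] by (intro mult_mono) (auto intro: order_trans[OF norm_ge_zero])
  also have "\<dots> = D * c / (1 + w\<^sup>2)"
    using one_plus_square_pos[of w] by (simp add: power2_eq_square[of "1 + w\<^sup>2"])
  finally show "norm (X w *v v w) \<le> D * c / (1 + w\<^sup>2)" .
qed

lemma E_gaussian_bounds:
  assumes d: "0 < d" "d \<le> T"
  obtains D where "D \<ge> 0"
    "\<And>\<omega> t. d \<le> t \<Longrightarrow> t \<le> T \<Longrightarrow> norm (E \<omega> t) \<le> D / (1 + \<omega>\<^sup>2)\<^sup>2"
    "\<And>\<omega> t. d \<le> t \<Longrightarrow> t \<le> T \<Longrightarrow> norm (E' \<omega> t) \<le> D / (1 + \<omega>\<^sup>2)\<^sup>2"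
    "\<And>\<omega> t. d \<le> t \<Longrightarrow> t \<le> T \<Longrightarrow> norm (E'' \<omega> t) \<le> D / (1 + \<omega>\<^sup>2)\<^sup>2"
proof -
  have T: "T \<ge> 0" using d by simp
  obtain C where C: "C > 0"
    "\<And>\<omega> t. 0 \<le> t \<Longrightarrow> t \<le> T \<Longrightarrow> norm (E \<omega> t) \<le> C * exp (- \<kappa> * (\<omega>\<^sup>2 * t))"
    "\<And>\<omega> t. 0 \<le> t \<Longrightarrow> t \<le> T \<Longrightarrow> (1 + \<bar>\<omega>\<bar>) * norm (E' \<omega> t) \<le> C * exp (- \<kappa> * (\<omega>\<^sup>2 * t))"
    "\<And>\<omega> t. 0 \<le> t \<Longrightarrow> t \<le> T \<Longrightarrow> (1 + \<omega>\<^sup>2) * norm (E'' \<omega> t) \<le> C * exp (- \<kappa> * (\<omega>\<^sup>2 * t))"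
    using E_bounds[OF T] by metis
  define D where "D = C * (1 + 2 / (\<kappa> * d))\<^sup>2"
  have exp_le: "C * exp (- \<kappa> * (\<omega>\<^sup>2 * t)) \<le> D / (1 + \<omega>\<^sup>2)\<^sup>2" if "d \<le> t" for \<omega> t
  proof -
    have "C * exp (- \<kappa> * (\<omega>\<^sup>2 * t)) \<le> C * ((1 + 2 / (\<kappa> * d))\<^sup>2 / (1 + \<omega>\<^sup>2)\<^sup>2)"
      using C(1) by (intro mult_left_mono gaussian_le[OF \<kappa>_pos d(1) that]) auto
    then show ?thesis by (simp add: D_def)
  qed
  show ?thesis
  proof (rule that[of D])
    show "D \<ge> 0" using C(1) by (simp add: D_def)
    fix \<omega> t assume t: "d \<le> t" "t \<le> T"
    have t0: "0 \<le> t" using t d by simp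
    show "norm (E \<omega> t) \<le> D / (1 + \<omega>\<^sup>2)\<^sup>2"
      using C(2)[OF t0 t(2)] exp_le[OF t(1)] by (rule order_trans)
    have "1 * norm (E' \<omega> t) \<le> (1 + \<bar>\<omega>\<bar>) * norm (E' \<omega> t)"
      by (intro mult_right_mono) auto
    also have "\<dots> \<le> D / (1 + \<omega>\<^sup>2)\<^sup>2"
      using C(3)[OF t0 t(2)] exp_le[OF t(1)] by (rule order_trans)
    finally show "norm (E' \<omega> t) \<le> D / (1 + \<omega>\<^sup>2)\<^sup>2" by simp
    have "1 * norm (E'' \<omega> t) \<le> (1 + \<omega>\<^sup>2) * norm (E'' \<omega> t)"
      by (intro mult_right_mono) auto
    also have "\<dots> \<le> D / (1 + \<omega>\<^sup>2)\<^sup>2"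
      using C(4)[OF t0 t(2)] exp_le[OF t(1)] by (rule order_trans)
    finally show "norm (E'' \<omega> t) \<le> D / (1 + \<omega>\<^sup>2)\<^sup>2" by simp
  qed
qed

text \<open>Two integrations by parts express the \<open>E\<close>-mean of \<open>S\<close> through the Cesaro means of \<open>S\<close>,
  with the weight \<open>w E''(w, t)\<close>, which is bounded in \<open>L\<^sup>1\<close> uniformly in \<open>t\<close> and whose mass
  moves to infinity as \<open>t\<close> tends to \<open>0\<close>.\<close>

lemma gaussian_summation:
  fixes S :: "real \<Rightarrow> real^'n"
  assumes S: "continuous_on {0..} S" "\<And>w. w \<ge> 0 \<Longrightarrow> norm (S w) \<le> K"
    and lim: "((\<lambda>R. (1 / R) *\<^sub>R integral {0..R} (\<lambda>r. integral {0..r} S)) \<longlongrightarrow> L) at_top"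
  shows "((\<lambda>t. integral {0..} (\<lambda>w. E w t *v S w)) \<longlongrightarrow> L) (at_right 0)"
proof -
  have K: "K \<ge> 0" using order_trans[OF norm_ge_zero S(2)[of 0]] by simp
  define S1 where "S1 = (\<lambda>r. integral {0..r} S)"
  define S2 where "S2 = (\<lambda>r. integral {0..r} S1)"
  have S0: "S1 0 = 0" "S2 0 = 0"
    by (simp_all add: S1_def S2_def)
  have S1': "(S1 has_vector_derivative S r) (at r within {0..})" if "r \<ge> 0" for r
    unfolding S1_def by (rule integral_upto_deriv[OF S(1) that])
  have S1c: "continuous_on {0..} S1"
    unfolding S1_def by (rule continuous_integral_upto[OF S(1)])
  have S2': "(S2 has_vector_derivative S1 r) (at r within {0..})" if "r \<ge> 0" for r
    unfolding S2_def by (rule integral_upto_deriv[OF S1c that])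
  have S2c: "continuous_on {0..} S2"
    unfolding S2_def by (rule continuous_integral_upto[OF S1c])
  have S1_le: "norm (S1 r) \<le> K * r" if "r \<ge> 0" for r
    unfolding S1_def by (rule norm_integral_upto_le[OF S(1) that K S(2)])
  have S2_le: "norm (S2 r) \<le> K * r\<^sup>2" if "r \<ge> 0" for r
  proof -
    have "norm (S1 w) \<le> K * r" if "0 \<le> w" "w \<le> r" for w
      using S1_le[OF that(1)] mult_left_mono[OF that(2) K] by linarith
    then have "norm (S2 r) \<le> K * r * r"
      unfolding S2_def by (intro norm_integral_upto_le[OF S1c that]) (use K that in auto)
    then show ?thesis by (simp add: power2_eq_square)
  qed
  have w_le: "w \<le> 1 + w\<^sup>2" if "w \<ge> 0" for w :: real
  proof -
    have "0 \<le> (w - 1)\<^sup>2" by simp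
    then have "2 * w \<le> 1 + w\<^sup>2" by (simp add: power2_diff)
    with that show ?thesis by linarith
  qed
  have S1_le': "norm (S1 w) \<le> K * (1 + w\<^sup>2)" if "w \<ge> 0" for w
    using S1_le[OF that] mult_left_mono[OF w_le[OF that] K] by linarith
  have S2_le': "norm (S2 w) \<le> K * (1 + w\<^sup>2)" if "w \<ge> 0" for w
    using S2_le[OF that] K by (simp add: algebra_simps)
  have S_le': "norm (S w) \<le> K * (1 + w\<^sup>2)" if "w \<ge> 0" for w
    using S(2)[OF that] mult_left_mono[of 1 "1 + w\<^sup>2" K] K by simp
  obtain C where C: "C > 0"
    "\<And>\<omega> t. 0 \<le> t \<Longrightarrow> t \<le> 1 \<Longrightarrow> norm (E'' \<omega> t) \<le> C * t * exp (- \<kappa> * (\<omega>\<^sup>2 * t))"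
    using E_bounds[OF zero_le_one] by metis
  \<comment> \<open>The term \<open>E 0 t *v L\<close> equals the same weighted integral with
    \<open>S2 w\<close> replaced by w L. The error is thus governed by
    \<open>S2 w - w *\<^sub>R L\<close>, which is small compared with w at high frequencies by the
    Cesaro hypothesis.\<close>
  have identity: "integral {0..} (\<lambda>w. E w t *v S w) - E 0 t *v L = integral {0..} (\<lambda>w. E'' w t *v (S2 w - w *\<^sub>R L))"
    if t: "t > 0" for t
  proof -
    obtain D where D0: "D \<ge> 0"
      "\<And>\<omega> t'. t \<le> t' \<Longrightarrow> t' \<le> t \<Longrightarrow> norm (E \<omega> t') \<le> D / (1 + \<omega>\<^sup>2)\<^sup>2"
      "\<And>\<omega> t'. t \<le> t' \<Longrightarrow> t' \<le> t \<Longrightarrow> norm (E' \<omega> t') \<le> D / (1 + \<omega>\<^sup>2)\<^sup>2"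
      "\<And>\<omega> t'. t \<le> t' \<Longrightarrow> t' \<le> t \<Longrightarrow> norm (E'' \<omega> t') \<le> D / (1 + \<omega>\<^sup>2)\<^sup>2"
      using E_gaussian_bounds[OF t order_refl] by metis
    note D = D0(1) D0(2-4)[OF order_refl order_refl]
    have cE: "continuous_on {0..} (\<lambda>w. E w t)" "continuous_on {0..} (\<lambda>w. E' w t)" "continuous_on {0..} (\<lambda>w. E'' w t)"
      using t by (intro continuous_intros; simp)+
    have dE: "((\<lambda>w. E w t) has_vector_derivative E' w t) (at w within {0..})"
      "((\<lambda>w. E' w t) has_vector_derivative E'' w t) (at w within {0..})" for w
      using t by (intro has_vector_derivative_at_within[OF E_deriv_freq] has_vector_derivative_at_within[OF E'_deriv_freq]; simp)+
    have L_le: "norm L \<le> norm L * (1 + w\<^sup>2)" "norm (w *\<^sub>R L) \<le> norm L * (1 + w\<^sup>2)" if "w \<ge> 0" for w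
      using mult_left_mono[OF w_le[OF that], of "norm L"] that mult_left_mono[of 1 "1 + w\<^sup>2" "norm L"]
      by (simp_all add: mult.commute)
    note q = quad_decay_product[OF cE(1) D(2) S(1) S_le'] quad_decay_product[OF cE(1) D(2) S1c S1_le']
      quad_decay_product[OF cE(2) D(3) S2c S2_le'] quad_decay_product[OF cE(3) D(4) S2c S2_le']
    note qL = quad_decay_product[OF cE(1) D(2) continuous_on_const L_le(1)]
      quad_decay_product[OF cE(2) D(3) _ L_le(2)] quad_decay_product[OF cE(3) D(4) _ L_le(2)]
    have c_id: "continuous_on {0..} (\<lambda>w. w *\<^sub>R L)" by (intro continuous_intros)
    have "integral {0..} (\<lambda>w. E w t *v S w - E'' w t *v S2 w) = 0 - (E 0 t *v S1 0 - E' 0 t *v S2 0)"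
    proof (rule integral_atLeast_ftc)
      fix w :: real assume w: "w \<ge> 0"
      show "((\<lambda>w. E w t *v S1 w - E' w t *v S2 w) has_vector_derivative E w t *v S w - E'' w t *v S2 w) (at w within {0..})"
        by (rule has_vector_derivative_eq_rhs[OF has_vector_derivative_diff[OF
              matrix_vector_mult.has_vector_derivative[OF dE(1) S1'[OF w]]
              matrix_vector_mult.has_vector_derivative[OF dE(2) S2'[OF w]]]]) simp
    next
      show "(\<lambda>w. E w t *v S w - E'' w t *v S2 w) integrable_on {0..}"
        by (rule integrable_diff[OF quad_decay_integrable[OF q(1)] quad_decay_integrable[OF q(4)]])
      show "((\<lambda>w. E w t *v S1 w - E' w t *v S2 w) \<longlongrightarrow> 0) at_top"
        using tendsto_diff[OF quad_decay_tendsto[OF q(2)] quad_decay_tendsto[OF q(3)]] by simp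
    qed
    then have 1: "integral {0..} (\<lambda>w. E w t *v S w) = integral {0..} (\<lambda>w. E'' w t *v S2 w)"
      by (simp add: integral_diff[OF quad_decay_integrable[OF q(1)] quad_decay_integrable[OF q(4)]] S0)
    have "integral {0..} (\<lambda>w. E'' w t *v (w *\<^sub>R L)) = 0 - (E' 0 t *v (0 *\<^sub>R L) - E 0 t *v L)"
    proof (rule integral_atLeast_ftc)
      fix w :: real assume w: "w \<ge> 0"
      have "((\<lambda>w. w *\<^sub>R L) has_vector_derivative 1 *\<^sub>R L) (at w within {0..})"
        by (auto intro!: derivative_eq_intros)
      from has_vector_derivative_diff[OF matrix_vector_mult.has_vector_derivative[OF dE(2) this]
          matrix_vector_mult.has_vector_derivative[OF dE(1) has_vector_derivative_const]]
      show "((\<lambda>w. E' w t *v (w *\<^sub>R L) - E w t *v L) has_vector_derivative E'' w t *v (w *\<^sub>R L)) (at w within {0..})"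
        by (rule has_vector_derivative_eq_rhs) simp
    next
      show "(\<lambda>w. E'' w t *v (w *\<^sub>R L)) integrable_on {0..}"
        by (rule quad_decay_integrable[OF qL(3)[OF c_id]])
      show "((\<lambda>w. E' w t *v (w *\<^sub>R L) - E w t *v L) \<longlongrightarrow> 0) at_top"
        using tendsto_diff[OF quad_decay_tendsto[OF qL(2)[OF c_id]] quad_decay_tendsto[OF qL(1)]] by simp
    qed
    then have 2: "E 0 t *v L = integral {0..} (\<lambda>w. E'' w t *v (w *\<^sub>R L))" by simp
    show ?thesis
      unfolding 1 2 matrix_vector_mult.diff_right
      by (rule integral_diff[symmetric, OF quad_decay_integrable[OF q(4)] quad_decay_integrable[OF qL(3)[OF c_id]]])
  qed
  let ?J = "\<lambda>t. integral {0..} (\<lambda>w. t * exp (- \<kappa> * (w\<^sup>2 * t)))"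
  \<comment> \<open>For t at most 1, t / (1 + \<kappa> w^2 t) is at most 1 / (1 + \<kappa> w^2): a
    majorant independent of t, by which the integral \<open>?J t\<close> tends to 0.\<close>
  have te_le: "t * exp (- \<kappa> * (w\<^sup>2 * t)) \<le> (1 + 1 / \<kappa>) / (1 + w\<^sup>2)" if t: "0 < t" "t \<le> 1" for t w
  proof -
    have p: "\<kappa> * (w\<^sup>2 * t) \<ge> 0" "0 < 1 + \<kappa> * (w\<^sup>2 * t)" "0 < 1 + \<kappa> * w\<^sup>2"
      using \<kappa>_pos t by (auto intro!: add_pos_nonneg)
    have "exp (- \<kappa> * (w\<^sup>2 * t)) \<le> 1 / (1 + \<kappa> * (w\<^sup>2 * t))"
      using exp_ge_add_one_self[of "\<kappa> * (w\<^sup>2 * t)"] p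
      by (simp add: exp_minus inverse_eq_divide frac_le)
    then have "t * exp (- \<kappa> * (w\<^sup>2 * t)) \<le> t * (1 / (1 + \<kappa> * (w\<^sup>2 * t)))"
      using t by (intro mult_left_mono) auto
    also have "\<dots> \<le> 1 / (1 + \<kappa> * w\<^sup>2)"
      using t p by (simp add: divide_le_eq le_divide_eq field_simps)
    also have "\<dots> \<le> (1 + 1 / \<kappa>) / (1 + w\<^sup>2)"
    proof -
      have "1 + w\<^sup>2 \<le> (1 + 1 / \<kappa>) * (1 + \<kappa> * w\<^sup>2)"
        using \<kappa>_pos by (simp add: algebra_simps)
      then show ?thesis
        using p one_plus_square_pos[of w] by (simp add: divide_le_eq le_divide_eq mult.commute)
    qed
    finally show ?thesis .
  qed
  have te_int: "(\<lambda>w. t * exp (- \<kappa> * (w\<^sup>2 * t))) integrable_on {0..}" if t: "0 < t" "t \<le> 1" for t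
    by (rule integrable_by_bound(1)[OF _ _ inverse_quadratic_integrable[of "1 + 1 / \<kappa>"]])
      (use te_le[OF t] t in \<open>auto intro!: continuous_intros\<close>)
  have "(?J \<longlongrightarrow> integral {0..} (\<lambda>w::real. 0 :: real)) (at 0 within {0..1})"
  proof (rule dominated_convergence_at_within[OF _ inverse_quadratic_integrable[of "1 + 1 / \<kappa>"]])
    show "((\<lambda>t. t * exp (- \<kappa> * (w\<^sup>2 * t))) \<longlongrightarrow> 0) (at 0 within {0..1})" for w
      by (rule tendsto_eq_intros refl | simp)+
  qed (use te_le te_int in auto)
  then have J: "(?J \<longlongrightarrow> 0) (at_right 0)"
    by (simp add: at_within_Icc_at_right)
  \<comment> \<open>The scale-invariant integral: its value does not depend on t, which is the
    uniform L1 bound for the weight w E''(w, t).\<close>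
  have wte: "((\<lambda>w. w * (t * exp (- \<kappa> * (w\<^sup>2 * t)))) has_integral 1 / (2 * \<kappa>)) {0..}" if t: "0 < t" "t \<le> 1" for t
  proof -
    let ?f = "\<lambda>w. - (1 / (2 * \<kappa>)) * exp (- \<kappa> * (w\<^sup>2 * t))"
    let ?d = "\<lambda>w. w * (t * exp (- \<kappa> * (w\<^sup>2 * t)))"
    have int: "?d integrable_on {0..}"
    proof (rule integrable_by_bound(1)[OF _ _ inverse_quadratic_integrable])
      fix w :: real assume w: "w \<ge> 0"
      have "exp (- \<kappa> * (w\<^sup>2 * t)) \<le> (1 + 2 / (\<kappa> * t))\<^sup>2 / (1 + w\<^sup>2)\<^sup>2"
        by (rule gaussian_le[OF \<kappa>_pos t(1) order_refl])
      then have "norm (?d w) \<le> (1 + w\<^sup>2) * (t * ((1 + 2 / (\<kappa> * t))\<^sup>2 / (1 + w\<^sup>2)\<^sup>2))"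
        using w t w_le[OF w] unfolding real_norm_def abs_mult by (intro mult_mono) auto
      also have "\<dots> = t * (1 + 2 / (\<kappa> * t))\<^sup>2 / (1 + w\<^sup>2)"
        using one_plus_square_pos[of w] by (simp add: power2_eq_square[of "1 + w\<^sup>2"])
      finally show "norm (?d w) \<le> t * (1 + 2 / (\<kappa> * t))\<^sup>2 / (1 + w\<^sup>2)" .
    qed (intro continuous_intros)
    have "integral {0..} ?d = 0 - ?f 0"
    proof (rule integral_atLeast_ftc[OF _ int])
      show "(?f has_vector_derivative ?d w) (at w within {0..})" for w
        using \<kappa>_pos by (auto intro!: derivative_eq_intros simp: has_real_derivative_iff_has_vector_derivative[symmetric])
      have "quad_decay ((1 + 2 / (\<kappa> * t))\<^sup>2) (\<lambda>w. exp (- \<kappa> * (w\<^sup>2 * t)))"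
        unfolding quad_decay_def
      proof (intro conjI allI impI)
        fix w :: real
        have "norm (exp (- \<kappa> * (w\<^sup>2 * t))) \<le> (1 + 2 / (\<kappa> * t))\<^sup>2 / (1 + w\<^sup>2)\<^sup>2"
          using gaussian_le[OF \<kappa>_pos t(1) order_refl] by simp
        also have "\<dots> \<le> (1 + 2 / (\<kappa> * t))\<^sup>2 / (1 + w\<^sup>2)"
          using one_plus_square_pos[of w] self_le_power[of "1 + w\<^sup>2" 2]
          by (intro divide_left_mono mult_pos_pos zero_less_power) auto
        finally show "norm (exp (- \<kappa> * (w\<^sup>2 * t))) \<le> (1 + 2 / (\<kappa> * t))\<^sup>2 / (1 + w\<^sup>2)" .
      qed (intro continuous_intros)
      from tendsto_mult_right_zero[OF quad_decay_tendsto[OF this]]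
      show "(?f \<longlongrightarrow> 0) at_top" .
    qed
    with int show ?thesis by (simp add: has_integral_integrable_integral)
  qed
  have bound: "\<exists>M\<ge>0. \<forall>t. 0 < t \<and> t \<le> 1 \<longrightarrow> norm (integral {0..} (\<lambda>w. E w t *v S w) - E 0 t *v L) \<le> C * M * ?J t + C * e * (1 / (2 * \<kappa>))"
    if e: "e > 0" for e
  proof -
    have "\<forall>\<^sub>F R in at_top. dist ((1 / R) *\<^sub>R S2 R) L < e"
      using lim e unfolding S2_def S1_def by (rule tendstoD)
    then obtain W0 where W0: "\<And>R. R \<ge> W0 \<Longrightarrow> dist ((1 / R) *\<^sub>R S2 R) L < e"
      unfolding eventually_at_top_linorder by blast
    define W where "W = max W0 1"
    \<comment> \<open>Accounts for frequencies up to \<open>W\<close>, where the Cesaro mean need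
      not be near \<open>L\<close>. This constant is multiplied by \<open>?J t\<close>, so the low
      frequencies disappear as t tends to 0.\<close>
    define M where "M = K * W\<^sup>2 + W * norm L"
    have M0: "M \<ge> 0" using K by (simp add: M_def W_def)
    have le: "norm (S2 w - w *\<^sub>R L) \<le> M + e * w" if w: "w \<ge> 0" for w
    proof (cases "w \<le> W")
      case True
      have "norm (S2 w - w *\<^sub>R L) \<le> norm (S2 w) + norm (w *\<^sub>R L)"
        by (rule norm_triangle_ineq4)
      also have "\<dots> \<le> K * W\<^sup>2 + W * norm L"
      proof (rule add_mono)
        have "K * w\<^sup>2 \<le> K * W\<^sup>2"
          using K w True by (intro mult_left_mono power_mono) auto
        with S2_le[OF w] show "norm (S2 w) \<le> K * W\<^sup>2" by linarith
        show "norm (w *\<^sub>R L) \<le> W * norm L"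
          using w True by (simp add: mult_right_mono)
      qed
      also have "\<dots> \<le> M + e * w" using e w by (simp add: M_def)
      finally show ?thesis .
    next
      case False
      then have w1: "w > 0" "w \<ge> W0" by (auto simp: W_def)
      have "S2 w - w *\<^sub>R L = w *\<^sub>R ((1 / w) *\<^sub>R S2 w - L)"
        using w1 by (simp add: scaleR_diff_right)
      then have "norm (S2 w - w *\<^sub>R L) = w * norm ((1 / w) *\<^sub>R S2 w - L)"
        using w1 by simp
      also have "\<dots> \<le> w * e"
        using W0[OF w1(2)] w1 by (intro mult_left_mono) (auto simp: dist_norm)
      finally show ?thesis using M0 by (simp add: mult.commute)
    qed
    show ?thesis
    proof (intro exI[of _ M] conjI M0 allI impI)
      fix t :: real assume "0 < t \<and> t \<le> 1"
      then have t: "0 < t" "t \<le> 1" by auto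
      have i: "(\<lambda>w. C * M * (t * exp (- \<kappa> * (w\<^sup>2 * t)))) integrable_on {0..}"
        "(\<lambda>w. C * e * (w * (t * exp (- \<kappa> * (w\<^sup>2 * t))))) integrable_on {0..}"
        by (rule integrable_on_mult_right[OF te_int[OF t]],
            rule integrable_on_mult_right[OF has_integral_integrable[OF wte[OF t]]])
      have "norm (integral {0..} (\<lambda>w. E'' w t *v (S2 w - w *\<^sub>R L))) \<le>
          integral {0..} (\<lambda>w. C * M * (t * exp (- \<kappa> * (w\<^sup>2 * t))) + C * e * (w * (t * exp (- \<kappa> * (w\<^sup>2 * t)))))"
      proof (rule integrable_by_bound(2)[OF _ _ integrable_add[OF i]])
        have "continuous_on {0..} (\<lambda>w. S2 w - w *\<^sub>R L)"
          by (rule continuous_on_diff[OF S2c]) (intro continuous_intros)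
        moreover have "continuous_on {0..} (\<lambda>w. E'' w t)"
          using t by (intro continuous_intros) auto
        ultimately show "continuous_on {0..} (\<lambda>w. E'' w t *v (S2 w - w *\<^sub>R L))"
          by (rule matrix_vector_mult.continuous_on[rotated])
        fix w :: real assume w: "w \<ge> 0"
        have "norm (E'' w t *v (S2 w - w *\<^sub>R L)) \<le> norm (E'' w t) * norm (S2 w - w *\<^sub>R L)"
          by (rule norm_matrix_vector_mult_le)
        also have "\<dots> \<le> (C * t * exp (- \<kappa> * (w\<^sup>2 * t))) * (M + e * w)"
        proof (rule mult_mono[OF C(2) le[OF w]])
          show "0 \<le> C * t * exp (- \<kappa> * (w\<^sup>2 * t))"
            using C(1) t by simp
        qed (use t in auto)
        also have "\<dots> = C * M * (t * exp (- \<kappa> * (w\<^sup>2 * t))) + C * e * (w * (t * exp (- \<kappa> * (w\<^sup>2 * t))))"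
          by (simp add: algebra_simps)
        finally show "norm (E'' w t *v (S2 w - w *\<^sub>R L)) \<le>
          C * M * (t * exp (- \<kappa> * (w\<^sup>2 * t))) + C * e * (w * (t * exp (- \<kappa> * (w\<^sup>2 * t))))" .
      qed
      also have "\<dots> = C * M * ?J t + C * e * (1 / (2 * \<kappa>))"
        unfolding integral_add[OF i] integral_mult_right integral_unique[OF wte[OF t]] ..
      finally show "norm (integral {0..} (\<lambda>w. E w t *v S w) - E 0 t *v L) \<le> C * M * ?J t + C * e * (1 / (2 * \<kappa>))"
        unfolding identity[OF t(1)] .
    qed
  qed
  have diff: "((\<lambda>t. integral {0..} (\<lambda>w. E w t *v S w) - E 0 t *v L) \<longlongrightarrow> 0) (at_right 0)"
  proof (rule tendstoI)
    fix e0 :: real assume e0: "e0 > 0"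
    \<comment> \<open>Chosen so that the uniform L1 mass 1 / (2 \<kappa>) of the weight, times C e,
      is e0 / 2.\<close>
    define e where "e = e0 * \<kappa> / C"
    have e: "e > 0" "C * e * (1 / (2 * \<kappa>)) = e0 / 2"
      using e0 \<kappa>_pos C(1) by (simp_all add: e_def)
    from bound[OF e(1)] obtain M where M: "M \<ge> 0" "\<And>t. 0 < t \<Longrightarrow> t \<le> 1 \<Longrightarrow>
        norm (integral {0..} (\<lambda>w. E w t *v S w) - E 0 t *v L) \<le> C * M * ?J t + e0 / 2"
      unfolding e(2) by blast
    have "((\<lambda>t. C * M * ?J t) \<longlongrightarrow> C * M * 0) (at_right 0)"
      by (intro tendsto_intros J)
    then have "\<forall>\<^sub>F t in at_right 0. C * M * ?J t < e0 / 2"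
      using e0 by (intro order_tendstoD(2)) auto
    moreover have "\<forall>\<^sub>F t::real in at_right 0. 0 < t \<and> t < 1"
      using eventually_at_right_real[of 0 1] by simp
    ultimately show "\<forall>\<^sub>F t in at_right 0. dist (integral {0..} (\<lambda>w. E w t *v S w) - E 0 t *v L) 0 < e0"
    proof eventually_elim
      case (elim t)
      then show ?case using M(2)[of t] by (simp add: dist_norm)
    qed
  qed
  have "continuous_on {0..} (\<lambda>t. E 0 t *v L)"
    by (intro matrix_vector_mult.continuous_on continuous_intros)
  then have "((\<lambda>t. E 0 t *v L) \<longlongrightarrow> E 0 0 *v L) (at 0 within {0..})"
    unfolding continuous_on_def by (rule bspec) simp
  then have "((\<lambda>t. E 0 t *v L) \<longlongrightarrow> L) (at_right 0)"
    by (simp add: at_within_Ici_at_right)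
  from tendsto_add[OF diff this] show ?thesis by simp
qed

subsection \<open>High-frequency behaviour of the boundary term\<close>

text \<open>At high frequency the kernel \<omega>^2 E(\<omega>, t - s) B acts as an approximate
  identity at s = t. Freezing \<open>g\<close> at time t makes the integral explicit up to
  lower-order terms; the remainder is controlled by continuity of \<open>g\<close> at t and by
  exponential decay for earlier times.\<close>

lemma G_asymptotics:
  assumes g: "continuous_on {0..} g" and t: "t > 0"
  shows "((\<lambda>\<omega>. \<omega>\<^sup>2 *\<^sub>R G (\<lambda>s. B *v g s) \<omega> t) \<longlongrightarrow> g t) at_top"
proof -
  have gB: "continuous_on {0..} (\<lambda>s. B *v g s)"
    by (intro matrix_vector_mult.continuous_on continuous_on_const g)
  have gd: "continuous_on {0..} (\<lambda>s. B *v (g s - g t))"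
    by (intro matrix_vector_mult.continuous_on continuous_intros g)
  have T: "t \<ge> 0" "t \<le> t" using t by auto
  obtain C where C: "C > 0"
    "\<And>\<omega> r. 0 \<le> r \<Longrightarrow> r \<le> t \<Longrightarrow> norm (E \<omega> r) \<le> C * exp (- \<kappa> * (\<omega>\<^sup>2 * r))"
    using E_bounds[OF T(1)] by metis
  \<comment> \<open>For constant data, \<omega>^2 E B is the s-derivative of E(\<omega>, t - s) plus
    E A. The derivative integrates to \<open>g t\<close> minus a Gaussian term, and the part with
    \<open>A\<close> is a boundary density of the same kind without the factor \<omega>^2.\<close>
  have frozen: "\<omega>\<^sup>2 *\<^sub>R G (\<lambda>s. B *v g t) \<omega> t = g t - E \<omega> t *v g t + G (\<lambda>s. A *v g t) \<omega> t" for \<omega>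
  proof -
    have E_rev: "((\<lambda>s. E \<omega> (t - s)) has_vector_derivative - (E \<omega> (t - s) ** (A - \<omega>\<^sup>2 *\<^sub>R B))) (at s within {0..t})" for s
    proof -
      have "((\<lambda>s. t - s) has_vector_derivative 0 - 1) (at s within {0..t})"
        by (intro derivative_intros)
      from vector_diff_chain_within[OF this E_deriv_time]
      show ?thesis by (simp add: o_def E_commute)
    qed
    have d: "((\<lambda>s. E \<omega> (t - s) *v g t) has_vector_derivative
        \<omega>\<^sup>2 *\<^sub>R (E \<omega> (t - s) *v (B *v g t)) - E \<omega> (t - s) *v (A *v g t)) (at s within {0..t})" for s
      by (rule has_vector_derivative_eq_rhs[OF bounded_linear.has_vector_derivative[OF matrix_vector_mult.bounded_linear_left E_rev]])
        (simp add: matrix_mult.diff_right matrix_mult.scaleR_right matrix_vector_mult.diff_left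
          matrix_vector_mult.scaleR_left matrix_vector_mult.minus_left matrix_vector_mul_assoc)
    have i: "(\<lambda>s. E \<omega> (t - s) *v v) integrable_on {0..t}" for v
      by (intro integrable_continuous_interval matrix_vector_mult.continuous_on continuous_intros)
    have "((\<lambda>s. \<omega>\<^sup>2 *\<^sub>R (E \<omega> (t - s) *v (B *v g t)) - E \<omega> (t - s) *v (A *v g t)) has_integral
        E \<omega> (t - t) *v g t - E \<omega> (t - 0) *v g t) {0..t}"
      by (rule fundamental_theorem_of_calculus[OF T(1) d])
    from integral_unique[OF this]
    have "\<omega>\<^sup>2 *\<^sub>R G (\<lambda>s. B *v g t) \<omega> t - G (\<lambda>s. A *v g t) \<omega> t = g t - E \<omega> t *v g t"
      unfolding G_def integral_diff[OF integrable_cmul[OF i] i] integral_cmul by simp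
    then show ?thesis by (simp only: diff_eq_eq)
  qed
  have split: "\<omega>\<^sup>2 *\<^sub>R G (\<lambda>s. B *v g s) \<omega> t =
      \<omega>\<^sup>2 *\<^sub>R G (\<lambda>s. B *v (g s - g t)) \<omega> t + \<omega>\<^sup>2 *\<^sub>R G (\<lambda>s. B *v g t) \<omega> t" for \<omega>
  proof -
    have "G (\<lambda>s. B *v (g s - g t)) \<omega> t + G (\<lambda>s. B *v g t) \<omega> t =
        integral {0..t} (\<lambda>s. E \<omega> (t - s) *v (B *v (g s - g t)) + E \<omega> (t - s) *v (B *v g t))"
      unfolding G_def
    proof (rule integral_add[symmetric])
      show "(\<lambda>s. E \<omega> (t - s) *v (B *v (g s - g t))) integrable_on {0..t}"
        by (intro integrable_continuous_interval matrix_vector_mult.continuous_on continuous_on_subset[OF gd] continuous_intros) auto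
      show "(\<lambda>s. E \<omega> (t - s) *v (B *v g t)) integrable_on {0..t}"
        by (intro integrable_continuous_interval matrix_vector_mult.continuous_on continuous_intros)
    qed
    also have "\<dots> = G (\<lambda>s. B *v g s) \<omega> t"
      by (simp add: G_def matrix_vector_mult.add_right[symmetric])
    finally show ?thesis by (simp add: scaleR_add_right[symmetric])
  qed
  have E_lim: "((\<lambda>\<omega>. E \<omega> t *v g t) \<longlongrightarrow> 0) at_top"
  proof (rule Lim_null_comparison)
    let ?c = "C * (1 + 2 / (\<kappa> * t))\<^sup>2 * norm (g t)"
    have "norm (E \<omega> t *v g t) \<le> ?c / (1 + \<omega>\<^sup>2)" for \<omega>
    proof -
      have "exp (- \<kappa> * (\<omega>\<^sup>2 * t)) \<le> (1 + 2 / (\<kappa> * t))\<^sup>2 / (1 + \<omega>\<^sup>2)\<^sup>2"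
        by (rule gaussian_le[OF \<kappa>_pos t order_refl])
      also have "\<dots> \<le> (1 + 2 / (\<kappa> * t))\<^sup>2 / (1 + \<omega>\<^sup>2)"
        using self_le_power[of "1 + \<omega>\<^sup>2" 2] by (intro divide_left_mono mult_pos_pos zero_less_power) auto
      finally have "C * exp (- \<kappa> * (\<omega>\<^sup>2 * t)) \<le> C * ((1 + 2 / (\<kappa> * t))\<^sup>2 / (1 + \<omega>\<^sup>2))"
        using C(1) by (intro mult_left_mono) auto
      with C(2)[OF T, of \<omega>] have "norm (E \<omega> t) \<le> C * ((1 + 2 / (\<kappa> * t))\<^sup>2 / (1 + \<omega>\<^sup>2))"
        by linarith
      from order_trans[OF norm_matrix_vector_mult_le mult_right_mono[OF this, of "norm (g t)"]]
      show ?thesis by simp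
    qed
    then show "\<forall>\<^sub>F \<omega> in at_top. norm (E \<omega> t *v g t) \<le> ?c / (1 + \<omega>\<^sup>2)" by simp
  qed (rule inverse_quadratic_tendsto_0)
  have GA_lim: "((\<lambda>\<omega>. G (\<lambda>s. A *v g t) \<omega> t) \<longlongrightarrow> 0) at_top"
  proof -
    have cA: "continuous_on {0..} (\<lambda>s. A *v g t)"
      by (rule continuous_on_const)
    obtain D where D: "D \<ge> 0" "\<And>\<omega> r. 0 \<le> r \<Longrightarrow> r \<le> t \<Longrightarrow> norm (G (\<lambda>s. A *v g t) \<omega> r) \<le> D / (1 + \<omega>\<^sup>2)"
      using G_bounds[OF cA T(1)] by metis
    have "quad_decay D (\<lambda>\<omega>. G (\<lambda>s. A *v g t) \<omega> t)"
      unfolding quad_decay_def using continuous_on_G(1)[OF cA T(1)] D(2)[OF T] by simp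
    then show ?thesis by (rule quad_decay_tendsto)
  qed
  obtain K where K: "K \<ge> 0" "\<And>s. 0 \<le> s \<Longrightarrow> s \<le> t \<Longrightarrow> norm (B *v (g s - g t)) \<le> K"
    using source_bounded[OF gd] by blast
  have rem_lim: "((\<lambda>\<omega>. \<omega>\<^sup>2 *\<^sub>R G (\<lambda>s. B *v (g s - g t)) \<omega> t) \<longlongrightarrow> 0) at_top"
  proof (rule tendstoI)
    fix e0 :: real assume e0: "e0 > 0"
    \<comment> \<open>Balances the time integral of the Gaussian times \<omega>^2, which is at most
      t + 1 / \<kappa>, so that the part near t contributes e0 / 2.\<close>
    define e where "e = e0 / (2 * (C * (t + 1 / \<kappa>)))"
    have Ct: "C * (t + 1 / \<kappa>) > 0"
      using C(1) t \<kappa>_pos by (simp add: add_pos_pos)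
    have e: "e > 0" using e0 Ct by (simp add: e_def)
    have cancel: "q * (e0 / (2 * q)) = e0 / 2" if "q > 0" for q
      using that by simp
    have "((\<lambda>s. B *v (g s - g t)) \<longlongrightarrow> B *v (g t - g t)) (at t within {0..})"
      using gd unfolding continuous_on_def by (rule bspec) (use t in simp)
    then have "\<forall>\<^sub>F s in at t within {0..}. dist (B *v (g s - g t)) 0 < e"
      using e by (intro tendstoD) simp_all
    then obtain d where d: "d > 0" "\<And>s. s \<ge> 0 \<Longrightarrow> s \<noteq> t \<Longrightarrow> dist s t < d \<Longrightarrow> norm (B *v (g s - g t)) < e"
      unfolding eventually_at by auto
    \<comment> \<open>An affine majorant replaces the split into near and far times. Its linear part
      brings the factor t - s, which combines with \<omega>^2 to a power of \<open>X\<close> and is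
      absorbed by half of the exponential rate, leaving a contribution of order 1 / (1 +
      \<omega>^2).\<close>
    have src: "norm (B *v (g s - g t)) \<le> e + K * (t - s) / d" if s: "0 \<le> s" "s \<le> t" for s
    proof (cases "t - s < d")
      case True
      have "norm (B *v (g s - g t)) \<le> e"
        using d(2)[OF s(1)] s True e by (cases "s = t") (auto simp: dist_real_def less_imp_le)
      moreover have "0 \<le> K * (t - s) / d" using K s d by simp
      ultimately show ?thesis by linarith
    next
      case False
      have "K * 1 \<le> K * ((t - s) / d)"
        using False d K by (intro mult_left_mono) (auto simp: le_divide_eq)
      with K(2)[OF s] e show ?thesis by simp
    qed
    have bound: "norm (\<omega>\<^sup>2 *\<^sub>R G (\<lambda>s. B *v (g s - g t)) \<omega> t) \<le>
        e0 / 2 + (C * (K / d) * (2 / \<kappa>) * (t + 2 / \<kappa>)) / (1 + \<omega>\<^sup>2)" for \<omega>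
    proof -
      have expand: "(C * q) * (\<omega>\<^sup>2 * (e + K * r / d)) = (C * e * \<omega>\<^sup>2) * q + (C * (K / d)) * ((\<omega>\<^sup>2 * r) * q)" for q r
        by (simp add: algebra_simps)
      let ?e = "\<lambda>k s. exp (- k * (\<omega>\<^sup>2 * (t - s)))"
      have i: "(\<lambda>s. c * ?e k s) integrable_on {0..t}" for c k
        by (intro integrable_continuous_interval continuous_intros)
      have "norm (G (\<lambda>s. \<omega>\<^sup>2 *\<^sub>R (B *v (g s - g t))) \<omega> t) \<le>
          integral {0..t} (\<lambda>s. (C * e * \<omega>\<^sup>2) * ?e \<kappa> s + (C * (K / d) * (2 / \<kappa>)) * ?e (\<kappa> / 2) s)"
        unfolding G_def
      proof (rule integral_norm_bound_integral[OF _ integrable_add[OF i i]])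
        show "(\<lambda>s. E \<omega> (t - s) *v (\<omega>\<^sup>2 *\<^sub>R (B *v (g s - g t)))) integrable_on {0..t}"
        proof (intro integrable_continuous_interval matrix_vector_mult.continuous_on)
          show "continuous_on {0..t} (\<lambda>s. \<omega>\<^sup>2 *\<^sub>R (B *v (g s - g t)))"
            by (intro continuous_on_scaleR continuous_on_const continuous_on_subset[OF gd]) auto
        qed (intro continuous_intros)
        fix s assume "s \<in> {0..t}"
        then have s: "0 \<le> s" "s \<le> t" by auto
        define X where "X = \<omega>\<^sup>2 * (t - s)"
        have X: "X \<ge> 0" using s by (simp add: X_def)
        have "\<kappa> / 2 * X \<le> exp (\<kappa> / 2 * X)"
          using exp_ge_add_one_self[of "\<kappa> / 2 * X"] by linarith
        then have "X \<le> (2 / \<kappa>) * exp (\<kappa> / 2 * X)"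
          using \<kappa>_pos by (simp add: field_simps)
        then have "X * exp (- \<kappa> * X) \<le> (2 / \<kappa>) * exp (\<kappa> / 2 * X) * exp (- \<kappa> * X)"
          by (intro mult_right_mono) auto
        also have "\<dots> = (2 / \<kappa>) * exp (- (\<kappa> / 2) * X)"
          by (simp add: exp_add[symmetric])
        finally have Xe: "X * exp (- \<kappa> * X) \<le> (2 / \<kappa>) * exp (- (\<kappa> / 2) * X)" .
        have "norm (E \<omega> (t - s) *v (\<omega>\<^sup>2 *\<^sub>R (B *v (g s - g t)))) \<le> norm (E \<omega> (t - s)) * (\<omega>\<^sup>2 * norm (B *v (g s - g t)))"
          using norm_matrix_vector_mult_le[of "E \<omega> (t - s)" "\<omega>\<^sup>2 *\<^sub>R (B *v (g s - g t))"] by simp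
        also have "\<dots> \<le> (C * exp (- \<kappa> * X)) * (\<omega>\<^sup>2 * (e + K * (t - s) / d))"
        proof (rule mult_mono)
          show "norm (E \<omega> (t - s)) \<le> C * exp (- \<kappa> * X)"
            unfolding X_def by (rule C(2)) (use s in auto)
          show "\<omega>\<^sup>2 * norm (B *v (g s - g t)) \<le> \<omega>\<^sup>2 * (e + K * (t - s) / d)"
            by (rule mult_left_mono[OF src[OF s]]) simp
        qed (use C(1) in auto)
        also have "\<dots> = (C * e * \<omega>\<^sup>2) * exp (- \<kappa> * X) + (C * (K / d)) * (X * exp (- \<kappa> * X))"
          unfolding X_def by (rule expand)
        also have "\<dots> \<le> (C * e * \<omega>\<^sup>2) * exp (- \<kappa> * X) + (C * (K / d)) * ((2 / \<kappa>) * exp (- (\<kappa> / 2) * X))"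
          by (intro add_left_mono mult_left_mono[OF Xe]) (use C(1) K(1) d(1) in simp)
        finally show "norm (E \<omega> (t - s) *v (\<omega>\<^sup>2 *\<^sub>R (B *v (g s - g t)))) \<le>
            (C * e * \<omega>\<^sup>2) * ?e \<kappa> s + (C * (K / d) * (2 / \<kappa>)) * ?e (\<kappa> / 2) s"
          by (simp add: X_def mult_ac)
      qed
      also have "\<dots> = (C * e * \<omega>\<^sup>2) * integral {0..t} (?e \<kappa>) + (C * (K / d) * (2 / \<kappa>)) * integral {0..t} (?e (\<kappa> / 2))"
        unfolding integral_add[OF i i] integral_mult_right ..
      also have "\<dots> \<le> C * e * (t + 1 / \<kappa>) + (C * (K / d) * (2 / \<kappa>)) * ((t + 2 / \<kappa>) / (1 + \<omega>\<^sup>2))"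
      proof (rule add_mono)
        have "0 \<le> integral {0..t} (?e \<kappa>)"
          using i[of 1 \<kappa>] by (intro integral_nonneg) auto
        then have "\<omega>\<^sup>2 * integral {0..t} (?e \<kappa>) \<le> (1 + \<omega>\<^sup>2) * integral {0..t} (?e \<kappa>)"
          by (intro mult_right_mono) auto
        also have "\<dots> \<le> t + 1 / \<kappa>"
          by (rule integral_exp_bound[OF \<kappa>_pos T])
        finally have "C * e * (\<omega>\<^sup>2 * integral {0..t} (?e \<kappa>)) \<le> C * e * (t + 1 / \<kappa>)"
          using C(1) e by (intro mult_left_mono) auto
        then show "(C * e * \<omega>\<^sup>2) * integral {0..t} (?e \<kappa>) \<le> C * e * (t + 1 / \<kappa>)"
          by (simp add: mult.assoc)
        have "(1 + \<omega>\<^sup>2) * integral {0..t} (?e (\<kappa> / 2)) \<le> t + 1 / (\<kappa> / 2)"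
          using \<kappa>_pos by (intro integral_exp_bound T) simp
        then have "integral {0..t} (?e (\<kappa> / 2)) \<le> (t + 2 / \<kappa>) / (1 + \<omega>\<^sup>2)"
          using one_plus_square_pos[of \<omega>] by (simp add: le_divide_eq mult.commute)
        then show "(C * (K / d) * (2 / \<kappa>)) * integral {0..t} (?e (\<kappa> / 2)) \<le> (C * (K / d) * (2 / \<kappa>)) * ((t + 2 / \<kappa>) / (1 + \<omega>\<^sup>2))"
          using C(1) K(1) d(1) \<kappa>_pos by (intro mult_left_mono) auto
      qed
      also have "C * e * (t + 1 / \<kappa>) = (C * (t + 1 / \<kappa>)) * e"
        by (simp only: mult_ac)
      also have "\<dots> = e0 / 2"
        unfolding e_def by (rule cancel[OF Ct])
      finally show ?thesis
        by (simp add: G_def matrix_vector_mult.scaleR_right)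
    qed
    have "\<forall>\<^sub>F \<omega> in at_top. (C * (K / d) * (2 / \<kappa>) * (t + 2 / \<kappa>)) / (1 + \<omega>\<^sup>2) < e0 / 2"
      using e0 by (intro order_tendstoD(2)[OF inverse_quadratic_tendsto_0]) simp
    then show "\<forall>\<^sub>F \<omega> in at_top. dist (\<omega>\<^sup>2 *\<^sub>R G (\<lambda>s. B *v (g s - g t)) \<omega> t) 0 < e0"
    proof eventually_elim
      case (elim \<omega>)
      then show ?case using bound[of \<omega>] unfolding dist_norm diff_0_right by linarith
    qed
  qed
  have "((\<lambda>\<omega>. \<omega>\<^sup>2 *\<^sub>R G (\<lambda>s. B *v (g s - g t)) \<omega> t + (g t - E \<omega> t *v g t + G (\<lambda>s. A *v g t) \<omega> t)) \<longlongrightarrow> 0 + (g t - 0 + 0)) at_top"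
    by (intro tendsto_intros rem_lim E_lim GA_lim)
  then show ?thesis
    unfolding split frozen by simp
qed

end

subsection \<open>The solution formula\<close>

lemma sin_int_0 [simp]: "sin_int h 0 = 0"
  by (simp add: sin_int_def)

lemma cos_transform_eq: "cos_transform f \<omega> = cos_int f \<omega>"
  by (simp add: cos_transform_def cos_int_def mult.commute)

lemma quad_decay_diff:
  assumes "quad_decay C f" "quad_decay D g"
  shows "quad_decay (C + D) (\<lambda>w. f w - g w)"
  using quad_decay_add[OF assms(1) quad_decay_scaleR[OF assms(2), of "- 1"]] by simp

locale heat_system = parabolic_matrices A B b for A B :: "real^2^2" and b +
  fixes f g :: "real \<Rightarrow> real^2"
  assumes f: "f absolutely_integrable_on {0..}" and g: "continuous_on {0..} g"
begin

abbreviation "c \<equiv> \<lambda>s. B *v g s"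

section \<open>The integral carrying the initial datum\<close>

definition V :: "real \<Rightarrow> real \<Rightarrow> real^2" where
  "V t \<omega> = E \<omega> t *v cos_int f \<omega>"

definition K :: real where "K = integral {0..} (\<lambda>y. norm (f y))"

lemma norm_cos_int_f: "norm (cos_int f \<omega>) \<le> K"
  unfolding K_def by (rule cos_int_bounded_continuous(1)[OF f])

lemma K_nonneg: "K \<ge> 0"
  using order_trans[OF norm_ge_zero norm_cos_int_f] .

lemma c_cont: "continuous_on {0..} c"
  by (intro matrix_vector_mult.continuous_on continuous_on_const g)

lemma integrand1_eq: "integrand1 A B f z t = (\<lambda>\<omega>. cos (\<omega> * z) *\<^sub>R V t \<omega>)"
  by (simp add: fun_eq_iff integrand1_def V_def E_def P_def cos_transform_eq)

lemma integrand2_eq: "integrand2 A B g z t = (\<lambda>\<omega>. cos (\<omega> * z) *\<^sub>R G c \<omega> t)"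
  by (simp add: fun_eq_iff integrand2_def G_def E_def P_def)

lemma u_sol_eq: "u_sol A B f g z t = (2 / pi) *\<^sub>R (cos_int (V t) z - cos_int (\<lambda>\<omega>. G c \<omega> t) z)"
  by (simp add: u_sol_def integrand1_eq integrand2_eq cos_int_def)

lemma V_cont: "continuous_on S (V t)"
  unfolding V_def[abs_def] by (intro matrix_vector_mult.continuous_on continuous_intros cos_int_bounded_continuous(2)[OF f])

lemma V_bound:
  assumes "0 < d" "d \<le> T"
  obtains D where "D \<ge> 0" "\<And>\<omega> t. d \<le> t \<Longrightarrow> t \<le> T \<Longrightarrow> (1 + \<omega>\<^sup>2) * norm (V t \<omega>) \<le> D / (1 + \<omega>\<^sup>2)"
proof -
  obtain D where D: "D \<ge> 0" "\<And>\<omega> t. d \<le> t \<Longrightarrow> t \<le> T \<Longrightarrow> norm (E \<omega> t) \<le> D / (1 + \<omega>\<^sup>2)\<^sup>2"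
    using E_gaussian_bounds[OF assms] by metis
  show ?thesis
  proof (rule that[of "D * K"])
    show "D * K \<ge> 0" using D(1) K_nonneg by simp
    fix \<omega> t assume t: "d \<le> t" "t \<le> T"
    have "norm (V t \<omega>) \<le> norm (E \<omega> t) * norm (cos_int f \<omega>)"
      unfolding V_def by (rule norm_matrix_vector_mult_le)
    also have "\<dots> \<le> (D / (1 + \<omega>\<^sup>2)\<^sup>2) * K"
      by (rule mult_mono[OF D(2)[OF t] norm_cos_int_f]) (use D(1) in auto)
    finally have "(1 + \<omega>\<^sup>2) * norm (V t \<omega>) \<le> (1 + \<omega>\<^sup>2) * ((D / (1 + \<omega>\<^sup>2)\<^sup>2) * K)"
      by (rule mult_left_mono) simp
    also have "\<dots> = D * K / (1 + \<omega>\<^sup>2)"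
      using one_plus_square_pos[of \<omega>] by (simp add: power2_eq_square[of "1 + \<omega>\<^sup>2"])
    finally show "(1 + \<omega>\<^sup>2) * norm (V t \<omega>) \<le> D * K / (1 + \<omega>\<^sup>2)" .
  qed
qed

text \<open>At a fixed positive time the Gaussian leaves room for two more powers of \<omega>
  besides quadratic decay, enough for two derivatives in z.\<close>

lemma V_weighted:
  assumes t: "t > 0"
  obtains D where "\<And>\<omega>. \<omega> \<ge> 0 \<Longrightarrow> (1 + \<omega>) * norm (V t \<omega>) \<le> D / (1 + \<omega>\<^sup>2)"
    "\<And>\<omega>. \<omega> \<ge> 0 \<Longrightarrow> (1 + \<omega>) * norm (\<omega> *\<^sub>R V t \<omega>) \<le> D / (1 + \<omega>\<^sup>2)"
    "quad_decay D (V t)" "quad_decay D (\<lambda>\<omega>. \<omega> *\<^sub>R V t \<omega>)" "quad_decay D (\<lambda>\<omega>. \<omega>\<^sup>2 *\<^sub>R V t \<omega>)"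
proof -
  obtain D where D: "D \<ge> 0" "\<And>\<omega>. (1 + \<omega>\<^sup>2) * norm (V t \<omega>) \<le> D / (1 + \<omega>\<^sup>2)"
    using V_bound[OF t order_refl] order_refl[of t] by metis
  have le: "q * norm (V t \<omega>) \<le> 2 * D / (1 + \<omega>\<^sup>2)" if "q \<le> 2 * (1 + \<omega>\<^sup>2)" for q \<omega>
  proof -
    have "q * norm (V t \<omega>) \<le> (2 * (1 + \<omega>\<^sup>2)) * norm (V t \<omega>)"
      by (rule mult_right_mono[OF that]) simp
    also have "\<dots> = 2 * ((1 + \<omega>\<^sup>2) * norm (V t \<omega>))"
      by (simp only: mult.assoc)
    also have "\<dots> \<le> 2 * (D / (1 + \<omega>\<^sup>2))"
      by (rule mult_left_mono[OF D(2)]) simp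
    finally show ?thesis by simp
  qed
  have w: "1 + \<omega> \<le> 2 * (1 + \<omega>\<^sup>2)" "\<omega> \<le> 2 * (1 + \<omega>\<^sup>2)" "1 \<le> 2 * (1 + \<omega>\<^sup>2)" "\<omega>\<^sup>2 \<le> 2 * (1 + \<omega>\<^sup>2)" for \<omega> :: real
  proof -
    have "0 \<le> (\<omega> - 1)\<^sup>2" by simp
    then have a: "2 * \<omega> \<le> 1 + \<omega>\<^sup>2" by (simp add: power2_diff)
    have b: "0 \<le> \<omega>\<^sup>2" by simp
    have eq: "2 * (1 + \<omega>\<^sup>2) = 2 + 2 * \<omega>\<^sup>2" by simp
    show "1 + \<omega> \<le> 2 * (1 + \<omega>\<^sup>2)" "\<omega> \<le> 2 * (1 + \<omega>\<^sup>2)" "1 \<le> 2 * (1 + \<omega>\<^sup>2)" "\<omega>\<^sup>2 \<le> 2 * (1 + \<omega>\<^sup>2)"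
      unfolding eq using a b by linarith+
  qed
  show ?thesis
  proof (rule that[of "2 * D"])
    show "quad_decay (2 * D) (V t)" "quad_decay (2 * D) (\<lambda>\<omega>. \<omega> *\<^sub>R V t \<omega>)" "quad_decay (2 * D) (\<lambda>\<omega>. \<omega>\<^sup>2 *\<^sub>R V t \<omega>)"
      unfolding quad_decay_def using le[OF w(3)] le[OF w(2)] le[OF w(4)]
      by (auto intro!: continuous_intros V_cont)
    fix \<omega> :: real assume "\<omega> \<ge> 0"
    then show "(1 + \<omega>) * norm (V t \<omega>) \<le> 2 * D / (1 + \<omega>\<^sup>2)"
      by (intro le w)
    have "(1 + \<omega>) * norm (\<omega> *\<^sub>R V t \<omega>) = ((1 + \<omega>) * \<omega>) * norm (V t \<omega>)"
      using \<open>\<omega> \<ge> 0\<close> by simp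
    also have "\<dots> \<le> 2 * D / (1 + \<omega>\<^sup>2)"
      by (intro le mult_le_one_plus_square)
    finally show "(1 + \<omega>) * norm (\<omega> *\<^sub>R V t \<omega>) \<le> 2 * D / (1 + \<omega>\<^sup>2)" .
  qed
qed

lemma cos_int_V_deriv:
  assumes t: "t > 0"
  shows "(cos_int (V t) has_vector_derivative - sin_int (\<lambda>\<omega>. \<omega> *\<^sub>R V t \<omega>) z) (at z within S)"
    "((\<lambda>z. - sin_int (\<lambda>\<omega>. \<omega> *\<^sub>R V t \<omega>) z) has_vector_derivative - cos_int (\<lambda>\<omega>. \<omega>\<^sup>2 *\<^sub>R V t \<omega>) z) (at z within S)"
proof -
  obtain D where D: "\<And>\<omega>. \<omega> \<ge> 0 \<Longrightarrow> (1 + \<omega>) * norm (V t \<omega>) \<le> D / (1 + \<omega>\<^sup>2)"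
    "\<And>\<omega>. \<omega> \<ge> 0 \<Longrightarrow> (1 + \<omega>) * norm (\<omega> *\<^sub>R V t \<omega>) \<le> D / (1 + \<omega>\<^sup>2)"
    using V_weighted[OF t] by metis
  show "(cos_int (V t) has_vector_derivative - sin_int (\<lambda>\<omega>. \<omega> *\<^sub>R V t \<omega>) z) (at z within S)"
    by (rule trig_int_deriv(1)[OF V_cont D(1)])
  have "continuous_on {0..} (\<lambda>\<omega>. \<omega> *\<^sub>R V t \<omega>)"
    by (intro continuous_intros V_cont)
  from trig_int_deriv(2)[OF this D(2)]
  have "(sin_int (\<lambda>\<omega>. \<omega> *\<^sub>R V t \<omega>) has_vector_derivative cos_int (\<lambda>\<omega>. \<omega> *\<^sub>R \<omega> *\<^sub>R V t \<omega>) z) (at z within S)" .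
  then have "(sin_int (\<lambda>\<omega>. \<omega> *\<^sub>R V t \<omega>) has_vector_derivative cos_int (\<lambda>\<omega>. \<omega>\<^sup>2 *\<^sub>R V t \<omega>) z) (at z within S)"
    by (simp add: power2_eq_square)
  then show "((\<lambda>z. - sin_int (\<lambda>\<omega>. \<omega> *\<^sub>R V t \<omega>) z) has_vector_derivative - cos_int (\<lambda>\<omega>. \<omega>\<^sup>2 *\<^sub>R V t \<omega>) z) (at z within S)"
    by (rule has_vector_derivative_minus)
qed

lemma norm_generator_le: "norm ((A - \<omega>\<^sup>2 *\<^sub>R B) *v x) \<le> (norm A + norm B) * ((1 + \<omega>\<^sup>2) * norm x)"
proof -
  have "norm ((A - \<omega>\<^sup>2 *\<^sub>R B) *v x) \<le> norm (A - \<omega>\<^sup>2 *\<^sub>R B) * norm x"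
    by (rule norm_matrix_vector_mult_le)
  also have "\<dots> \<le> ((norm A + norm B) * (1 + \<omega>\<^sup>2)) * norm x"
  proof (rule mult_right_mono)
    have "norm (A - \<omega>\<^sup>2 *\<^sub>R B) \<le> norm A + \<omega>\<^sup>2 * norm B"
      using norm_triangle_ineq4[of A "\<omega>\<^sup>2 *\<^sub>R B"] by simp
    also have "\<dots> \<le> (norm A + norm B) * (1 + \<omega>\<^sup>2)"
      by (simp add: algebra_simps)
    finally show "norm (A - \<omega>\<^sup>2 *\<^sub>R B) \<le> (norm A + norm B) * (1 + \<omega>\<^sup>2)" .
  qed simp
  finally show ?thesis by (simp only: mult.assoc)
qed

lemma cos_int_V_deriv_time:
  assumes t: "t > 0"
  shows "((\<lambda>t. cos_int (V t) z) has_vector_derivative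
      A *v cos_int (V t) z - B *v cos_int (\<lambda>\<omega>. \<omega>\<^sup>2 *\<^sub>R V t \<omega>) z) (at t)"
proof -
  \<comment> \<open>Staying away from time 0 gives a single Gaussian majorant, strong enough to
    absorb the factor \<omega>^2 of the generator.\<close>
  let ?U = "{t / 2<..<2 * t}"
  have "t / 2 > 0" "t / 2 \<le> 2 * t" using t by auto
  then obtain D where D: "D \<ge> 0" "\<And>\<omega> r. t / 2 \<le> r \<Longrightarrow> r \<le> 2 * t \<Longrightarrow> (1 + \<omega>\<^sup>2) * norm (V r \<omega>) \<le> D / (1 + \<omega>\<^sup>2)"
    using V_bound by metis
  have int: "(\<lambda>\<omega>. cos (\<omega> * z) *\<^sub>R V r \<omega>) integrable_on {0..}" if r: "r > 0" for r
  proof -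
    obtain D where "quad_decay D (V r)" using V_weighted[OF r] by metis
    then show ?thesis by (rule quad_decay_trig_integrable)
  qed
  have "((\<lambda>t. integral {0..} (\<lambda>\<omega>. cos (\<omega> * z) *\<^sub>R V t \<omega>)) has_vector_derivative
      integral {0..} (\<lambda>\<omega>. cos (\<omega> * z) *\<^sub>R ((A - \<omega>\<^sup>2 *\<^sub>R B) *v V t \<omega>))) (at t within ?U)"
  proof (rule has_vector_derivative_integral_dominated[OF _ _ _ inverse_quadratic_integrable[of "(norm A + norm B) * D"]])
    fix r \<omega> :: real assume r: "r \<in> ?U"
    show "((\<lambda>t. cos (\<omega> * z) *\<^sub>R V t \<omega>) has_vector_derivative cos (\<omega> * z) *\<^sub>R ((A - \<omega>\<^sup>2 *\<^sub>R B) *v V r \<omega>)) (at r within ?U)"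
      unfolding V_def matrix_vector_mul_assoc
      by (rule bounded_linear.has_vector_derivative[OF bounded_linear_scaleR_right
            bounded_linear.has_vector_derivative[OF matrix_vector_mult.bounded_linear_left E_deriv_time]])
    have "norm (cos (\<omega> * z) *\<^sub>R ((A - \<omega>\<^sup>2 *\<^sub>R B) *v V r \<omega>)) \<le> norm ((A - \<omega>\<^sup>2 *\<^sub>R B) *v V r \<omega>)"
      by (simp add: mult_left_le_one_le)
    also have "\<dots> \<le> (norm A + norm B) * ((1 + \<omega>\<^sup>2) * norm (V r \<omega>))"
      by (rule norm_generator_le)
    also have "\<dots> \<le> (norm A + norm B) * (D / (1 + \<omega>\<^sup>2))"
      by (rule mult_left_mono[OF D(2)]) (use r in auto)
    finally show "norm (cos (\<omega> * z) *\<^sub>R ((A - \<omega>\<^sup>2 *\<^sub>R B) *v V r \<omega>)) \<le> (norm A + norm B) * D / (1 + \<omega>\<^sup>2)"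
      by simp
  next
    fix r assume "r \<in> ?U"
    then show "(\<lambda>\<omega>. cos (\<omega> * z) *\<^sub>R V r \<omega>) integrable_on {0..}" using t by (intro int) auto
  qed (use t in auto)
  then have d: "((\<lambda>t. cos_int (V t) z) has_vector_derivative cos_int (\<lambda>\<omega>. (A - \<omega>\<^sup>2 *\<^sub>R B) *v V t \<omega>) z) (at t)"
    unfolding cos_int_def using t by (subst (asm) at_within_open) auto
  obtain D' where D': "quad_decay D' (V t)" "quad_decay D' (\<lambda>\<omega>. \<omega>\<^sup>2 *\<^sub>R V t \<omega>)"
    using V_weighted[OF t] by metis
  have "cos_int (\<lambda>\<omega>. (A - \<omega>\<^sup>2 *\<^sub>R B) *v V t \<omega>) z = cos_int (\<lambda>\<omega>. A *v V t \<omega> - B *v (\<omega>\<^sup>2 *\<^sub>R V t \<omega>)) z"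
    by (simp add: matrix_vector_mult.diff_left matrix_vector_mult.scaleR_left matrix_vector_mult.scaleR_right)
  also have "\<dots> = A *v cos_int (V t) z - B *v cos_int (\<lambda>\<omega>. \<omega>\<^sup>2 *\<^sub>R V t \<omega>) z"
    by (simp only: cos_int_linear(3)[OF quad_decay_matrix[OF D'(1)] quad_decay_matrix[OF D'(2)]]
        cos_int_matrix[OF D'(1)] cos_int_matrix[OF D'(2)])
  finally show ?thesis using d by simp
qed

section \<open>The integral carrying the boundary datum\<close>

lemma G_profile:
  assumes t: "t > 0"
  obtains C where "decaying_profile (\<lambda>\<omega>. G c \<omega> t) (\<lambda>\<omega>. G' c \<omega> t) (\<lambda>\<omega>. G'' c \<omega> t) C"
proof -
  have T: "0 \<le> t" "t \<le> t" using t by auto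
  obtain C where C: "C \<ge> 0"
    "\<And>\<omega> r. 0 \<le> r \<Longrightarrow> r \<le> t \<Longrightarrow> norm (G c \<omega> r) \<le> C / (1 + \<omega>\<^sup>2)"
    "\<And>\<omega> r. 0 \<le> r \<Longrightarrow> r \<le> t \<Longrightarrow> (1 + \<bar>\<omega>\<bar>) * norm (G' c \<omega> r) \<le> C / (1 + \<omega>\<^sup>2)"
    "\<And>\<omega> r. 0 \<le> r \<Longrightarrow> r \<le> t \<Longrightarrow> (1 + \<omega>\<^sup>2) * norm (G'' c \<omega> r) \<le> C / (1 + \<omega>\<^sup>2)"
    using G_bounds[OF c_cont T(1)] by metis
  show ?thesis
    by (rule that[of C], unfold_locales)
      (intro G_deriv_freq[OF c_cont T(1)] G'_deriv_freq[OF c_cont T(1)] continuous_on_G(3)[OF c_cont T(1)] G'_0 C(1)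
        C(2)[OF T] C(3)[OF T] C(4)[OF T])+
qed

text \<open>Differentiation takes place in the reduced form with \<open>G''\<close> and the factor
  -1 / z^2. In the equation of \<open>G''\<close> the terms with \<omega>^2 G'', \<omega> G' and G
  are exactly those of the second z-derivative from \<open>cos_int_d2_def\<close>, so the
  differential equation results without touching the divergent formal integral.\<close>

lemma cos_int_G_deriv_time:
  assumes t: "t > 0" and z: "z > 0"
  shows "((\<lambda>t. cos_int (\<lambda>\<omega>. G c \<omega> t) z) has_vector_derivative
      A *v cos_int (\<lambda>\<omega>. G c \<omega> t) z + B *v ((1 / z\<^sup>2) *\<^sub>R (cos_int (\<lambda>\<omega>. \<omega>\<^sup>2 *\<^sub>R G'' c \<omega> t) z
        + 4 *\<^sub>R cos_int (\<lambda>\<omega>. \<omega> *\<^sub>R G' c \<omega> t) z + 2 *\<^sub>R cos_int (\<lambda>\<omega>. G c \<omega> t) z))) (at t)"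
proof -
  let ?U = "{0<..<2 * t}"
  have T: "2 * t \<ge> 0" using t by simp
  obtain C where C: "C \<ge> 0"
    "\<And>\<omega> r. 0 \<le> r \<Longrightarrow> r \<le> 2 * t \<Longrightarrow> norm (G c \<omega> r) \<le> C / (1 + \<omega>\<^sup>2)"
    "\<And>\<omega> r. 0 \<le> r \<Longrightarrow> r \<le> 2 * t \<Longrightarrow> (1 + \<bar>\<omega>\<bar>) * norm (G' c \<omega> r) \<le> C / (1 + \<omega>\<^sup>2)"
    "\<And>\<omega> r. 0 \<le> r \<Longrightarrow> r \<le> 2 * t \<Longrightarrow> (1 + \<omega>\<^sup>2) * norm (G'' c \<omega> r) \<le> C / (1 + \<omega>\<^sup>2)"
    using G_bounds[OF c_cont T] by metis
  let ?D = "\<lambda>r \<omega>. (A - \<omega>\<^sup>2 *\<^sub>R B) *v G'' c \<omega> r - 2 *\<^sub>R (B *v G c \<omega> r) - (4 * \<omega>) *\<^sub>R (B *v G' c \<omega> r)"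
  define M where "M = (norm A + norm B) * C + 2 * (norm B * C) + 4 * (norm B * C)"
  have D_le: "norm (?D r \<omega>) \<le> M / (1 + \<omega>\<^sup>2)" if r: "0 \<le> r" "r \<le> 2 * t" for r \<omega>
  proof -
    have "norm ((A - \<omega>\<^sup>2 *\<^sub>R B) *v G'' c \<omega> r) \<le> (norm A + norm B) * ((1 + \<omega>\<^sup>2) * norm (G'' c \<omega> r))"
      by (rule norm_generator_le)
    also have "\<dots> \<le> (norm A + norm B) * (C / (1 + \<omega>\<^sup>2))"
      by (rule mult_left_mono[OF C(4)[OF r]]) simp
    finally have 1: "norm ((A - \<omega>\<^sup>2 *\<^sub>R B) *v G'' c \<omega> r) \<le> (norm A + norm B) * (C / (1 + \<omega>\<^sup>2))" .
    have "norm (B *v G c \<omega> r) \<le> norm B * (C / (1 + \<omega>\<^sup>2))"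
      by (rule order_trans[OF norm_matrix_vector_mult_le mult_left_mono[OF C(2)[OF r]]]) simp
    then have 2: "norm (2 *\<^sub>R (B *v G c \<omega> r)) \<le> 2 * (norm B * (C / (1 + \<omega>\<^sup>2)))"
      by simp
    have "\<bar>\<omega>\<bar> * norm (G' c \<omega> r) \<le> (1 + \<bar>\<omega>\<bar>) * norm (G' c \<omega> r)"
      by (intro mult_right_mono) auto
    with C(3)[OF r, of \<omega>] have "\<bar>\<omega>\<bar> * norm (G' c \<omega> r) \<le> C / (1 + \<omega>\<^sup>2)"
      by linarith
    then have "norm B * (\<bar>\<omega>\<bar> * norm (G' c \<omega> r)) \<le> norm B * (C / (1 + \<omega>\<^sup>2))"
      by (rule mult_left_mono) simp
    moreover have "norm ((4 * \<omega>) *\<^sub>R (B *v G' c \<omega> r)) \<le> 4 * (norm B * (\<bar>\<omega>\<bar> * norm (G' c \<omega> r)))"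
      using mult_left_mono[OF norm_matrix_vector_mult_le[of B "G' c \<omega> r"], of "4 * \<bar>\<omega>\<bar>"] by (simp add: abs_mult mult_ac)
    ultimately have 3: "norm ((4 * \<omega>) *\<^sub>R (B *v G' c \<omega> r)) \<le> 4 * (norm B * (C / (1 + \<omega>\<^sup>2)))"
      by linarith
    have "norm (?D r \<omega>) \<le> (norm A + norm B) * (C / (1 + \<omega>\<^sup>2)) + 2 * (norm B * (C / (1 + \<omega>\<^sup>2))) + 4 * (norm B * (C / (1 + \<omega>\<^sup>2)))"
      by (rule order_trans[OF norm_triangle_ineq4 add_mono[OF order_trans[OF norm_triangle_ineq4 add_mono[OF 1 2]] 3]])
    also have "\<dots> = M / (1 + \<omega>\<^sup>2)"
      by (simp add: M_def add_divide_distrib)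
    finally show ?thesis .
  qed
  have int: "(\<lambda>\<omega>. cos (\<omega> * z) *\<^sub>R G'' c \<omega> r) integrable_on {0..}" if r: "r > 0" for r
  proof -
    obtain C where "decaying_profile (\<lambda>\<omega>. G c \<omega> r) (\<lambda>\<omega>. G' c \<omega> r) (\<lambda>\<omega>. G'' c \<omega> r) C"
      using G_profile[OF r] .
    then interpret decaying_profile "\<lambda>\<omega>. G c \<omega> r" "\<lambda>\<omega>. G' c \<omega> r" "\<lambda>\<omega>. G'' c \<omega> r" C .
    show ?thesis by (rule quad_decay_trig_integrable(1)[OF profile_decay(3)])
  qed
  have "((\<lambda>t. integral {0..} (\<lambda>\<omega>. cos (\<omega> * z) *\<^sub>R G'' c \<omega> t)) has_vector_derivative
      integral {0..} (\<lambda>\<omega>. cos (\<omega> * z) *\<^sub>R ?D t \<omega>)) (at t within ?U)"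
  proof (rule has_vector_derivative_integral_dominated[OF _ _ _ inverse_quadratic_integrable[of M]])
    fix r \<omega> :: real assume r: "r \<in> ?U"
    have "(G'' c \<omega> has_vector_derivative ?D r \<omega>) (at r within ?U)"
      by (rule has_vector_derivative_within_subset[OF G''_deriv_time[OF c_cont]]) (use r in auto)
    then show "((\<lambda>t. cos (\<omega> * z) *\<^sub>R G'' c \<omega> t) has_vector_derivative cos (\<omega> * z) *\<^sub>R ?D r \<omega>) (at r within ?U)"
      by (rule bounded_linear.has_vector_derivative[OF bounded_linear_scaleR_right])
    have "norm (cos (\<omega> * z) *\<^sub>R ?D r \<omega>) \<le> norm (?D r \<omega>)"
      by (simp add: mult_left_le_one_le)
    also have "\<dots> \<le> M / (1 + \<omega>\<^sup>2)"
      by (rule D_le) (use r in auto)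
    finally show "norm (cos (\<omega> * z) *\<^sub>R ?D r \<omega>) \<le> M / (1 + \<omega>\<^sup>2)" .
  next
    fix r assume "r \<in> ?U"
    then show "(\<lambda>\<omega>. cos (\<omega> * z) *\<^sub>R G'' c \<omega> r) integrable_on {0..}" by (intro int) auto
  qed (use t in auto)
  then have d0: "((\<lambda>t. cos_int (\<lambda>\<omega>. G'' c \<omega> t) z) has_vector_derivative cos_int (?D t) z) (at t)"
    unfolding cos_int_def using t by (subst (asm) at_within_open) auto
  have d1: "((\<lambda>t. - (1 / z\<^sup>2) *\<^sub>R cos_int (\<lambda>\<omega>. G'' c \<omega> t) z) has_vector_derivative - (1 / z\<^sup>2) *\<^sub>R cos_int (?D t) z) (at t)"
    by (rule bounded_linear.has_vector_derivative[OF bounded_linear_scaleR_right d0])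
  have red: "cos_int (\<lambda>\<omega>. G c \<omega> r) z = - (1 / z\<^sup>2) *\<^sub>R cos_int (\<lambda>\<omega>. G'' c \<omega> r) z" if r: "r > 0" for r
  proof -
    obtain C where "decaying_profile (\<lambda>\<omega>. G c \<omega> r) (\<lambda>\<omega>. G' c \<omega> r) (\<lambda>\<omega>. G'' c \<omega> r) C"
      using G_profile[OF r] .
    then interpret decaying_profile "\<lambda>\<omega>. G c \<omega> r" "\<lambda>\<omega>. G' c \<omega> r" "\<lambda>\<omega>. G'' c \<omega> r" C .
    show ?thesis by (rule cos_int_profile) (use z in simp)
  qed
  have d2: "((\<lambda>t. cos_int (\<lambda>\<omega>. G c \<omega> t) z) has_vector_derivative - (1 / z\<^sup>2) *\<^sub>R cos_int (?D t) z) (at t)"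
    by (rule has_vector_derivative_transform_within_open[OF d1, where S = "{0<..}"]) (use t red in auto)
  obtain C where "decaying_profile (\<lambda>\<omega>. G c \<omega> t) (\<lambda>\<omega>. G' c \<omega> t) (\<lambda>\<omega>. G'' c \<omega> t) C"
    using G_profile[OF t] .
  then interpret decaying_profile "\<lambda>\<omega>. G c \<omega> t" "\<lambda>\<omega>. G' c \<omega> t" "\<lambda>\<omega>. G'' c \<omega> t" C .
  note q = profile_decay
  let ?a = "cos_int (\<lambda>\<omega>. G'' c \<omega> t) z" and ?b = "cos_int (\<lambda>\<omega>. \<omega>\<^sup>2 *\<^sub>R G'' c \<omega> t) z"
    and ?c = "cos_int (\<lambda>\<omega>. \<omega> *\<^sub>R G' c \<omega> t) z" and ?d = "cos_int (\<lambda>\<omega>. G c \<omega> t) z"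
  have D_expand: "?D t = (\<lambda>\<omega>. ((A *v G'' c \<omega> t - B *v (\<omega>\<^sup>2 *\<^sub>R G'' c \<omega> t)) - 2 *\<^sub>R (B *v G c \<omega> t)) - 4 *\<^sub>R (B *v (\<omega> *\<^sub>R G' c \<omega> t)))"
    by (simp add: fun_eq_iff matrix_vector_mult.diff_left matrix_vector_mult.scaleR_left matrix_vector_mult.scaleR_right)
  have D_eq: "cos_int (?D t) z = A *v ?a - B *v ?b - 2 *\<^sub>R (B *v ?d) - 4 *\<^sub>R (B *v ?c)"
    unfolding D_expand
  proof -
    note m = quad_decay_matrix[OF q(3), of A] quad_decay_matrix[OF q(6), of B]
      quad_decay_scaleR[OF quad_decay_matrix[OF q(1), of B], of 2]
      quad_decay_scaleR[OF quad_decay_matrix[OF q(4), of B], of 4]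
    let ?h1 = "\<lambda>\<omega>. A *v G'' c \<omega> t" and ?h2 = "\<lambda>\<omega>. B *v (\<omega>\<^sup>2 *\<^sub>R G'' c \<omega> t)"
      and ?h3 = "\<lambda>\<omega>. 2 *\<^sub>R (B *v G c \<omega> t)" and ?h4 = "\<lambda>\<omega>. 4 *\<^sub>R (B *v (\<omega> *\<^sub>R G' c \<omega> t))"
    have "cos_int (\<lambda>\<omega>. ((?h1 \<omega> - ?h2 \<omega>) - ?h3 \<omega>) - ?h4 \<omega>) z = cos_int (\<lambda>\<omega>. (?h1 \<omega> - ?h2 \<omega>) - ?h3 \<omega>) z - cos_int ?h4 z"
      by (rule cos_int_linear(3)[OF quad_decay_diff[OF quad_decay_diff[OF m(1) m(2)] m(3)] m(4)])
    moreover have "cos_int (\<lambda>\<omega>. (?h1 \<omega> - ?h2 \<omega>) - ?h3 \<omega>) z = cos_int (\<lambda>\<omega>. ?h1 \<omega> - ?h2 \<omega>) z - cos_int ?h3 z"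
      by (rule cos_int_linear(3)[OF quad_decay_diff[OF m(1) m(2)] m(3)])
    moreover have "cos_int (\<lambda>\<omega>. ?h1 \<omega> - ?h2 \<omega>) z = cos_int ?h1 z - cos_int ?h2 z"
      by (rule cos_int_linear(3)[OF m(1) m(2)])
    moreover have "cos_int ?h1 z = A *v ?a"
      by (rule cos_int_matrix[OF q(3)])
    moreover have "cos_int ?h2 z = B *v ?b"
      by (rule cos_int_matrix[OF q(6)])
    moreover have "cos_int ?h3 z = 2 *\<^sub>R (B *v ?d)"
      unfolding cos_int_matrix[OF q(1), symmetric] by (rule cos_int_scaleR)
    moreover have "cos_int ?h4 z = 4 *\<^sub>R (B *v ?c)"
      unfolding cos_int_matrix[OF q(4), symmetric] by (rule cos_int_scaleR)
    ultimately show "cos_int (\<lambda>\<omega>. ((?h1 \<omega> - ?h2 \<omega>) - ?h3 \<omega>) - ?h4 \<omega>) z = A *v ?a - B *v ?b - 2 *\<^sub>R (B *v ?d) - 4 *\<^sub>R (B *v ?c)"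
      by (simp only:)
  qed
  have Ad: "A *v ?d = - ((1 / z\<^sup>2) *\<^sub>R (A *v ?a))"
    unfolding red[OF t] by (simp add: matrix_vector_mult.scaleR_right matrix_vector_mult.minus_right)
  have "- (1 / z\<^sup>2) *\<^sub>R cos_int (?D t) z = A *v ?d + B *v ((1 / z\<^sup>2) *\<^sub>R (?b + 4 *\<^sub>R ?c + 2 *\<^sub>R ?d))"
    unfolding D_eq Ad
    by (simp add: matrix_vector_mult.scaleR_right matrix_vector_mult.add_right scaleR_diff_right scaleR_add_right)
  with d2 show ?thesis by simp
qed

lemma integrands_integrable:
  assumes t: "t > 0"
  shows "integrand1 A B f z t integrable_on {0..}" "integrand2 A B g z t integrable_on {0..}"
proof -
  obtain D where "quad_decay D (V t)" using V_weighted[OF t] by metis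
  then show "integrand1 A B f z t integrable_on {0..}"
    unfolding integrand1_eq by (rule quad_decay_trig_integrable)
  obtain C where "decaying_profile (\<lambda>\<omega>. G c \<omega> t) (\<lambda>\<omega>. G' c \<omega> t) (\<lambda>\<omega>. G'' c \<omega> t) C"
    using G_profile[OF t] .
  then interpret decaying_profile "\<lambda>\<omega>. G c \<omega> t" "\<lambda>\<omega>. G' c \<omega> t" "\<lambda>\<omega>. G'' c \<omega> t" C .
  show "integrand2 A B g z t integrable_on {0..}"
    unfolding integrand2_eq by (rule quad_decay_trig_integrable[OF profile_decay(1)])
qed

text \<open>These are \<open>cos_int_d1\<close> and, in the next definition,
  \<open>cos_int_d2\<close> for the profile at time t. They are spelled out because the profile
  locale can be instantiated only inside proofs, for one t at a time.\<close>

definition G_z :: "real \<Rightarrow> real \<Rightarrow> real^2" where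
  "G_z z t = (1 / z\<^sup>2) *\<^sub>R sin_int (\<lambda>\<omega>. \<omega> *\<^sub>R G'' c \<omega> t) z + (2 / z ^ 3) *\<^sub>R cos_int (\<lambda>\<omega>. G'' c \<omega> t) z"

definition G_zz :: "real \<Rightarrow> real \<Rightarrow> real^2" where
  "G_zz z t = (1 / z\<^sup>2) *\<^sub>R (cos_int (\<lambda>\<omega>. \<omega>\<^sup>2 *\<^sub>R G'' c \<omega> t) z
     + 4 *\<^sub>R cos_int (\<lambda>\<omega>. \<omega> *\<^sub>R G' c \<omega> t) z + 2 *\<^sub>R cos_int (\<lambda>\<omega>. G c \<omega> t) z)"

lemma cos_int_G_deriv:
  assumes t: "t > 0"
  shows "z > 0 \<Longrightarrow> (cos_int (\<lambda>\<omega>. G c \<omega> t) has_vector_derivative G_z z t) (at z)"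
    "z > 0 \<Longrightarrow> ((\<lambda>z. G_z z t) has_vector_derivative G_zz z t) (at z)"
    "(cos_int (\<lambda>\<omega>. G c \<omega> t) \<longlongrightarrow> 0) at_top" "((\<lambda>z. G_z z t) \<longlongrightarrow> 0) at_top"
proof -
  obtain C where "decaying_profile (\<lambda>\<omega>. G c \<omega> t) (\<lambda>\<omega>. G' c \<omega> t) (\<lambda>\<omega>. G'' c \<omega> t) C"
    using G_profile[OF t] .
  then interpret decaying_profile "\<lambda>\<omega>. G c \<omega> t" "\<lambda>\<omega>. G' c \<omega> t" "\<lambda>\<omega>. G'' c \<omega> t" C .
  have d1: "cos_int_d1 = (\<lambda>z. G_z z t)" and d2: "cos_int_d2 = (\<lambda>z. G_zz z t)"
    by (simp_all add: fun_eq_iff G_z_def G_zz_def cos_int_d1_def cos_int_d2_def)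
  show "z > 0 \<Longrightarrow> (cos_int (\<lambda>\<omega>. G c \<omega> t) has_vector_derivative G_z z t) (at z)"
    using cos_int_deriv1 unfolding d1 .
  show "z > 0 \<Longrightarrow> ((\<lambda>z. G_z z t) has_vector_derivative G_zz z t) (at z)"
    using cos_int_deriv2 unfolding d1 d2 .
  show "(cos_int (\<lambda>\<omega>. G c \<omega> t) \<longlongrightarrow> 0) at_top"
    by (rule trig_int_tendsto_0(1)[OF profile_decay(1)])
  show "((\<lambda>z. G_z z t) \<longlongrightarrow> 0) at_top"
    using cos_int_d1_tendsto_0 unfolding d1 .
qed

section \<open>Assembling the solution: equation, boundary and initial values, truncation\<close>

definition u_z :: "real \<Rightarrow> real \<Rightarrow> real^2" where
  "u_z z t = (2 / pi) *\<^sub>R (- sin_int (\<lambda>\<omega>. \<omega> *\<^sub>R V t \<omega>) z - G_z z t)"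

definition u_zz :: "real \<Rightarrow> real \<Rightarrow> real^2" where
  "u_zz z t = (2 / pi) *\<^sub>R (- cos_int (\<lambda>\<omega>. \<omega>\<^sup>2 *\<^sub>R V t \<omega>) z - G_zz z t)"

lemma u_sol_derivs:
  assumes "z > 0" "t > 0"
  shows "((\<lambda>t. u_sol A B f g z t) has_vector_derivative A *v u_sol A B f g z t + B *v u_zz z t) (at t)"
    "((\<lambda>z. u_sol A B f g z t) has_vector_derivative u_z z t) (at z)"
    "((\<lambda>z. u_z z t) has_vector_derivative u_zz z t) (at z)"
proof -
  have "((\<lambda>t. u_sol A B f g z t) has_vector_derivative
      (2 / pi) *\<^sub>R ((A *v cos_int (V t) z - B *v cos_int (\<lambda>\<omega>. \<omega>\<^sup>2 *\<^sub>R V t \<omega>) z)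
        - (A *v cos_int (\<lambda>\<omega>. G c \<omega> t) z + B *v G_zz z t))) (at t)"
    unfolding u_sol_eq G_zz_def
    by (intro bounded_linear.has_vector_derivative[OF bounded_linear_scaleR_right] has_vector_derivative_diff
        cos_int_V_deriv_time cos_int_G_deriv_time assms)
  then show "((\<lambda>t. u_sol A B f g z t) has_vector_derivative A *v u_sol A B f g z t + B *v u_zz z t) (at t)"
    by (rule has_vector_derivative_eq_rhs)
      (simp add: u_sol_eq u_zz_def matrix_vector_mult.scaleR_right matrix_vector_mult.diff_right
        matrix_vector_mult.minus_right scaleR_diff_right scaleR_add_right)
  show "((\<lambda>z. u_sol A B f g z t) has_vector_derivative u_z z t) (at z)"
    unfolding u_sol_eq u_z_def
    by (intro bounded_linear.has_vector_derivative[OF bounded_linear_scaleR_right] has_vector_derivative_diff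
        cos_int_V_deriv cos_int_G_deriv assms)
  show "((\<lambda>z. u_z z t) has_vector_derivative u_zz z t) (at z)"
    unfolding u_z_def u_zz_def
    by (intro bounded_linear.has_vector_derivative[OF bounded_linear_scaleR_right] has_vector_derivative_diff
        cos_int_V_deriv cos_int_G_deriv assms)
qed

lemma u_sol_at_infinity:
  assumes t: "t > 0"
  shows "((\<lambda>z. u_sol A B f g z t) \<longlongrightarrow> 0) at_top" "((\<lambda>z. u_z z t) \<longlongrightarrow> 0) at_top"
proof -
  obtain D where D: "quad_decay D (V t)" "quad_decay D (\<lambda>\<omega>. \<omega> *\<^sub>R V t \<omega>)"
    using V_weighted[OF t] by metis
  have "((\<lambda>z. (2 / pi) *\<^sub>R (cos_int (V t) z - cos_int (\<lambda>\<omega>. G c \<omega> t) z)) \<longlongrightarrow> (2 / pi) *\<^sub>R (0 - 0)) at_top"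
    by (intro tendsto_scaleR tendsto_const tendsto_diff trig_int_tendsto_0(1)[OF D(1)] cos_int_G_deriv(3)[OF t])
  then show "((\<lambda>z. u_sol A B f g z t) \<longlongrightarrow> 0) at_top"
    by (simp add: u_sol_eq)
  have "((\<lambda>z. (2 / pi) *\<^sub>R (- sin_int (\<lambda>\<omega>. \<omega> *\<^sub>R V t \<omega>) z - G_z z t)) \<longlongrightarrow> (2 / pi) *\<^sub>R (- 0 - 0)) at_top"
    by (intro tendsto_scaleR tendsto_const tendsto_diff tendsto_minus trig_int_tendsto_0(2)[OF D(2)] cos_int_G_deriv(4)[OF t])
  then show "((\<lambda>z. u_z z t) \<longlongrightarrow> 0) at_top"
    by (simp add: u_z_def)
qed

text \<open>The difference quotient at \<open>z = 0\<close> is a Fejer mean of \<open>\<omega>\<^sup>2 G(\<omega>, t)\<close>, so it picks out the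
  limit of that function for large \<open>\<omega>\<close>.\<close>

lemma cos_int_G_boundary:
  assumes t: "t > 0"
  shows "(cos_int (\<lambda>\<omega>. G c \<omega> t) has_vector_derivative - ((pi / 2) *\<^sub>R g t)) (at 0 within {0..})"
proof -
  obtain C where "decaying_profile (\<lambda>\<omega>. G c \<omega> t) (\<lambda>\<omega>. G' c \<omega> t) (\<lambda>\<omega>. G'' c \<omega> t) C"
    using G_profile[OF t] .
  then interpret decaying_profile "\<lambda>\<omega>. G c \<omega> t" "\<lambda>\<omega>. G' c \<omega> t" "\<lambda>\<omega>. G'' c \<omega> t" C .
  note int = quad_decay_trig_integrable(1)[OF profile_decay(1)]
  let ?k = "\<lambda>\<omega>. \<omega>\<^sup>2 *\<^sub>R G c \<omega> t"
  define q where "q = (\<lambda>z. if z = 0 then - ((pi / 2) *\<^sub>R g t) else - integral {0..} (\<lambda>\<omega>. fejer z \<omega> *\<^sub>R ?k \<omega>))"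
  have lim: "((\<lambda>z. integral {0..} (\<lambda>\<omega>. fejer z \<omega> *\<^sub>R ?k \<omega>)) \<longlongrightarrow> (pi / 2) *\<^sub>R g t) (at_right 0)"
  proof (rule fejer_concentrates)
    show "continuous_on {0..} ?k"
      by (intro continuous_intros continuous_profile)
    fix \<omega> :: real
    have "norm (?k \<omega>) \<le> \<omega>\<^sup>2 * (C / (1 + \<omega>\<^sup>2))"
      using mult_left_mono[OF H_le[of \<omega>], of "\<omega>\<^sup>2"] by simp
    also have "\<dots> \<le> (1 + \<omega>\<^sup>2) * (C / (1 + \<omega>\<^sup>2))"
      using C by (intro mult_right_mono) auto
    also have "\<dots> = C"
      using less_imp_neq[OF one_plus_square_pos[of \<omega>]] by simp
    finally show "norm (?k \<omega>) \<le> C" .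
  next
    show "(?k \<longlongrightarrow> g t) at_top"
      by (rule G_asymptotics[OF g t])
  qed
  have "(cos_int (\<lambda>\<omega>. G c \<omega> t) has_vector_derivative q 0) (at 0 within {0..})"
  proof (rule has_vector_derivative_caratheodory)
    fix z :: real assume z: "z \<in> {0..}"
    show "cos_int (\<lambda>\<omega>. G c \<omega> t) z - cos_int (\<lambda>\<omega>. G c \<omega> t) 0 = (z - 0) *\<^sub>R q z"
    proof (cases "z = 0")
      case False
      have pt: "cos (\<omega> * z) *\<^sub>R G c \<omega> t - cos (\<omega> * 0) *\<^sub>R G c \<omega> t = (- z) *\<^sub>R (fejer z \<omega> *\<^sub>R ?k \<omega>)" for \<omega>
      proof -
        have "cos (\<omega> * z) - 1 = - z * (fejer z \<omega> * \<omega>\<^sup>2)"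
          using False by (cases "\<omega> = 0") (simp_all add: fejer_def mult.commute)
        then have "(cos (\<omega> * z) - 1) *\<^sub>R G c \<omega> t = (- z) *\<^sub>R (fejer z \<omega> *\<^sub>R ?k \<omega>)"
          by simp
        then show ?thesis by (simp add: scaleR_diff_left)
      qed
      have "cos_int (\<lambda>\<omega>. G c \<omega> t) z - cos_int (\<lambda>\<omega>. G c \<omega> t) 0 =
          integral {0..} (\<lambda>\<omega>. cos (\<omega> * z) *\<^sub>R G c \<omega> t - cos (\<omega> * 0) *\<^sub>R G c \<omega> t)"
        unfolding cos_int_def by (rule integral_diff[OF int int, symmetric])
      also have "\<dots> = (- z) *\<^sub>R integral {0..} (\<lambda>\<omega>. fejer z \<omega> *\<^sub>R ?k \<omega>)"
        unfolding pt by (rule integral_cmul)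
      finally show ?thesis using False by (simp add: q_def)
    qed simp
  next
    have "((\<lambda>z. - integral {0..} (\<lambda>\<omega>. fejer z \<omega> *\<^sub>R ?k \<omega>)) \<longlongrightarrow> q 0) (at 0 within {0..})"
      using tendsto_minus[OF lim] by (simp add: q_def at_within_Ici_at_right)
    then show "(q \<longlongrightarrow> q 0) (at 0 within {0..})"
      by (rule Lim_transform_eventually) (simp add: eventually_at_filter q_def)
  qed
  then show ?thesis by (simp add: q_def)
qed

text \<open>The part from the initial datum is smooth up to z = 0, and its slope there is a sine
  transform at 0, hence zero. The entire slope comes from \<open>cos_int_G_boundary\<close>.\<close>

lemma u_sol_boundary:
  assumes t: "t > 0"
  shows "((\<lambda>z. u_sol A B f g z t) has_vector_derivative g t) (at 0 within {0..})"
proof -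
  have "((\<lambda>z. u_sol A B f g z t) has_vector_derivative
      (2 / pi) *\<^sub>R (- sin_int (\<lambda>\<omega>. \<omega> *\<^sub>R V t \<omega>) 0 - - ((pi / 2) *\<^sub>R g t))) (at 0 within {0..})"
    unfolding u_sol_eq
    by (intro bounded_linear.has_vector_derivative[OF bounded_linear_scaleR_right] has_vector_derivative_diff
        cos_int_V_deriv(1) cos_int_G_boundary t)
  then show ?thesis by simp
qed

lemma inverse_cosine_integrand_continuous: "continuous_on S (\<lambda>\<omega>. cos (\<omega> * z) *\<^sub>R cos_int f \<omega>)"
  by (intro continuous_intros cos_int_bounded_continuous(2)[OF f])

text \<open>The cosine factor is moved onto the transform of \<open>f\<close>, so that
  \<open>gaussian_summation\<close> applies to the integrand of the inverse cosine integral. The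
  boundary part tends to 0 by dominated convergence, since G(\<omega>, 0) is an integral over a
  point and the bounds of \<open>G\<close> are uniform down to time 0.\<close>

lemma u_sol_initial:
  assumes z: "z > 0" and lp: "lebesgue_point f z"
  shows "((\<lambda>t. u_sol A B f g z t) \<longlongrightarrow> f z) (at_right 0)"
proof -
  have "((\<lambda>t. integral {0..} (\<lambda>\<omega>. E \<omega> t *v (cos (\<omega> * z) *\<^sub>R cos_int f \<omega>))) \<longlongrightarrow> (pi / 2) *\<^sub>R f z) (at_right 0)"
  proof (rule gaussian_summation[OF inverse_cosine_integrand_continuous _ fejer_theorem[OF f z lp]])
    show "norm (cos (\<omega> * z) *\<^sub>R cos_int f \<omega>) \<le> K" for \<omega>
      using mult_left_le_one_le[of "norm (cos_int f \<omega>)" "\<bar>cos (\<omega> * z)\<bar>"] norm_cos_int_f[of \<omega>] by simp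
  qed
  then have V: "((\<lambda>t. cos_int (V t) z) \<longlongrightarrow> (pi / 2) *\<^sub>R f z) (at_right 0)"
    by (simp add: cos_int_def V_def matrix_vector_mult.scaleR_right)
  obtain C where C: "C \<ge> 0" "\<And>\<omega> r. 0 \<le> r \<Longrightarrow> r \<le> 1 \<Longrightarrow> norm (G c \<omega> r) \<le> C / (1 + \<omega>\<^sup>2)"
    using G_bounds[OF c_cont zero_le_one] by metis
  have qd: "quad_decay C (\<lambda>\<omega>. G c \<omega> r)" if "0 \<le> r" "r \<le> 1" for r
    unfolding quad_decay_def using C(2)[OF that] continuous_on_G(1)[OF c_cont that(1)] by simp
  have "((\<lambda>t. integral {0..} (\<lambda>\<omega>. cos (\<omega> * z) *\<^sub>R G c \<omega> t)) \<longlongrightarrow> integral {0..} (\<lambda>\<omega>. cos (\<omega> * z) *\<^sub>R G c \<omega> 0)) (at 0 within {0..1})"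
  proof (rule dominated_convergence_at_within[OF _ inverse_quadratic_integrable[of C]])
    fix r :: real assume r: "r \<in> {0..1}"
    then show "(\<lambda>\<omega>. cos (\<omega> * z) *\<^sub>R G c \<omega> r) integrable_on {0..}"
      by (intro quad_decay_trig_integrable(1)[OF qd]) auto
    fix \<omega> :: real
    have "norm (cos (\<omega> * z) *\<^sub>R G c \<omega> r) \<le> norm (G c \<omega> r)"
      by (simp add: mult_left_le_one_le)
    also have "\<dots> \<le> C / (1 + \<omega>\<^sup>2)"
      using r by (intro C(2)) auto
    finally show "norm (cos (\<omega> * z) *\<^sub>R G c \<omega> r) \<le> C / (1 + \<omega>\<^sup>2)" .
  next
    fix \<omega> :: real
    have "continuous (at 0 within {0..}) (G c \<omega>)"
      by (rule has_vector_derivative_continuous[OF G_deriv_time[OF c_cont order_refl]])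
    then have "(G c \<omega> \<longlongrightarrow> G c \<omega> 0) (at 0 within {0..1})"
      unfolding continuous_within by (rule tendsto_within_subset) auto
    then show "((\<lambda>r. cos (\<omega> * z) *\<^sub>R G c \<omega> r) \<longlongrightarrow> cos (\<omega> * z) *\<^sub>R G c \<omega> 0) (at 0 within {0..1})"
      by (intro tendsto_scaleR tendsto_const)
  qed
  then have "((\<lambda>t. cos_int (\<lambda>\<omega>. G c \<omega> t) z) \<longlongrightarrow> 0) (at_right 0)"
    by (simp add: cos_int_def at_within_Icc_at_right G_def)
  from tendsto_scaleR[OF tendsto_const tendsto_diff[OF V this], of "2 / pi"] show ?thesis
    by (simp add: u_sol_eq)
qed

text \<open>At t = 0 the Gaussian factor is gone, and for integrable \<open>f\<close> the remaining
  integral may diverge or converge only conditionally. If it converges, its value agrees with the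
  limit of its Cesaro means.\<close>

lemma u_sol_at_0:
  assumes z: "z > 0" and lp: "lebesgue_point f z" and int: "integrand1 A B f z 0 integrable_on {0..}"
  shows "u_sol A B f g z 0 = f z"
proof -
  let ?S = "\<lambda>\<omega>. cos (\<omega> * z) *\<^sub>R cos_int f \<omega>"
  have S: "integrand1 A B f z 0 = ?S"
    by (simp add: integrand1_eq V_def)
  have "((\<lambda>R. (1 / R) *\<^sub>R integral {0..R} (\<lambda>r. integral {0..r} ?S)) \<longlongrightarrow> integral {0..} ?S) at_top"
    using int unfolding S
    by (intro cesaro_mean_tendsto continuous_integral_upto inverse_cosine_integrand_continuous integral_upto_tendsto)
  from tendsto_unique[OF _ this fejer_theorem[OF f z lp]]
  have "integral {0..} ?S = (pi / 2) *\<^sub>R f z" by simp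
  moreover have "integrand2 A B g z 0 = (\<lambda>_. 0)"
    by (simp add: integrand2_eq G_def)
  ultimately show ?thesis
    by (simp add: u_sol_def S)
qed

text \<open>Lebesgue points contain almost every point and every point of continuity, so they are
  the common hypothesis behind both clauses of the pointwise notion.\<close>

lemma essentially_everywhere_lebesgue_point:
  assumes "\<And>z. z > 0 \<Longrightarrow> lebesgue_point f z \<Longrightarrow> Q z"
  shows "essentially_everywhere f Q"
  unfolding essentially_everywhere_def
proof (intro conjI allI impI)
  show "AE z in lebesgue. 0 < z \<longrightarrow> Q z"
    using AE_lebesgue_point[OF f] by (rule AE_mp) (use assms in auto)
  show "Q z" if "z > 0" "isCont f z" for z
    using assms isCont_imp_lebesgue_point[OF f that] that(1) by blast
qed

text \<open>Both remainders are dominated by tails of C / (1 + w^2) with constants that depend on t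
  but not on z.\<close>

lemma u_trunc_uniform_limit:
  assumes t: "t > 0"
  shows "uniform_limit S (\<lambda>R z. u_trunc A B f g R z t) (\<lambda>z. u_sol A B f g z t) at_top"
proof -
  obtain D where D: "quad_decay D (V t)" using V_weighted[OF t] by metis
  obtain C where "decaying_profile (\<lambda>\<omega>. G c \<omega> t) (\<lambda>\<omega>. G' c \<omega> t) (\<lambda>\<omega>. G'' c \<omega> t) C"
    using G_profile[OF t] .
  then interpret decaying_profile "\<lambda>\<omega>. G c \<omega> t" "\<lambda>\<omega>. G' c \<omega> t" "\<lambda>\<omega>. G'' c \<omega> t" C .
  define tail where "tail = (\<lambda>C R. integral {0..} (\<lambda>w::real. C / (1 + w\<^sup>2)) - integral {0..R} (\<lambda>w. C / (1 + w\<^sup>2)))"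
  have tail: "(tail C \<longlongrightarrow> 0) at_top" for C
    using tendsto_diff[OF tendsto_const[of "integral {0..} (\<lambda>w::real. C / (1 + w\<^sup>2))"]
        integral_upto_tendsto[OF inverse_quadratic_integrable[of C]]] by (simp add: tail_def)
  have le: "dist (u_trunc A B f g R z t) (u_sol A B f g z t) \<le> (2 / pi) * (tail D R + tail C R)" if R: "R \<ge> 0" for R z
  proof -
    have cos_qd: "quad_decay M (\<lambda>\<omega>. cos (\<omega> * z) *\<^sub>R h \<omega>)" if "quad_decay M h" for M and h :: "real \<Rightarrow> real^2"
      by (rule quad_decay_trig[OF that]) (auto intro!: continuous_intros)
    have 1: "norm (integral {0..R} (integrand1 A B f z t) - integral {0..} (integrand1 A B f z t)) \<le> tail D R"
      unfolding integrand1_eq tail_def by (rule quad_decay_tail[OF cos_qd[OF D] R])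
    have 2: "norm (integral {0..R} (integrand2 A B g z t) - integral {0..} (integrand2 A B g z t)) \<le> tail C R"
      unfolding integrand2_eq tail_def by (rule quad_decay_tail[OF cos_qd[OF profile_decay(1)] R])
    have "u_trunc A B f g R z t - u_sol A B f g z t = (2 / pi) *\<^sub>R
        ((integral {0..R} (integrand1 A B f z t) - integral {0..} (integrand1 A B f z t))
          - (integral {0..R} (integrand2 A B g z t) - integral {0..} (integrand2 A B g z t)))"
      by (simp add: u_trunc_def u_sol_def scaleR_diff_right)
    then have "dist (u_trunc A B f g R z t) (u_sol A B f g z t) = (2 / pi) * norm
        ((integral {0..R} (integrand1 A B f z t) - integral {0..} (integrand1 A B f z t))
          - (integral {0..R} (integrand2 A B g z t) - integral {0..} (integrand2 A B g z t)))"
      by (simp add: dist_norm)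
    also have "\<dots> \<le> (2 / pi) * (tail D R + tail C R)"
      by (intro mult_left_mono order_trans[OF norm_triangle_ineq4 add_mono[OF 1 2]]) simp
    finally show ?thesis .
  qed
  show ?thesis
  proof (rule uniform_limitI)
    fix e :: real assume e: "e > 0"
    have "((\<lambda>R. (2 / pi) * (tail D R + tail C R)) \<longlongrightarrow> (2 / pi) * (0 + 0)) at_top"
      by (intro tendsto_mult tendsto_const tendsto_add tail)
    then have "\<forall>\<^sub>F R in at_top. (2 / pi) * (tail D R + tail C R) < e"
      using e by (intro order_tendstoD(2)) auto
    then show "\<forall>\<^sub>F R in at_top. \<forall>z\<in>S. dist (u_trunc A B f g R z t) (u_sol A B f g z t) < e"
      using eventually_ge_at_top[of 0]
    proof eventually_elim
      case (elim R)
      show ?case using le_less_trans[OF le[OF elim(2)] elim(1)] by blast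
    qed
  qed
qed

lemma u_sol_solves: "solves_problem A B f g (u_sol A B f g)"
  unfolding solves_problem_def
proof (rule exI[of _ "\<lambda>z t. A *v u_sol A B f g z t + B *v u_zz z t"], rule exI[of _ u_z], rule exI[of _ u_zz],
    intro conjI allI impI)
  show "essentially_everywhere f (\<lambda>z. ((\<lambda>t. u_sol A B f g z t) \<longlongrightarrow> f z) (at_right 0))"
    by (rule essentially_everywhere_lebesgue_point) (rule u_sol_initial)
qed (rule u_sol_derivs u_sol_boundary u_sol_at_infinity refl; assumption)+

end

theorem theorem1:
  fixes A B :: "real^2^2" and f g :: "real \<Rightarrow> real^2" and b :: real
  assumes b_def: "b = lambda_min ((1 / 2) *\<^sub>R (B + transpose B))"
    and b_pos: "b > 0"
    and f: "f absolutely_integrable_on {0..}"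
    and g: "continuous_on {0..} g"
  shows
    \<comment> \<open>the integrals defining \<open>u\<close> converge\<close>
    "(\<forall>z\<ge>0. \<forall>t>0. integrand1 A B f z t integrable_on {0..} \<and>
                    integrand2 A B g z t integrable_on {0..}) \<and>
    solves_problem A B f g (u_sol A B f g) \<and>
    \<comment> \<open>the formula itself, evaluated at \<open>t = 0\<close>, also gives \<open>f z\<close> wherever it converges\<close>
    essentially_everywhere f
      (\<lambda>z. integrand1 A B f z 0 integrable_on {0..} \<longrightarrow> u_sol A B f g z 0 = f z) \<and>
    (\<forall>t>0. uniform_limit {0<..} (\<lambda>R z. u_trunc A B f g R z t) (\<lambda>z. u_sol A B f g z t) at_top) \<and>
    (\<forall>z>0. \<forall>t>0. ((\<lambda>R. u_trunc A B f g R z t) \<longlongrightarrow> u_sol A B f g z t) at_top)"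
proof -
  interpret heat_system A B b f g
    using lambda_min_coercive[of B] b_pos f g by unfold_locales (simp_all add: b_def)
  show ?thesis
  proof (intro conjI allI impI)
    show "essentially_everywhere f (\<lambda>z. integrand1 A B f z 0 integrable_on {0..} \<longrightarrow> u_sol A B f g z 0 = f z)"
      by (rule essentially_everywhere_lebesgue_point) (blast intro: u_sol_at_0)
    show "((\<lambda>R. u_trunc A B f g R z t) \<longlongrightarrow> u_sol A B f g z t) at_top" if "z > 0" "t > 0" for z t
      \<comment> \<open>Pointwise convergence is the uniform statement on the singleton containing
        \<open>z\<close>.\<close>
      using tendsto_uniform_limitI[OF u_trunc_uniform_limit[OF that(2)], of z "{z}"] by simp
  qed (simp_all add: integrands_integrable u_sol_solves u_trunc_uniform_limit)
qed

end
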